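(* (Hölder inequality.) Let $\alpha\ge0$ and let $p,p'\in(1,\infty)$ be conjugate exponents, $\frac1p+\frac1{p'}=1$. There is a positive constant $C_\alpha$ such that for all $f\in\mathcal{T}_p^{(\alpha)}(t^\alpha)$ and $g\in\mathcal{T}_{p'}^{(\alpha)}(t^\alpha)$ the pointwise product $fg$ belongs to $\mathcal{T}_1^{(\alpha)}(t^\alpha)$ and $$\|fg\|_{\alpha,1}\le C_\alpha\,\|f\|_{\alpha,p}\,\|g\|_{\alpha,p'}.$$
   Context: Let $\mathcal{S}_+$ be the Schwartz class on $[0,\infty)$. For $f\in\mathcal{S}_+$ and $\alpha>0$ put $W_+^{-\alpha}f(t)=\frac1{\Gamma(\alpha)}\int_t^\infty(s-t)^{\alpha-1}f(s)\,ds$ and $W_+^{\alpha}f(t)=(-1)^n\frac{d^n}{dt^n}W_+^{-(n-\alpha)}f(t)$ with $n=[\alpha]+1$; $W_+^0=\mathrm{Id}$. For $1\le p<\infty$ and $\alpha>0$, $\mathcal{T}_p^{(\alpha)}(t^\alpha)$ is the completion of $\mathcal{S}_+$ in the norm $\|f\|_{\alpha,p}=\frac1{\Gamma(\alpha+1)}\left(\int_0^\infty|W_+^\alpha f(t)|^p t^{\alpha p}dt\right)^{1/p}$; $\mathcal{T}_p^{(0)}(t^0)=L^p(\mathbb{R}^+)$ with $\|\cdot\|_{0,p}=\|\cdot\|_p$. These spaces are continuously embedded in $L^p(\mathbb{R}^+)$ and regarded as subspaces of it. The map $D_+^\alpha f(t)=\frac1{\Gamma(\alpha+1)}t^\alpha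 W_+^\alpha f(t)$ extends to an isometric isomorphism $\mathcal{T}_p^{(\alpha)}(t^\alpha)\to L^p(\mathbb{R}^+)$ with inverse (for $\alpha>0$) $(D_+^\alpha)^{-1}h(t)=\alpha\int_t^\infty(s-t)^{\alpha-1}\frac{h(s)}{s^\alpha}ds$. *)

theory Defs
  imports "HOL-Analysis.Analysis"
begin

text \<open>
  Functions on the half-line are represented by total functions of type
  \<open>real \<Rightarrow> complex\<close>; only their values on \<open>{0..}\<close> matter. Elements of
  \<open>L\<^sup>p(\<real>\<^sup>+)\<close> are represented by arbitrary members of their classes; accordingly
  \<open>Lp_halfline\<close>, \<open>Lp_norm\<close>, \<open>T_space\<close> and \<open>T_norm\<close> below do not
  change when a function is modified on a null set.
\<close>

text \<open>Iterated derivatives on \<open>[0, \<infinity>)\<close>, one-sided at \<open>0\<close>.\<close>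

primrec nderiv :: "nat \<Rightarrow> (real \<Rightarrow> complex) \<Rightarrow> real \<Rightarrow> complex" where
  "nderiv 0 f = f"
| "nderiv (Suc n) f = (\<lambda>t. vector_derivative (nderiv n f) (at t within {0..}))"

definition schwartz_halfline :: "(real \<Rightarrow> complex) set" where
  "schwartz_halfline =
     {f. (\<forall>n. nderiv n f differentiable_on {0..}) \<and>
         (\<forall>m n. bounded ((\<lambda>t. t ^ m *\<^sub>R nderiv n f t) ` {0..}))}"

definition weyl_integral :: "real \<Rightarrow> (real \<Rightarrow> complex) \<Rightarrow> real \<Rightarrow> complex" where
  "weyl_integral \<beta> f t =
     (1 / Gamma \<beta>) *\<^sub>R (LINT s:{t<..}|lebesgue. (s - t) powr (\<beta> - 1) *\<^sub>R f s)"

definition weyl_deriv :: "real \<Rightarrow> (real \<Rightarrow> complex) \<Rightarrow> real \<Rightarrow> complex" where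
  "weyl_deriv \<alpha> f =
     (if \<alpha> = 0 then f
      else (let n = nat \<lfloor>\<alpha>\<rfloor> + 1
            in (\<lambda>t. (-1) ^ n * nderiv n (weyl_integral (real n - \<alpha>) f) t)))"

definition Lp_halfline :: "real \<Rightarrow> (real \<Rightarrow> complex) set" where
  "Lp_halfline p =
     {f. f \<in> borel_measurable (lebesgue_on {0..}) \<and>
         integrable (lebesgue_on {0..}) (\<lambda>t. cmod (f t) powr p)}"

definition Lp_norm :: "real \<Rightarrow> (real \<Rightarrow> complex) \<Rightarrow> real" where
  "Lp_norm p f = (LINT t|lebesgue_on {0..}. cmod (f t) powr p) powr (1 / p)"

text \<open>The norm \<open>\<parallel>\<cdot>\<parallel>\<^bsub>\<alpha>,p\<^esub>\<close> on the Schwartz class, before completion.\<close>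

definition schwartz_norm :: "real \<Rightarrow> real \<Rightarrow> (real \<Rightarrow> complex) \<Rightarrow> real" where
  "schwartz_norm \<alpha> p f =
     1 / Gamma (\<alpha> + 1) *
       (LINT t|lebesgue_on {0..}. cmod (weyl_deriv \<alpha> f t) powr p * t powr (\<alpha> * p)) powr (1 / p)"

text \<open>
  For \<open>\<alpha> > 0\<close> the completion of the Schwartz class is realised inside \<open>L\<^sup>p(\<real>\<^sup>+)\<close>: an
  element of the completion is represented by a sequence of Schwartz functions that is Cauchy
  for \<open>schwartz_norm \<alpha> p\<close>, and is identified with the \<open>L\<^sup>p\<close> limit of this sequence. The
  limit exists because the inclusion into \<open>L\<^sup>p\<close> is continuous on the Schwartz class, and
  it determines the element because the extension of the inclusion is injective.
\<close>

definition completion_seq ::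
  "real \<Rightarrow> real \<Rightarrow> (nat \<Rightarrow> real \<Rightarrow> complex) \<Rightarrow> (real \<Rightarrow> complex) \<Rightarrow> bool" where
  "completion_seq \<alpha> p \<phi> f \<longleftrightarrow>
     (\<forall>n. \<phi> n \<in> schwartz_halfline) \<and>
     (\<forall>\<epsilon>>0. \<exists>N. \<forall>m\<ge>N. \<forall>n\<ge>N. schwartz_norm \<alpha> p (\<lambda>t. \<phi> m t - \<phi> n t) < \<epsilon>) \<and>
     f \<in> Lp_halfline p \<and>
     (\<lambda>n. Lp_norm p (\<lambda>t. \<phi> n t - f t)) \<longlonglongrightarrow> 0"

definition T_space :: "real \<Rightarrow> real \<Rightarrow> (real \<Rightarrow> complex) set" where
  "T_space \<alpha> p = (if \<alpha> = 0 then Lp_halfline p else {f. \<exists>\<phi>. completion_seq \<alpha> p \<phi> f})"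

text \<open>
  The completed norm is the limit of the norms along any representing sequence; by the
  injectivity noted above it does not depend on that sequence.
\<close>

definition T_norm :: "real \<Rightarrow> real \<Rightarrow> (real \<Rightarrow> complex) \<Rightarrow> real" where
  "T_norm \<alpha> p f =
     (if \<alpha> = 0 then Lp_norm p f
      else (THE r. \<exists>\<phi>. completion_seq \<alpha> p \<phi> f \<and> (\<lambda>n. schwartz_norm \<alpha> p (\<phi> n)) \<longlonglongrightarrow> r))"

end

theory Submission
  imports Defs
begin

text \<open>
  Write \<open>\<alpha> = m + \<beta>\<close> with \<open>0 < \<beta> \<le> 1\<close>. By the Leibniz rule and Hardy's inequality the estimate
  for Schwartz functions reduces to the weighted \<open>L\<^sup>1\<close> norm of \<open>W\<^sub>+\<^bsup>\<beta>\<^esup>(u v)\<close>. For \<open>\<beta> < 1\<close>, write \<open>u\<close> and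
  \<open>v\<close> as Weyl integrals of \<open>F = W\<^sub>+\<^bsup>\<beta>\<^esup> u\<close> and \<open>G = W\<^sub>+\<^bsup>\<beta>\<^esup> v\<close>. Then \<open>W\<^sub>+\<^bsup>\<beta>-1\<^esup>(u v)\<close> is an integral of
  \<open>F x G y\<close> against a kernel that is monotone in \<open>t\<close> up to \<open>min x y\<close>, zero afterwards, and bounded by a
  multiple of \<open>\<bar>x - y\<bar>\<^bsup>\<beta>-1\<^esup>\<close>. Hence its variation in \<open>t\<close> needs no pointwise derivative bound,
  and the remaining bilinear form is controlled by a Hardy inequality with a kernel that is
  homogeneous of degree \<open>-1\<close>. The estimate passes to the completion because the
  norm of a limit depends only on the \<open>Lp\<close> limit.
\<close>

section \<open>Bounds for Lp norms\<close>

text \<open>As \<open>t\<close> rises to \<open>min x y\<close>, the kernel does not fade out: it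
  tends to a multiple of \<open>\<bar>x - y\<bar> powr (\<beta> - 1)\<close> and then jumps to 0.
  Its derivative in \<open>t\<close> thus contains a point mass and gives no kernel function for
  \<open>W_+^\<beta>(u v)\<close>. Differences with step \<open>h\<close> see the jump as a mere
  contribution to the variation; the resulting bound is linear in \<open>h\<close>, and Fatou's
  lemma recovers the derivative. The range 0 < \<beta> \<le> 1 is chosen so that integer orders have
  \<beta> = 1, where the fractional integral is the identity and the product rule suffices. In the
  induction over m each derivative that falls on a factor is paid for by one unit of weight on that
  factor, so the weight exponents of the two factors must vary independently. The constant depends
  on p as well as on \<alpha>: through the Hardy constants p and p', and for \<beta> < 1 also
  through the values of \<open>Beta\<close> at \<open>1 - 1/p\<close> and \<open>1 - 1/p'\<close>,
  which come from dilations in Lp. For the completion, the obstacle is that Weyl integrals of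
  positive order have kernels not integrable at infinity, so Lp convergence does not pass through
  them; one difference of the kernel makes it integrable.\<close>

text \<open>
  Norms enter through upper bounds, stated with the extended nonnegative integral, because the
  Bochner integral is \<open>0\<close> on non-integrable functions.
\<close>

definition Lp_le :: "'a measure \<Rightarrow> real \<Rightarrow> ('a \<Rightarrow> 'b::real_normed_vector) \<Rightarrow> real \<Rightarrow> bool" where
  "Lp_le M p f K \<longleftrightarrow> f \<in> borel_measurable M \<and> K \<ge> 0 \<and>
     (\<integral>\<^sup>+x. ennreal (norm (f x) powr p) \<partial>M) \<le> ennreal (K powr p)"

lemma Lp_leD:
  assumes "Lp_le M p f K"
  shows "f \<in> borel_measurable M" "K \<ge> 0"
    "(\<integral>\<^sup>+x. ennreal (norm (f x) powr p) \<partial>M) \<le> ennreal (K powr p)"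
  using assms by (auto simp: Lp_le_def)

lemma Lp_le_mono:
  assumes "Lp_le M p f K" "g \<in> borel_measurable M" "\<And>x. x \<in> space M \<Longrightarrow> norm (g x) \<le> norm (f x)"
    "K \<le> L" "p > 0"
  shows "Lp_le M p g L"
proof -
  have "(\<integral>\<^sup>+x. ennreal (norm (g x) powr p) \<partial>M) \<le> (\<integral>\<^sup>+x. ennreal (norm (f x) powr p) \<partial>M)"
    using assms by (intro nn_integral_mono ennreal_leI powr_mono2) auto
  also have "\<dots> \<le> ennreal (K powr p)" using assms Lp_leD by blast
  also have "\<dots> \<le> ennreal (L powr p)"
    using assms Lp_leD(2)[OF assms(1)] by (intro ennreal_leI powr_mono2) auto
  finally show ?thesis using assms Lp_leD(2)[OF assms(1)] by (auto simp: Lp_le_def)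
qed

text \<open>Enlarging a bound by \<epsilon> makes it positive, so that one may divide by it. Several
  estimates below are proved for positive bounds first; the bound 0 is then reached by letting
  \<epsilon> tend to 0.\<close>

lemma Lp_le_closed:
  assumes "\<And>\<epsilon>. \<epsilon> > 0 \<Longrightarrow> Lp_le M p f (K + \<epsilon>)" "K \<ge> 0" "p > 0"
  shows "Lp_le M p f K"
proof -
  let ?I = "(\<integral>\<^sup>+x. ennreal (norm (f x) powr p) \<partial>M)"
  have "((\<lambda>n. ennreal ((K + 1 / Suc n) powr p)) \<longlongrightarrow> ennreal ((K + 0) powr p)) sequentially"
    using assms by (intro tendsto_intros LIMSEQ_Suc[OF lim_1_over_n] tendsto_powr') auto
  moreover have "\<forall>\<^sub>F n in sequentially. ?I \<le> ennreal ((K + 1 / Suc n) powr p)"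
    using assms(1) by (intro always_eventually allI Lp_leD(3)) auto
  ultimately have "?I \<le> ennreal (K powr p)"
    using tendsto_lowerbound[of "\<lambda>n. ennreal ((K + 1 / Suc n) powr p)" "ennreal ((K + 0) powr p)" sequentially ?I]
    by (simp del: of_nat_Suc)
  then show ?thesis using assms(1)[of 1] assms(2) by (auto simp: Lp_le_def)
qed

lemma Lp_le_scaleR:
  fixes f :: "'a \<Rightarrow> 'b::{real_normed_vector, second_countable_topology}"
  assumes "Lp_le M p f K" "p > 0"
  shows "Lp_le M p (\<lambda>x. c *\<^sub>R f x) (\<bar>c\<bar> * K)"
proof -
  have [measurable]: "f \<in> borel_measurable M" using assms Lp_leD by blast
  have "(\<integral>\<^sup>+x. ennreal (norm (c *\<^sub>R f x) powr p) \<partial>M) = ennreal (\<bar>c\<bar> powr p) * (\<integral>\<^sup>+x. ennreal (norm (f x) powr p) \<partial>M)"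
    by (subst nn_integral_cmult[symmetric])
       (auto simp: ennreal_mult'[symmetric] powr_mult)
  also have "\<dots> \<le> ennreal (\<bar>c\<bar> powr p) * ennreal (K powr p)"
    using assms Lp_leD by (intro mult_left_mono) auto
  also have "\<dots> = ennreal ((\<bar>c\<bar> * K) powr p)"
    using Lp_leD[OF assms(1)] by (simp add: ennreal_mult'[symmetric] powr_mult)
  finally show ?thesis using Lp_leD[OF assms(1)] by (auto simp: Lp_le_def)
qed

text \<open>The tangent at \<open>l\<close> to the convex function \<open>y powr p\<close>, obtained
  from Young's inequality for \<open>y\<close> and \<open>l powr (p-1)\<close>. It is the source of
  Jensen's inequality both for two points and for integrals.\<close>

lemma powr_tangent:
  fixes l y p :: real
  assumes "p \<ge> 1" "l \<ge> 0" "y \<ge> 0"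
  shows "p * l powr (p-1) * y \<le> y powr p + (p-1) * l powr p"
proof (cases "p = 1 \<or> l = 0")
  case True
  then show ?thesis using assms by auto
next
  case False
  define q where "q = p / (p-1)"
  have q: "q > 1" "1/p + 1/q = 1" using assms False by (auto simp: q_def field_simps)
  have "y * l powr (p-1) \<le> y powr p / p + (l powr (p-1)) powr q / q"
    using assms q False by (intro Youngs_inequality) auto
  also have "(l powr (p-1)) powr q = l powr p" using assms False by (simp add: powr_powr q_def)
  finally have "p * (y * l powr (p-1)) \<le> p * (y powr p / p + l powr p / q)" using assms by (intro mult_left_mono) auto
  also have "\<dots> = y powr p + (p-1) * l powr p" using assms False by (simp add: q_def field_simps)
  finally show ?thesis by (simp add: mult_ac)
qed

text \<open>The tangent at the mean \<open>m\<close> is evaluated at \<open>a\<close> and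
  \<open>b\<close> and averaged with the weights \<open>u\<close> and \<open>v\<close>.\<close>

lemma powr_convex_ineq:
  fixes a b u v p :: real
  assumes "p \<ge> 1" "a \<ge> 0" "b \<ge> 0" "u \<ge> 0" "v \<ge> 0" "u + v = 1"
  shows "(u * a + v * b) powr p \<le> u * a powr p + v * b powr p"
proof -
  define m where "m = u * a + v * b"
  have m: "m \<ge> 0" using assms by (simp add: m_def)
  have "u * (p * m powr (p-1) * a) + v * (p * m powr (p-1) * b)
      \<le> u * (a powr p + (p-1) * m powr p) + v * (b powr p + (p-1) * m powr p)"
    using assms m by (intro add_mono mult_left_mono powr_tangent) auto
  moreover have "u * (p * m powr (p-1) * a) + v * (p * m powr (p-1) * b) = p * m powr (p-1) * m"
    by (simp add: m_def algebra_simps)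
  moreover have "m powr (p-1) * m = m powr p" using m by (cases "m = 0") (auto simp: powr_diff)
  moreover have "u * (a powr p + (p-1) * m powr p) + v * (b powr p + (p-1) * m powr p)
      = u * a powr p + v * b powr p + (u + v) * ((p-1) * m powr p)" by (simp add: algebra_simps)
  ultimately have "p * m powr p \<le> u * a powr p + v * b powr p + (p-1) * m powr p"
    using assms by (simp add: mult.assoc)
  then have "m powr p \<le> u * a powr p + v * b powr p" by (simp add: algebra_simps)
  then show ?thesis unfolding m_def .
qed

lemma Lp_le_Minkowski_pos:
  fixes f g :: "'a \<Rightarrow> 'b::{real_normed_vector, second_countable_topology}"
  assumes "Lp_le M p f K" "Lp_le M p g L" "p \<ge> 1" "K > 0" "L > 0"
  shows "Lp_le M p (\<lambda>x. f x + g x) (K + L)"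
proof -
  have [measurable]: "f \<in> borel_measurable M" "g \<in> borel_measurable M" using assms Lp_leD by blast+
  define S where "S = K + L"
  have S: "S > 0" using assms by (simp add: S_def)
  \<comment> \<open>Convexity is applied to the normalised values \<open>norm (f x) / K\<close> and
    \<open>norm (g x) / L\<close> with weights \<open>K/S\<close> and \<open>L/S\<close>. After
    integration each normalised function contributes at most its weight.\<close>
  have pt: "norm (f x + g x) powr p \<le> (S powr (p-1)) * (K powr (1-p) * norm (f x) powr p + L powr (1-p) * norm (g x) powr p)" for x
  proof -
    define a where "a = norm (f x) / K"
    define b where "b = norm (g x) / L"
    have "norm (f x + g x) \<le> K * a + L * b"
      using norm_triangle_ineq assms by (simp add: a_def b_def)
    also have "\<dots> = S * (K/S * a + L/S * b)" using S by (simp add: field_simps)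
    finally have "norm (f x + g x) powr p \<le> (S * (K/S * a + L/S * b)) powr p"
      using assms by (intro powr_mono2) auto
    also have "\<dots> = S powr p * (K/S * a + L/S * b) powr p"
      using S assms by (subst powr_mult) (auto simp: a_def b_def)
    also have "(K/S * a + L/S * b) powr p \<le> K/S * a powr p + L/S * b powr p"
      using S assms
      by (intro powr_convex_ineq) (auto simp: a_def b_def S_def add_divide_distrib[symmetric])
    finally have "norm (f x + g x) powr p \<le> S powr p * (K/S * a powr p + L/S * b powr p)"
      using S by (simp add: mult_left_mono)
    also have "\<dots> = (S powr (p-1)) * (K powr (1-p) * norm (f x) powr p + L powr (1-p) * norm (g x) powr p)"
      using assms S by (simp add: a_def b_def powr_divide powr_diff field_simps)
    finally show ?thesis .
  qed
  have "(\<integral>\<^sup>+x. ennreal (norm (f x + g x) powr p) \<partial>M) \<le> (\<integral>\<^sup>+x. ennreal ((S powr (p-1)) * (K powr (1-p) * norm (f x) powr p + L powr (1-p) * norm (g x) powr p)) \<partial>M)"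
    by (intro nn_integral_mono ennreal_leI pt)
  also have "\<dots> = ennreal (S powr (p-1)) * (ennreal (K powr (1-p)) * (\<integral>\<^sup>+x. ennreal (norm (f x) powr p) \<partial>M) + ennreal (L powr (1-p)) * (\<integral>\<^sup>+x. ennreal (norm (g x) powr p) \<partial>M))"
    by (simp add: ennreal_mult nn_integral_cmult nn_integral_add)
  also have "\<dots> \<le> ennreal (S powr (p-1)) * (ennreal (K powr (1-p)) * ennreal (K powr p) + ennreal (L powr (1-p)) * ennreal (L powr p))"
    using assms by (intro mult_left_mono add_mono Lp_leD) auto
  also have "\<dots> = ennreal (S powr (p-1) * (K powr (1-p) * K powr p + L powr (1-p) * L powr p))"
    by (simp add: ennreal_mult)
  also have "S powr (p-1) * (K powr (1-p) * K powr p + L powr (1-p) * L powr p) = S powr p"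
    using assms S by (simp add: powr_add[symmetric] powr_diff S_def)
  finally show ?thesis using assms S by (auto simp: Lp_le_def S_def)
qed

lemma Lp_le_Minkowski:
  fixes f g :: "'a \<Rightarrow> 'b::{real_normed_vector, second_countable_topology}"
  assumes "Lp_le M p f K" "Lp_le M p g L" "p \<ge> 1"
  shows "Lp_le M p (\<lambda>x. f x + g x) (K + L)"
proof (rule Lp_le_closed)
  fix \<epsilon> :: real assume e: "\<epsilon> > 0"
  have "Lp_le M p f (K + \<epsilon>/2)"
    using assms e by (intro Lp_le_mono[OF assms(1)]) (auto dest: Lp_leD)
  moreover have "Lp_le M p g (L + \<epsilon>/2)"
    using assms e by (intro Lp_le_mono[OF assms(2)]) (auto dest: Lp_leD)
  ultimately have "Lp_le M p (\<lambda>x. f x + g x) (K + \<epsilon>/2 + (L + \<epsilon>/2))"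
    using assms e Lp_leD[OF assms(1)] Lp_leD[OF assms(2)] by (intro Lp_le_Minkowski_pos) auto
  then show "Lp_le M p (\<lambda>x. f x + g x) (K + L + \<epsilon>)" by (simp add: algebra_simps)
qed (use assms Lp_leD[OF assms(1)] Lp_leD[OF assms(2)] in auto)

section \<open>Hoelder's inequality and Minkowski's inequality for integrals\<close>

lemma Lp_le_Holder_pos:
  fixes f :: "'a \<Rightarrow> 'b::{real_normed_vector, second_countable_topology}"
    and g :: "'a \<Rightarrow> 'c::{real_normed_vector, second_countable_topology}"
  assumes "Lp_le M p f K" "Lp_le M q g L" "p > 1" "q > 1" "1 / p + 1 / q = 1" "K > 0" "L > 0"
  shows "(\<integral>\<^sup>+x. ennreal (norm (f x) * norm (g x)) \<partial>M) \<le> ennreal (K * L)"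
proof -
  have [measurable]: "f \<in> borel_measurable M" "g \<in> borel_measurable M" using assms Lp_leD by blast+
  have pt: "norm (f x) * norm (g x) \<le> (K * L) * (K powr -p / p * norm (f x) powr p + L powr -q / q * norm (g x) powr q)" for x
  proof -
    have "(norm (f x) / K) * (norm (g x) / L) \<le> (norm (f x) / K) powr p / p + (norm (g x) / L) powr q / q"
      using assms by (intro Youngs_inequality) auto
    then have "(K * L) * ((norm (f x) / K) * (norm (g x) / L)) \<le> (K * L) * ((norm (f x) / K) powr p / p + (norm (g x) / L) powr q / q)"
      using assms by (intro mult_left_mono) auto
    then show ?thesis using assms by (simp add: powr_divide powr_minus field_simps)
  qed
  have "(\<integral>\<^sup>+x. ennreal (norm (f x) * norm (g x)) \<partial>M) \<le> (\<integral>\<^sup>+x. ennreal ((K * L) * (K powr -p / p * norm (f x) powr p + L powr -q / q * norm (g x) powr q)) \<partial>M)"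
    by (intro nn_integral_mono ennreal_leI pt)
  also have "\<dots> = (\<integral>\<^sup>+x. ennreal (K * L) * (ennreal (K powr -p / p) * ennreal (norm (f x) powr p) + ennreal (L powr -q / q) * ennreal (norm (g x) powr q)) \<partial>M)"
    using assms by (intro nn_integral_cong) (simp add: ennreal_mult[symmetric] ennreal_plus[symmetric] del: ennreal_plus)
  also have "\<dots> = ennreal (K * L) * (ennreal (K powr -p / p) * (\<integral>\<^sup>+x. ennreal (norm (f x) powr p) \<partial>M) + ennreal (L powr -q / q) * (\<integral>\<^sup>+x. ennreal (norm (g x) powr q) \<partial>M))"
    by (simp add: nn_integral_cmult nn_integral_add)
  also have "\<dots> \<le> ennreal (K * L) * (ennreal (K powr -p / p) * ennreal (K powr p) + ennreal (L powr -q / q) * ennreal (L powr q))"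
    using assms by (intro mult_left_mono add_mono Lp_leD) auto
  also have "\<dots> = ennreal ((K * L) * (K powr -p / p * K powr p + L powr -q / q * L powr q))"
    using assms by (simp add: ennreal_mult[symmetric] ennreal_plus[symmetric] del: ennreal_plus)
  also have "(K * L) * (K powr -p / p * K powr p + L powr -q / q * L powr q) = K * L"
    using assms by (simp add: powr_add[symmetric] powr_minus divide_simps)
  finally show ?thesis .
qed

lemma Lp_le_Holder:
  fixes f :: "'a \<Rightarrow> 'b::{real_normed_vector, second_countable_topology}"
    and g :: "'a \<Rightarrow> 'c::{real_normed_vector, second_countable_topology}"
  assumes "Lp_le M p f K" "Lp_le M q g L" "p > 1" "q > 1" "1 / p + 1 / q = 1"
  shows "(\<integral>\<^sup>+x. ennreal (norm (f x) * norm (g x)) \<partial>M) \<le> ennreal (K * L)"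
proof -
  let ?I = "(\<integral>\<^sup>+x. ennreal (norm (f x) * norm (g x)) \<partial>M)"
  have "((\<lambda>n. ennreal ((K + 1 / Suc n) * (L + 1 / Suc n))) \<longlongrightarrow> ennreal ((K + 0) * (L + 0))) sequentially"
    using assms by (intro tendsto_intros LIMSEQ_Suc[OF lim_1_over_n])
  moreover have "?I \<le> ennreal ((K + 1 / Suc n) * (L + 1 / Suc n))" for n
    using assms Lp_leD(2)[OF assms(1)] Lp_leD(2)[OF assms(2)] 
    by (intro Lp_le_Holder_pos[of M p f _ q g] Lp_le_mono[OF assms(1)] Lp_le_mono[OF assms(2)]) (auto dest: Lp_leD intro!: add_nonneg_pos)
  ultimately show "?I \<le> ennreal (K * L)"
    using tendsto_lowerbound[of _ _ sequentially ?I] by simp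
qed

text \<open>Jensen's inequality for the density \<open>c\<close>, of total mass at most
  \<open>D\<close>, applied to the quotient \<open>h z x / c z\<close>: it bounds
  \<open>norm (g x) powr p\<close> by \<open>D powr (p-1)\<close> times the integral over
  \<open>z\<close> of \<open>c z powr (1-p) * h z x powr p\<close>. Fubini and the bound on each
  \<open>h z\<close> then leave only the integral of \<open>c\<close>.\<close>

lemma Lp_le_integral_Minkowski:
  fixes h :: "'z \<Rightarrow> 'a \<Rightarrow> real"
  assumes "sigma_finite_measure M" "sigma_finite_measure N"
  and h [measurable]: "(\<lambda>(z, x). h z x) \<in> borel_measurable (N \<Otimes>\<^sub>M M)" and h0: "\<And>z x. h z x \<ge> 0"
  and c [measurable]: "c \<in> borel_measurable N" and hc: "\<And>z. Lp_le M p (h z) (c z)"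
  and c0: "\<And>z x. c z = 0 \<Longrightarrow> h z x = 0"
  and C: "(\<integral>\<^sup>+z. ennreal (c z) \<partial>N) \<le> ennreal C" and "C \<ge> 0" and p: "p \<ge> 1"
  and g [measurable]: "g \<in> borel_measurable M"
  and gh: "\<And>x. x \<in> space M \<Longrightarrow> ennreal (norm (g x)) \<le> (\<integral>\<^sup>+z. ennreal (h z x) \<partial>N)"
  shows "Lp_le M p g C"
proof (rule Lp_le_closed)
  fix \<epsilon> :: real assume e: "\<epsilon> > 0"
  interpret M: sigma_finite_measure M by fact
  interpret N: sigma_finite_measure N by fact
  interpret pair_sigma_finite N M ..
  define D where "D = C + \<epsilon>"
  have D: "D > 0" using e assms by (simp add: D_def)
  have CD: "(\<integral>\<^sup>+z. ennreal (c z) \<partial>N) \<le> ennreal D"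
    using C e by (rule_tac order_trans[OF C]) (auto simp: D_def intro: ennreal_leI)
  have cpos: "c z \<ge> 0" for z using hc Lp_leD by blast
  have key: "ennreal (norm (g x) powr p) \<le> ennreal (D powr (p-1)) * (\<integral>\<^sup>+z. ennreal (c z powr (1-p) * h z x powr p) \<partial>N)"
    if x: "x \<in> space M" for x
  proof -
    define l where "l = norm (g x) / D"
    have l: "l \<ge> 0" using D by (simp add: l_def)
    have hx [measurable]: "(\<lambda>z. h z x) \<in> borel_measurable N"
      using measurable_compose[OF measurable_Pair2'[OF x] h] by simp
    define J where "J = (\<integral>\<^sup>+z. ennreal (c z powr (1-p) * h z x powr p) \<partial>N)"
    \<comment> \<open>The tangent at \<open>l\<close>, multiplied by \<open>c z\<close>. Where
      \<open>c z = 0\<close> the quotient is meaningless, and the hypothesis that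
      \<open>h z x\<close> vanishes there takes over.\<close>
    have pz: "p * l powr (p-1) * h z x \<le> c z powr (1-p) * h z x powr p + (p-1) * l powr p * c z" for z
    proof (cases "c z = 0")
      case True
      then show ?thesis using c0[OF True, of x] by auto
    next
      case False
      then have cz: "c z > 0" using cpos[of z] by simp
      have "c z * (p * l powr (p-1) * (h z x / c z)) \<le> c z * ((h z x / c z) powr p + (p-1) * l powr p)"
        using powr_tangent[of p l "h z x / c z"] p l h0[of z x] cz by (intro mult_left_mono) auto
      then show ?thesis using cz h0[of z x] by (simp add: powr_divide powr_diff field_simps)
    qed
    have "ennreal (p * l powr (p-1) * norm (g x)) = ennreal (p * l powr (p-1)) * ennreal (norm (g x))"
      using p by (simp add: ennreal_mult)
    also have "\<dots> \<le> ennreal (p * l powr (p-1)) * (\<integral>\<^sup>+z. ennreal (h z x) \<partial>N)"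
      using gh[OF x] by (intro mult_left_mono) auto
    also have "\<dots> = (\<integral>\<^sup>+z. ennreal (p * l powr (p-1) * h z x) \<partial>N)"
      using p h0 by (subst nn_integral_cmult[symmetric]) (auto simp: ennreal_mult)
    also have "\<dots> \<le> (\<integral>\<^sup>+z. ennreal (c z powr (1-p) * h z x powr p + (p-1) * l powr p * c z) \<partial>N)"
      by (intro nn_integral_mono ennreal_leI pz)
    also have "\<dots> = (\<integral>\<^sup>+z. ennreal (c z powr (1-p) * h z x powr p) + ennreal ((p-1) * l powr p) * ennreal (c z) \<partial>N)"
      using p cpos by (intro nn_integral_cong) (simp add: ennreal_mult[symmetric] ennreal_plus[symmetric] del: ennreal_plus)
    also have "\<dots> = J + ennreal ((p-1) * l powr p) * (\<integral>\<^sup>+z. ennreal (c z) \<partial>N)"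
      by (simp add: J_def nn_integral_add nn_integral_cmult)
    also have "\<dots> \<le> J + ennreal ((p-1) * l powr p) * ennreal D"
      using CD by (intro add_left_mono mult_left_mono) auto
    also have "\<dots> = J + ennreal ((p-1) * l powr p * D)"
      using p D by (simp add: ennreal_mult)
    finally have J: "ennreal (p * l powr (p-1) * norm (g x)) \<le> J + ennreal ((p-1) * l powr p * D)" .
    have gl: "norm (g x) = l * D" using D by (simp add: l_def)
    have eq: "p * l powr (p-1) * norm (g x) = l powr p * D + (p-1) * l powr p * D"
      unfolding gl using l by (cases "l = 0") (auto simp: powr_diff algebra_simps)
    have "ennreal (l powr p * D) + ennreal ((p-1) * l powr p * D) \<le> J + ennreal ((p-1) * l powr p * D)"
      using J p D unfolding eq by (simp add: ennreal_plus[symmetric] del: ennreal_plus)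
    \<comment> \<open>The choice \<open>l = norm (g x) / D\<close> makes the left side split off
      exactly the error term of the tangent inequality. This summand is finite, hence can be
      cancelled in \<open>ennreal\<close>.\<close>
    then have J2: "ennreal (l powr p * D) \<le> J"
      by (simp add: add.commute[of _ "ennreal ((p-1) * l powr p * D)"])
    have "norm (g x) powr p = D powr (p-1) * (l powr p * D)"
      unfolding gl using l D by (simp add: powr_mult powr_diff)
    then have "ennreal (norm (g x) powr p) = ennreal (D powr (p-1)) * ennreal (l powr p * D)"
      using D by (simp add: ennreal_mult)
    also have "\<dots> \<le> ennreal (D powr (p-1)) * J" using J2 by (intro mult_left_mono) auto
    finally show ?thesis by (simp add: J_def)
  qed
  have hz [measurable]: "h z \<in> borel_measurable M" for z using hc Lp_leD by blast
  have "(\<integral>\<^sup>+x. ennreal (norm (g x) powr p) \<partial>M) \<le> (\<integral>\<^sup>+x. ennreal (D powr (p-1)) * (\<integral>\<^sup>+z. ennreal (c z powr (1-p) * h z x powr p) \<partial>N) \<partial>M)"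
    by (intro nn_integral_mono key)
  also have "\<dots> = ennreal (D powr (p-1)) * (\<integral>\<^sup>+x. (\<integral>\<^sup>+z. ennreal (c z powr (1-p) * h z x powr p) \<partial>N) \<partial>M)"
  proof (rule nn_integral_cmult)
    have "(\<lambda>(z, x). ennreal (c z powr (1-p) * h z x powr p)) \<in> borel_measurable (N \<Otimes>\<^sub>M M)" by measurable
    from measurable_compose[OF measurable_pair_swap' this]
    have [measurable]: "(\<lambda>(x, z). ennreal (c z powr (1-p) * h z x powr p)) \<in> borel_measurable (M \<Otimes>\<^sub>M N)"
      by (simp add: case_prod_unfold)
    show "(\<lambda>x. \<integral>\<^sup>+z. ennreal (c z powr (1-p) * h z x powr p) \<partial>N) \<in> borel_measurable M"
      by measurable
  qed
  also have "(\<integral>\<^sup>+x. (\<integral>\<^sup>+z. ennreal (c z powr (1-p) * h z x powr p) \<partial>N) \<partial>M) = (\<integral>\<^sup>+z. (\<integral>\<^sup>+x. ennreal (c z powr (1-p) * h z x powr p) \<partial>M) \<partial>N)"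
    by (rule Fubini'[of "\<lambda>z x. ennreal (c z powr (1-p) * h z x powr p)"]) measurable
  also have "\<dots> \<le> (\<integral>\<^sup>+z. ennreal (c z) \<partial>N)"
  proof (rule nn_integral_mono)
    fix z
    have "(\<integral>\<^sup>+x. ennreal (c z powr (1-p) * h z x powr p) \<partial>M) = ennreal (c z powr (1-p)) * (\<integral>\<^sup>+x. ennreal (norm (h z x) powr p) \<partial>M)"
      using h0 by (subst nn_integral_cmult[symmetric]) (auto simp: ennreal_mult)
    also have "\<dots> \<le> ennreal (c z powr (1-p)) * ennreal (c z powr p)"
      using hc by (intro mult_left_mono Lp_leD) auto
    also have "\<dots> = ennreal (c z powr (1-p) * c z powr p)" by (simp add: ennreal_mult)
    also have "c z powr (1-p) * c z powr p = c z"
      using cpos[of z] by (simp add: powr_add[symmetric])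
    finally show "(\<integral>\<^sup>+x. ennreal (c z powr (1-p) * h z x powr p) \<partial>M) \<le> ennreal (c z)" .
  qed
  also have "\<dots> \<le> ennreal D" by (rule CD)
  finally have "(\<integral>\<^sup>+x. ennreal (norm (g x) powr p) \<partial>M) \<le> ennreal (D powr (p-1)) * ennreal D"
    by (simp add: mult_left_mono)
  also have "\<dots> = ennreal (D powr p)" using D by (simp add: ennreal_mult[symmetric] powr_diff)
  finally show "Lp_le M p g (C + \<epsilon>)" using D by (auto simp: Lp_le_def D_def)
qed (use assms in auto)

section \<open>Calculus on the half-line\<close>

definition rapid :: "(real \<Rightarrow> complex) \<Rightarrow> bool" where
  "rapid f \<longleftrightarrow> continuous_on {0..} f \<and> (\<forall>m::nat. \<exists>B. \<forall>t\<ge>0. (1 + t) ^ m * cmod (f t) \<le> B)"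

definition hderiv :: "(real \<Rightarrow> complex) \<Rightarrow> (real \<Rightarrow> complex) \<Rightarrow> bool" where
  "hderiv f f' \<longleftrightarrow> (\<forall>t\<ge>0. (f has_vector_derivative f' t) (at t within {0..}))"

text \<open>A total function representing a function on the half-line is arbitrary at negative
  arguments, so it need not even be measurable there. Extension by zero allows substitutions and
  Fubini over the whole line.\<close>

definition zext :: "(real \<Rightarrow> complex) \<Rightarrow> real \<Rightarrow> complex" where
  "zext f t = indicator {0..} t *\<^sub>R f t"

lemma at_within_halfline_neq_bot:
  assumes "t \<ge> 0" shows "at t within {0::real..} \<noteq> bot"
proof -
  have "at_right t \<le> at t within {0..}" using assms by (intro at_le) auto
  then show ?thesis using trivial_limit_at_right_real[of t] by (metis bot.extremum_uniqueI trivial_limit_def)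
qed

lemma hderiv_vector_derivative:
  assumes "hderiv f f'" "t \<ge> 0"
  shows "vector_derivative f (at t within {0..}) = f' t"
  using assms at_within_halfline_neq_bot[of t] by (auto simp: hderiv_def intro: vector_derivative_within)

lemma hderiv_cong:
  assumes "hderiv f f'" "\<And>t. t \<ge> 0 \<Longrightarrow> f t = g t" "\<And>t. t \<ge> 0 \<Longrightarrow> f' t = g' t"
  shows "hderiv g g'"
  unfolding hderiv_def
proof (intro allI impI)
  fix t :: real assume t: "t \<ge> 0"
  have "(f has_vector_derivative g' t) (at t within {0..})"
    using assms(1,3) t by (auto simp: hderiv_def)
  then show "(g has_vector_derivative g' t) (at t within {0..})"
    by (rule has_vector_derivative_transform[rotated 2]) (use t assms(2) in auto)
qed

lemma rapid_cong:
  assumes "rapid f" "\<And>t. t \<ge> 0 \<Longrightarrow> f t = g t"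
  shows "rapid g"
proof -
  have "continuous_on {0..} g \<longleftrightarrow> continuous_on {0..} f"
    using assms(2) by (intro continuous_on_cong) auto
  then show ?thesis using assms by (simp add: rapid_def)
qed

lemma rapid_bound:
  assumes "rapid f"
  obtains B where "B \<ge> 0" "\<And>t. t \<ge> 0 \<Longrightarrow> cmod (f t) \<le> B / (1 + t) ^ m"
proof -
  obtain B where B: "\<And>t. t \<ge> 0 \<Longrightarrow> (1 + t) ^ m * cmod (f t) \<le> B"
    using assms unfolding rapid_def by blast
  show ?thesis
  proof
    show "B \<ge> 0" using B[of 0] by (simp add: order_trans[OF norm_ge_zero])
    fix t :: real assume t: "t \<ge> 0"
    then show "cmod (f t) \<le> B / (1 + t) ^ m" using B[OF t] by (simp add: field_simps)
  qed
qed

lemma rapidI: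
  assumes "continuous_on {0..} f" "\<And>m. \<exists>B. \<forall>t\<ge>0. cmod (f t) \<le> B / (1 + t) ^ m"
  shows "rapid f"
  unfolding rapid_def
proof (intro conjI allI)
  fix m
  obtain B where B: "\<forall>t\<ge>0. cmod (f t) \<le> B / (1 + t) ^ m" using assms(2) by blast
  then have "\<forall>t\<ge>0. (1 + t) ^ m * cmod (f t) \<le> B" by (auto simp: field_simps)
  then show "\<exists>B. \<forall>t\<ge>0. (1 + t) ^ m * cmod (f t) \<le> B" ..
qed fact

lemma rapid_add:
  assumes "rapid f" "rapid g" shows "rapid (\<lambda>t. f t + g t)"
proof (rule rapidI)
  show "continuous_on {0..} (\<lambda>t. f t + g t)" using assms by (auto simp: rapid_def intro!: continuous_intros)
  fix m
  obtain B where B: "\<And>t. t \<ge> 0 \<Longrightarrow> cmod (f t) \<le> B / (1 + t) ^ m" using assms(1) by (rule rapid_bound) blast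
  obtain C where C: "\<And>t. t \<ge> 0 \<Longrightarrow> cmod (g t) \<le> C / (1 + t) ^ m" using assms(2) by (rule rapid_bound) blast
  have "cmod (f t + g t) \<le> (B + C) / (1 + t) ^ m" if "t \<ge> 0" for t
    using norm_triangle_ineq[of "f t" "g t"] B[OF that] C[OF that] by (simp add: add_divide_distrib)
  then show "\<exists>B. \<forall>t\<ge>0. cmod (f t + g t) \<le> B / (1 + t) ^ m" by blast
qed

lemma rapid_mult:
  assumes "rapid f" "rapid g" shows "rapid (\<lambda>t. f t * g t)"
proof (rule rapidI)
  show "continuous_on {0..} (\<lambda>t. f t * g t)" using assms by (auto simp: rapid_def intro!: continuous_intros)
  fix m
  obtain B where B: "B \<ge> 0" "\<And>t. t \<ge> 0 \<Longrightarrow> cmod (f t) \<le> B / (1 + t) ^ m" using assms(1) by (rule rapid_bound) blast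
  obtain C where C: "\<And>t. t \<ge> 0 \<Longrightarrow> cmod (g t) \<le> C / (1 + t) ^ 0" using assms(2) by (rule rapid_bound) blast
  have "cmod (f t * g t) \<le> (B * C) / (1 + t) ^ m" if "t \<ge> 0" for t
    using mult_mono[OF B(2)[OF that] C[OF that]] that B(1) by (simp add: norm_mult)
  then show "\<exists>B. \<forall>t\<ge>0. cmod (f t * g t) \<le> B / (1 + t) ^ m" by blast
qed

lemma rapid_cmult:
  assumes "rapid f" shows "rapid (\<lambda>t. c * f t)"
proof (rule rapidI)
  show "continuous_on {0..} (\<lambda>t. c * f t)" using assms by (auto simp: rapid_def intro!: continuous_intros)
  fix m
  obtain B where B: "B \<ge> 0" "\<And>t. t \<ge> 0 \<Longrightarrow> cmod (f t) \<le> B / (1 + t) ^ m" using assms(1) by (rule rapid_bound) blast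
  have "cmod (c * f t) \<le> (cmod c * B) / (1 + t) ^ m" if "t \<ge> 0" for t
    using mult_left_mono[OF B(2)[OF that], of "cmod c"] by (simp add: norm_mult)
  then show "\<exists>B. \<forall>t\<ge>0. cmod (c * f t) \<le> B / (1 + t) ^ m" by blast
qed

lemma rapid_shift:
  assumes "rapid f" "h \<ge> 0" shows "rapid (\<lambda>t. f (t + h))"
proof (rule rapidI)
  show "continuous_on {0..} (\<lambda>t. f (t + h))"
    using assms by (auto simp: rapid_def intro!: continuous_intros continuous_on_compose2[of "{0..}" f])
  fix m
  obtain B where B: "B \<ge> 0" "\<And>t. t \<ge> 0 \<Longrightarrow> cmod (f t) \<le> B / (1 + t) ^ m" using assms(1) by (rule rapid_bound) blast
  have "cmod (f (t + h)) \<le> B / (1 + t) ^ m" if "t \<ge> 0" for t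
  proof -
    have "cmod (f (t + h)) \<le> B / (1 + (t + h)) ^ m" using B(2)[of "t+h"] that assms by simp
    also have "\<dots> \<le> B / (1 + t) ^ m"
      using that assms B(1) by (intro divide_left_mono power_mono mult_pos_pos) auto
    finally show ?thesis .
  qed
  then show "\<exists>B. \<forall>t\<ge>0. cmod (f (t + h)) \<le> B / (1 + t) ^ m" by blast
qed

lemma hderiv_add: "hderiv f f' \<Longrightarrow> hderiv g g' \<Longrightarrow> hderiv (\<lambda>t. f t + g t) (\<lambda>t. f' t + g' t)"
  by (auto simp: hderiv_def intro!: derivative_intros)

lemma hderiv_cmult: "hderiv f f' \<Longrightarrow> hderiv (\<lambda>t. c * f t) (\<lambda>t. c * f' t)"
  by (auto simp: hderiv_def intro!: derivative_intros)

lemma hderiv_mult: "hderiv f f' \<Longrightarrow> hderiv g g' \<Longrightarrow> hderiv (\<lambda>t. f t * g t) (\<lambda>t. f' t * g t + f t * g' t)"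
  unfolding hderiv_def by (subst add.commute) (auto intro!: derivative_intros)

lemma hderiv_shift:
  assumes "hderiv f f'" "h \<ge> 0" shows "hderiv (\<lambda>t. f (t + h)) (\<lambda>t. f' (t + h))"
  unfolding hderiv_def
proof (intro allI impI)
  fix t :: real assume t: "t \<ge> 0"
  have *: "((\<lambda>t. t + h) has_vector_derivative 1) (at t within {0..})"
    by (auto intro!: derivative_eq_intros)
  have "(f has_vector_derivative f' (t + h)) (at (t + h) within ((\<lambda>t. t + h) ` {0..}))"
    by (rule has_vector_derivative_within_subset[of _ _ _ "{0..}"])
       (use assms t in \<open>auto simp: hderiv_def\<close>)
  from vector_diff_chain_within[OF * this]
  show "((\<lambda>t. f (t + h)) has_vector_derivative f' (t + h)) (at t within {0..})"
    by (simp add: o_def)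
qed

lemma hderiv_Lipschitz:
  assumes "hderiv f f'" "a \<ge> 0" "\<And>t. t \<ge> a \<Longrightarrow> cmod (f' t) \<le> B" "x \<ge> a" "y \<ge> a"
  shows "cmod (f x - f y) \<le> B * \<bar>x - y\<bar>"
proof -
  have "norm (f x - f y) \<le> B * norm (x - y)"
  proof (rule differentiable_bound[of "{a..}" f "\<lambda>t h. h *\<^sub>R f' t"])
    fix t assume "t \<in> {a..}"
    then show "(f has_derivative (\<lambda>h. h *\<^sub>R f' t)) (at t within {a..})"
      using assms(1,2) unfolding hderiv_def has_vector_derivative_def
      by (auto intro: has_derivative_subset[of _ _ _ "{0..}"])
    show "onorm (\<lambda>h. h *\<^sub>R f' t) \<le> B"
      using \<open>t \<in> {a..}\<close> assms(3)[of t] by (auto simp: onorm_scaleR_left bounded_linear_ident onorm_id)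
  qed (use assms in auto)
  then show ?thesis by simp
qed

section \<open>The Schwartz class\<close>

lemma nderiv_cong:
  assumes "\<And>t. t \<ge> 0 \<Longrightarrow> f t = g t" "t \<ge> 0"
  shows "nderiv n f t = nderiv n g t"
  using assms(2)
proof (induction n arbitrary: t)
  case (Suc n)
  have "(nderiv n f has_vector_derivative d) (at t within {0..}) \<longleftrightarrow>
        (nderiv n g has_vector_derivative d) (at t within {0..})" for d
    using Suc by (auto intro: has_vector_derivative_transform[rotated 2])
  then show ?case by (simp add: vector_derivative_def)
qed (use assms in auto)

lemma nderiv_add: "nderiv (m + n) f = nderiv m (nderiv n f)"
  by (induction m) auto

lemma nderiv_Suc_right: "nderiv (Suc n) f = nderiv n (nderiv 1 f)"
  using nderiv_add[of n 1 f] by simp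

lemma schwartz_halflineD:
  assumes "f \<in> schwartz_halfline"
  shows "rapid (nderiv n f)" "hderiv (nderiv n f) (nderiv (Suc n) f)"
proof -
  have d: "nderiv n f differentiable_on {0..}" and b: "\<And>m. bounded ((\<lambda>t. t ^ m *\<^sub>R nderiv n f t) ` {0..})"
    using assms by (auto simp: schwartz_halfline_def)
  show "hderiv (nderiv n f) (nderiv (Suc n) f)"
    using d by (auto simp: hderiv_def differentiable_on_def vector_derivative_works[symmetric])
  show "rapid (nderiv n f)"
  proof (unfold rapid_def, intro conjI allI)
    show "continuous_on {0..} (nderiv n f)" using d by (rule differentiable_imp_continuous_on)
    fix m
    obtain B0 where B0: "\<And>t. t \<ge> 0 \<Longrightarrow> norm (t ^ 0 *\<^sub>R nderiv n f t) \<le> B0"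
      using b[of 0] by (auto simp: bounded_iff)
    obtain B1 where B1: "\<And>t. t \<ge> 0 \<Longrightarrow> norm (t ^ m *\<^sub>R nderiv n f t) \<le> B1"
      using b[of m] by (auto simp: bounded_iff)
    have "(1 + t) ^ m * cmod (nderiv n f t) \<le> 2 ^ m * (B0 + B1)" if t: "t \<ge> 0" for t
    proof -
      \<comment> \<open>Since \<open>1 + t\<close> is at most \<open>2 * max 1 t\<close>, the bounds
        for the powers 0 and \<open>m\<close> of \<open>t\<close> together control the weight
        \<open>(1 + t) ^ m\<close>.\<close>
      have "(1 + t) ^ m \<le> (2 * max 1 t) ^ m" using t by (intro power_mono) auto
      also have "\<dots> = 2 ^ m * max 1 t ^ m" by (simp add: power_mult_distrib)
      also have "max 1 t ^ m \<le> 1 + t ^ m" using t by (auto simp: max_def)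
      finally have "(1 + t) ^ m * cmod (nderiv n f t) \<le> 2 ^ m * (1 + t ^ m) * cmod (nderiv n f t)"
        by (intro mult_right_mono) (auto simp: mult_left_mono)
      also have "\<dots> = 2 ^ m * (cmod (nderiv n f t) + t ^ m * cmod (nderiv n f t))" by (simp add: algebra_simps)
      also have "\<dots> \<le> 2 ^ m * (B0 + B1)" using B0[OF t] B1[OF t] t by (intro mult_left_mono add_mono) auto
      finally show ?thesis .
    qed
    then show "\<exists>B. \<forall>t\<ge>0. (1 + t) ^ m * cmod (nderiv n f t) \<le> B" by blast
  qed
qed

lemma schwartz_halflineI:
  assumes "\<And>n. rapid (nderiv n f)" "\<And>n. hderiv (nderiv n f) (nderiv (Suc n) f)"
  shows "f \<in> schwartz_halfline"
  unfolding schwartz_halfline_def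
proof (intro CollectI conjI allI)
  fix n m
  show "nderiv n f differentiable_on {0..}"
    using assms(2)[of n] by (auto simp: hderiv_def differentiable_on_def intro: differentiableI_vector)
  obtain B where B: "\<And>t. t \<ge> 0 \<Longrightarrow> (1 + t) ^ m * cmod (nderiv n f t) \<le> B"
    using assms(1)[of n] unfolding rapid_def by blast
  have "norm (t ^ m *\<^sub>R nderiv n f t) \<le> B" if "t \<ge> 0" for t
  proof -
    have "t ^ m * cmod (nderiv n f t) \<le> (1 + t) ^ m * cmod (nderiv n f t)"
      using that by (intro mult_right_mono power_mono) auto
    then show ?thesis using B[OF that] that by simp
  qed
  then show "bounded ((\<lambda>t. t ^ m *\<^sub>R nderiv n f t) ` {0..})" by (auto simp: bounded_iff)
qed

text \<open>The Schwartz class is the largest class of \<open>rapid\<close> functions in which every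
  member has a derivative, so closure under an operation follows from a class containing its results
  and their derivatives, with no formula for higher derivatives. A member of \<open>P\<close>
  matches \<open>nderiv n f\<close> only for \<open>t \<ge> 0\<close>, because \<open>hderiv\<close>
  does not determine values at negative arguments.\<close>

lemma schwartz_coinduct:
  assumes P: "P f" and step: "\<And>f. P f \<Longrightarrow> rapid f \<and> (\<exists>f'. P f' \<and> hderiv f f')"
  shows "f \<in> schwartz_halfline"
proof -
  have *: "\<exists>g. P g \<and> (\<forall>t\<ge>0. nderiv n f t = g t)" for n
  proof (induction n)
    case (Suc n)
    then obtain g where g: "P g" "\<And>t. t \<ge> 0 \<Longrightarrow> nderiv n f t = g t" by blast
    obtain g' where g': "P g'" "hderiv g g'" using step[OF g(1)] by blast
    have "hderiv (nderiv n f) g'" using hderiv_cong[OF g'(2)] g(2) by metis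
    from hderiv_vector_derivative[OF this] show ?case using g'(1) by (intro exI[of _ g']) auto
  qed (use P in auto)
  show ?thesis
  proof (rule schwartz_halflineI)
    fix n
    obtain g where g: "P g" "\<And>t. t \<ge> 0 \<Longrightarrow> nderiv n f t = g t" using * by blast
    obtain g' where g': "P g'" "hderiv g g'" using step[OF g(1)] by blast
    show "rapid (nderiv n f)" using rapid_cong[of g "nderiv n f"] step[OF g(1)] g(2) by auto
    have h: "hderiv (nderiv n f) g'" using hderiv_cong[OF g'(2)] g(2) by metis
    show "hderiv (nderiv n f) (nderiv (Suc n) f)"
      by (rule hderiv_cong[OF h]) (use hderiv_vector_derivative[OF h] in auto)
  qed
qed

lemma schwartz_rapid: "f \<in> schwartz_halfline \<Longrightarrow> rapid f"
  using schwartz_halflineD(1)[of f 0] by simp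

lemma schwartz_hderiv: "f \<in> schwartz_halfline \<Longrightarrow> hderiv f (nderiv 1 f)"
  using schwartz_halflineD(2)[of f 0] by simp

lemma schwartz_nderiv: "f \<in> schwartz_halfline \<Longrightarrow> nderiv n f \<in> schwartz_halfline"
  by (rule schwartz_halflineI) (metis nderiv_add add_Suc schwartz_halflineD)+

lemma schwartz_add:
  assumes "f \<in> schwartz_halfline" "g \<in> schwartz_halfline"
  shows "(\<lambda>t. f t + g t) \<in> schwartz_halfline"
proof (rule schwartz_coinduct[where P = "\<lambda>h. \<exists>f\<in>schwartz_halfline. \<exists>g\<in>schwartz_halfline. h = (\<lambda>t. f t + g t)"])
  fix h assume "\<exists>f\<in>schwartz_halfline. \<exists>g\<in>schwartz_halfline. h = (\<lambda>t. f t + g t)"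
  then obtain f g where fg: "f \<in> schwartz_halfline" "g \<in> schwartz_halfline" "h = (\<lambda>t. f t + g t)" by blast
  show "rapid h \<and> (\<exists>h'. (\<exists>f\<in>schwartz_halfline. \<exists>g\<in>schwartz_halfline. h' = (\<lambda>t. f t + g t)) \<and> hderiv h h')"
    unfolding fg(3) using fg(1,2)
    by (blast intro: rapid_add schwartz_rapid hderiv_add schwartz_hderiv schwartz_nderiv)
qed (use assms in blast)

lemma schwartz_cmult:
  assumes "f \<in> schwartz_halfline"
  shows "(\<lambda>t. c * f t) \<in> schwartz_halfline"
proof (rule schwartz_coinduct[where P = "\<lambda>h. \<exists>f\<in>schwartz_halfline. h = (\<lambda>t. c * f t)"])
  fix h assume "\<exists>f\<in>schwartz_halfline. h = (\<lambda>t. c * f t)"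
  then obtain f where fg: "f \<in> schwartz_halfline" "h = (\<lambda>t. c * f t)" by blast
  show "rapid h \<and> (\<exists>h'. (\<exists>f\<in>schwartz_halfline. h' = (\<lambda>t. c * f t)) \<and> hderiv h h')"
    unfolding fg(2) using fg(1)
    by (blast intro: rapid_cmult schwartz_rapid hderiv_cmult schwartz_hderiv schwartz_nderiv)
qed (use assms in blast)

lemma schwartz_shift:
  assumes "f \<in> schwartz_halfline" "h \<ge> 0"
  shows "(\<lambda>t. f (t + h)) \<in> schwartz_halfline"
proof (rule schwartz_coinduct[where P = "\<lambda>k. \<exists>f\<in>schwartz_halfline. k = (\<lambda>t. f (t + h))"])
  fix k assume "\<exists>f\<in>schwartz_halfline. k = (\<lambda>t. f (t + h))"
  then obtain f where fg: "f \<in> schwartz_halfline" "k = (\<lambda>t. f (t + h))" by blast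
  show "rapid k \<and> (\<exists>h'. (\<exists>f\<in>schwartz_halfline. h' = (\<lambda>t. f (t + h))) \<and> hderiv k h')"
    unfolding fg(2) using fg(1) assms(2)
    by (blast intro: rapid_shift schwartz_rapid hderiv_shift schwartz_hderiv schwartz_nderiv)
qed (use assms in blast)

lemma schwartz_diff:
  assumes "f \<in> schwartz_halfline" "g \<in> schwartz_halfline"
  shows "(\<lambda>t. f t - g t) \<in> schwartz_halfline"
  using schwartz_add[OF assms(1) schwartz_cmult[OF assms(2), of "-1"]] by simp

text \<open>
  The product of two Schwartz functions differentiates to a sum of such products, so the
  coinduction needs the additive span.
\<close>

inductive prodspan :: "(real \<Rightarrow> complex) \<Rightarrow> bool" where
  prod: "f \<in> schwartz_halfline \<Longrightarrow> g \<in> schwartz_halfline \<Longrightarrow> prodspan (\<lambda>t. f t * g t)"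
| add: "prodspan f \<Longrightarrow> prodspan g \<Longrightarrow> prodspan (\<lambda>t. f t + g t)"

lemma schwartz_mult:
  assumes "f \<in> schwartz_halfline" "g \<in> schwartz_halfline"
  shows "(\<lambda>t. f t * g t) \<in> schwartz_halfline"
proof (rule schwartz_coinduct[where P = prodspan])
  show "prodspan (\<lambda>t. f t * g t)" using assms by (rule prodspan.prod)
next
  fix h assume "prodspan h"
  then show "rapid h \<and> (\<exists>h'. prodspan h' \<and> hderiv h h')"
  proof induction
    case (prod f g)
    then show ?case
      by (blast intro: rapid_mult schwartz_rapid hderiv_mult schwartz_hderiv schwartz_nderiv prodspan.intros)
  next
    case (add f g)
    then show ?case by (blast intro: rapid_add hderiv_add prodspan.intros)
  qed
qed

lemma nderiv_hderiv:
  assumes "hderiv f f'" "t \<ge> 0" shows "nderiv (Suc n) f t = nderiv n f' t"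
  unfolding nderiv_Suc_right
  by (rule nderiv_cong) (use assms hderiv_vector_derivative in auto)

lemma nderiv_plus:
  assumes "f \<in> schwartz_halfline" "g \<in> schwartz_halfline" "t \<ge> 0"
  shows "nderiv n (\<lambda>t. f t + g t) t = nderiv n f t + nderiv n g t"
  using assms
proof (induction n arbitrary: f g)
  case (Suc n)
  have "nderiv (Suc n) (\<lambda>t. f t + g t) t = nderiv n (\<lambda>t. nderiv 1 f t + nderiv 1 g t) t"
    using Suc.prems by (intro nderiv_hderiv hderiv_add schwartz_hderiv) auto
  also have "\<dots> = nderiv n (nderiv 1 f) t + nderiv n (nderiv 1 g) t"
    using Suc.prems by (intro Suc.IH schwartz_nderiv)
  finally show ?case by (simp only: nderiv_Suc_right)
qed auto

lemma nderiv_cmult: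
  assumes "f \<in> schwartz_halfline" "t \<ge> 0"
  shows "nderiv n (\<lambda>t. c * f t) t = c * nderiv n f t"
  using assms
proof (induction n arbitrary: f)
  case (Suc n)
  have "nderiv (Suc n) (\<lambda>t. c * f t) t = nderiv n (\<lambda>t. c * nderiv 1 f t) t"
    using Suc.prems by (intro nderiv_hderiv hderiv_cmult schwartz_hderiv) auto
  also have "\<dots> = c * nderiv n (nderiv 1 f) t"
    using Suc.prems by (intro Suc.IH schwartz_nderiv)
  finally show ?case by (simp only: nderiv_Suc_right)
qed auto

lemma nderiv_shift:
  assumes "f \<in> schwartz_halfline" "h \<ge> 0" "t \<ge> 0"
  shows "nderiv n (\<lambda>t. f (t + h)) t = nderiv n f (t + h)"
  using assms
proof (induction n arbitrary: f)
  case (Suc n)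
  have "nderiv (Suc n) (\<lambda>t. f (t + h)) t = nderiv n (\<lambda>t. nderiv 1 f (t + h)) t"
    using Suc.prems by (intro nderiv_hderiv hderiv_shift schwartz_hderiv) auto
  also have "\<dots> = nderiv n (nderiv 1 f) (t + h)"
    using Suc.prems by (intro Suc.IH schwartz_nderiv)
  finally show ?case by (simp only: nderiv_Suc_right)
qed auto

section \<open>Convolution with one-sided kernels\<close>

text \<open>The weight is matched by two orders of decay of a \<open>rapid\<close> function. It is
  weak enough for kernels that are merely bounded at infinity, such as that of
  \<open>W_+^{-1}\<close>.\<close>

definition admissible :: "(real \<Rightarrow> real) \<Rightarrow> bool" where
  "admissible k \<longleftrightarrow> k \<in> borel_measurable borel \<and> (\<forall>z<0. k z = 0) \<and> integrable lborel (\<lambda>z. k z / (1 + z)\<^sup>2)"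

text \<open>The integration variable is the displacement \<open>z = s - t\<close>. In this form a
  derivative in \<open>t\<close> falls on \<open>f\<close> and never on the singular kernel.\<close>

definition kconv :: "(real \<Rightarrow> real) \<Rightarrow> (real \<Rightarrow> complex) \<Rightarrow> real \<Rightarrow> complex" where
  "kconv k f t = (\<integral>z. k z *\<^sub>R zext f (t + z) \<partial>lborel)"

lemma zext_borel: "rapid f \<Longrightarrow> zext f \<in> borel_measurable borel"
  unfolding zext_def[abs_def] rapid_def by (intro borel_measurable_continuous_on_indicator) auto

lemma zext_eq: "t \<ge> 0 \<Longrightarrow> zext f t = f t"
  by (simp add: zext_def)

lemma admissible_integrable: "admissible k \<Longrightarrow> integrable lborel (\<lambda>z. B * norm (k z / (1 + z)\<^sup>2))"
  unfolding admissible_def by (intro integrable_mult_right integrable_norm) blast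

text \<open>For nonnegative \<open>t\<close> and \<open>z\<close>,
  \<open>(1 + t)^m * (1 + z)^2\<close> is at most \<open>(1 + t + z)^(m + 2)\<close>. Thus
  \<open>m + 2\<close> orders of decay of \<open>f\<close> split into two that tame the kernel and
  \<open>m\<close> that survive in \<open>t\<close>.\<close>

lemma kernel_norm_bound:
  assumes "admissible k" "rapid f"
  obtains B where "B \<ge> 0" "\<And>t z. t \<ge> 0 \<Longrightarrow> norm (k z *\<^sub>R zext f (t + z)) \<le> (B / (1 + t) ^ m) * norm (k z / (1 + z)\<^sup>2)"
proof -
  obtain B where B: "B \<ge> 0" "\<And>t. t \<ge> 0 \<Longrightarrow> cmod (f t) \<le> B / (1 + t) ^ (m + 2)"
    using assms(2) rapid_bound by blast
  have "norm (k z *\<^sub>R zext f (t + z)) \<le> (B / (1 + t) ^ m) * norm (k z / (1 + z)\<^sup>2)" if t: "t \<ge> 0" for t z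
  proof (cases "z < 0")
    case True
    then show ?thesis using assms by (simp add: admissible_def)
  next
    case False
    have "(1 + t) ^ m * (1 + z)\<^sup>2 \<le> (1 + (t + z)) ^ m * (1 + (t + z))\<^sup>2"
      using t False by (intro mult_mono power_mono) auto
    then have "B / (1 + (t + z)) ^ (m + 2) \<le> B / ((1 + t) ^ m * (1 + z)\<^sup>2)"
      using t False B(1) by (intro divide_left_mono mult_pos_pos) (auto simp: power_add power2_eq_square mult_ac)
    with B(2)[of "t + z"] t False have "cmod (f (t + z)) \<le> B / ((1 + t) ^ m * (1 + z)\<^sup>2)" by simp
    then have "\<bar>k z\<bar> * cmod (f (t + z)) \<le> \<bar>k z\<bar> * (B / ((1 + t) ^ m * (1 + z)\<^sup>2))"
      by (intro mult_left_mono) auto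
    then show ?thesis using t False by (simp add: zext_eq mult.commute[of _ B])
  qed
  with B(1) show ?thesis using that by blast
qed

lemma kconv_integrable:
  assumes "admissible k" "rapid f" "t \<ge> 0"
  shows "integrable lborel (\<lambda>z. k z *\<^sub>R zext f (t + z))"
proof -
  have [measurable]: "zext f \<in> borel_measurable borel" "k \<in> borel_measurable borel"
    using assms by (auto simp: admissible_def intro: zext_borel)
  obtain B where B: "\<And>t z. t \<ge> 0 \<Longrightarrow> norm (k z *\<^sub>R zext f (t + z)) \<le> (B / (1 + t) ^ 0) * norm (k z / (1 + z)\<^sup>2)"
    using kernel_norm_bound[OF assms(1,2)] by metis
  show ?thesis
  proof (rule Bochner_Integration.integrable_bound)
    show "integrable lborel (\<lambda>z. B * norm (k z / (1 + z)\<^sup>2))"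
      using assms(1) by (rule admissible_integrable)
    show "AE z in lborel. norm (k z *\<^sub>R zext f (t + z)) \<le> norm (B * norm (k z / (1 + z)\<^sup>2))"
      by (intro always_eventually allI order_trans[OF B[OF assms(3)]]) (simp only: power_0 div_by_1 real_norm_def abs_ge_self)
  qed measurable
qed

lemma kconv_rapid:
  assumes "admissible k" "rapid f"
  shows "rapid (kconv k f)"
proof (rule rapidI)
  have [measurable]: "zext f \<in> borel_measurable borel" "k \<in> borel_measurable borel"
    using assms by (auto simp: admissible_def intro: zext_borel)
  show "continuous_on {0..} (kconv k f)"
  proof (rule continuous_on_sequentiallyI)
    fix u :: "nat \<Rightarrow> real" and a assume u: "\<forall>n. u n \<in> {0..}" and a: "a \<in> {0..}" and ua: "u \<longlonglongrightarrow> a"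
    obtain B where B: "\<And>t z. t \<ge> 0 \<Longrightarrow> norm (k z *\<^sub>R zext f (t + z)) \<le> (B / (1 + t) ^ 0) * norm (k z / (1 + z)\<^sup>2)"
      using kernel_norm_bound[OF assms(1,2)] by metis
    show "(\<lambda>n. kconv k f (u n)) \<longlonglongrightarrow> kconv k f a"
      unfolding kconv_def
    proof (rule integral_dominated_convergence[where w = "\<lambda>z. B * norm (k z / (1 + z)\<^sup>2)"])
      show "integrable lborel (\<lambda>z. B * norm (k z / (1 + z)\<^sup>2))" using assms(1) by (rule admissible_integrable)
      show "AE z in lborel. norm (k z *\<^sub>R zext f (u n + z)) \<le> B * norm (k z / (1 + z)\<^sup>2)" for n
        using B[of "u n"] u by (intro always_eventually allI) simp
      show "AE z in lborel. (\<lambda>n. k z *\<^sub>R zext f (u n + z)) \<longlonglongrightarrow> k z *\<^sub>R zext f (a + z)"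
      proof (intro always_eventually allI)
        fix z
        show "(\<lambda>n. k z *\<^sub>R zext f (u n + z)) \<longlonglongrightarrow> k z *\<^sub>R zext f (a + z)"
        proof (cases "z < 0")
          case True
          then show ?thesis using assms by (simp add: admissible_def)
        next
          case False
          have "(\<lambda>n. f (u n + z)) \<longlonglongrightarrow> f (a + z)"
            using assms(2) u a False
            by (intro continuous_on_tendsto_compose[of "{0..}" f] tendsto_intros ua) (auto simp: rapid_def)
          moreover have "zext f (u n + z) = f (u n + z)" for n
            using u[rule_format, of n] False by (simp add: zext_eq)
          moreover have "zext f (a + z) = f (a + z)" using a False by (simp add: zext_eq)
          ultimately show ?thesis by (auto intro!: tendsto_intros)
        qed
      qed
    qed measurable
  qed
  fix m
  obtain B where B: "B \<ge> 0" "\<And>t z. t \<ge> 0 \<Longrightarrow> norm (k z *\<^sub>R zext f (t + z)) \<le> (B / (1 + t) ^ m) * norm (k z / (1 + z)\<^sup>2)"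
    using kernel_norm_bound[OF assms(1,2)] by metis
  have "cmod (kconv k f t) \<le> (B * (\<integral>z. norm (k z / (1 + z)\<^sup>2) \<partial>lborel)) / (1 + t) ^ m" if t: "t \<ge> 0" for t
  proof -
    have "cmod (kconv k f t) \<le> (\<integral>z. (B / (1 + t) ^ m) * norm (k z / (1 + z)\<^sup>2) \<partial>lborel)"
      unfolding kconv_def
    proof (rule Bochner_Integration.integral_norm_bound_integral)
      show "integrable lborel (\<lambda>z. (B / (1 + t) ^ m) * norm (k z / (1 + z)\<^sup>2))" using assms(1) by (rule admissible_integrable)
    qed (use kconv_integrable[OF assms t] B(2)[OF t] in auto)
    also have "\<dots> = (B / (1 + t) ^ m) * (\<integral>z. norm (k z / (1 + z)\<^sup>2) \<partial>lborel)"
      by (rule integral_mult_right_zero)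
    finally show ?thesis by simp
  qed
  then show "\<exists>B. \<forall>t\<ge>0. cmod (kconv k f t) \<le> B / (1 + t) ^ m" by blast
qed

text \<open>Dominated convergence and Fatou's lemma speak of sequences, so the one-sided derivative
  is needed along a sequence of steps.\<close>

lemma hderiv_tendsto_sequentially:
  assumes "hderiv f f'" "x \<ge> 0" "\<And>n. y n \<ge> 0" "\<And>n. y n \<noteq> x" "y \<longlonglongrightarrow> x"
  shows "(\<lambda>n. (f (y n) - f x) /\<^sub>R (y n - x) - f' x) \<longlonglongrightarrow> 0"
proof -
  have "((\<lambda>y. norm ((f y - f x) - (y - x) *\<^sub>R f' x) / norm (y - x)) \<longlongrightarrow> 0) (at x within {0..})"
    using assms(1,2) by (auto simp: hderiv_def has_vector_derivative_def has_derivative_iff_norm)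
  moreover have "filterlim y (at x within {0..}) sequentially"
    using assms by (auto simp: filterlim_at)
  ultimately have "(\<lambda>n. norm ((f (y n) - f x) - (y n - x) *\<^sub>R f' x) / norm (y n - x)) \<longlonglongrightarrow> 0"
    by (rule filterlim_compose)
  moreover have "norm ((f (y n) - f x) - (y n - x) *\<^sub>R f' x) / norm (y n - x)
      = norm ((f (y n) - f x) /\<^sub>R (y n - x) - f' x)" for n
  proof -
    have "(f (y n) - f x) /\<^sub>R (y n - x) - f' x = ((f (y n) - f x) - (y n - x) *\<^sub>R f' x) /\<^sub>R (y n - x)"
      using assms(4)[of n] by (simp add: scaleR_diff_right)
    then show ?thesis by (simp add: divide_inverse_commute)
  qed
  ultimately show ?thesis using tendsto_norm_zero_cancel by auto
qed

lemma kconv_hderiv: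
  assumes k: "admissible k" and f: "rapid f" and f': "rapid f'" and h: "hderiv f f'"
  shows "hderiv (kconv k f) (kconv k f')"
  unfolding hderiv_def has_vector_derivative_def has_derivative_iff_norm
proof (intro allI impI conjI)
  have [measurable]: "zext f \<in> borel_measurable borel" "zext f' \<in> borel_measurable borel" "k \<in> borel_measurable borel"
    using assms by (auto simp: admissible_def intro: zext_borel)
  fix x :: real assume x: "x \<ge> 0"
  show "bounded_linear (\<lambda>h. h *\<^sub>R kconv k f' x)" by (rule bounded_linear_scaleR_left)
  show "((\<lambda>y. norm (kconv k f y - kconv k f x - (y - x) *\<^sub>R kconv k f' x) / norm (y - x)) \<longlongrightarrow> 0) (at x within {0..})"
    unfolding tendsto_at_iff_sequentially comp_def
  proof (intro allI impI)
    fix y :: "nat \<Rightarrow> real" assume y0: "\<forall>i. y i \<in> {0..} - {x}" and yx: "y \<longlonglongrightarrow> x"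
    have y: "y i \<ge> 0" "y i \<noteq> x" for i using y0 by auto
    \<comment> \<open>\<open>R n z\<close> is the kernel times the error of the difference quotient
      of \<open>f\<close> at \<open>x + z\<close>. The remainder of \<open>kconv k f\<close> at
      \<open>x\<close> is \<open>y n - x\<close> times the integral of \<open>R n\<close>, so this
      integral has to tend to 0.\<close>
    define R where "R n z = k z *\<^sub>R ((zext f (y n + z) - zext f (x + z)) /\<^sub>R (y n - x) - zext f' (x + z))" for n z
    have R: "kconv k f (y n) - kconv k f x - (y n - x) *\<^sub>R kconv k f' x = (y n - x) *\<^sub>R (\<integral>z. R n z \<partial>lborel)" for n
    proof -
      have "(y n - x) *\<^sub>R (\<integral>z. R n z \<partial>lborel) = (\<integral>z. (y n - x) *\<^sub>R R n z \<partial>lborel)" by simp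
      also have "\<dots> = (\<integral>z. k z *\<^sub>R zext f (y n + z) - k z *\<^sub>R zext f (x + z) - (y n - x) *\<^sub>R (k z *\<^sub>R zext f' (x + z)) \<partial>lborel)"
      proof (intro Bochner_Integration.integral_cong refl)
        fix z
        define d where "d = y n - x"
        have d: "d \<noteq> 0" using y(2)[of n] by (simp add: d_def)
        have e1: "d *\<^sub>R (a *\<^sub>R ((b - c) /\<^sub>R d - e)) = a *\<^sub>R (d *\<^sub>R ((b - c) /\<^sub>R d)) - d *\<^sub>R (a *\<^sub>R e)" for a and b c e :: complex
          by (simp add: scaleR_diff_right mult_ac)
        have e2: "d *\<^sub>R ((b - c) /\<^sub>R d) = b - c" for b c :: complex using d by simp
        show "(y n - x) *\<^sub>R R n z = k z *\<^sub>R zext f (y n + z) - k z *\<^sub>R zext f (x + z) - (y n - x) *\<^sub>R (k z *\<^sub>R zext f' (x + z))"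
          unfolding R_def d_def[symmetric] e1 e2 by (simp only: scaleR_diff_right)
      qed
      also have "\<dots> = kconv k f (y n) - kconv k f x - (y n - x) *\<^sub>R kconv k f' x"
        using kconv_integrable[OF k f y(1)] kconv_integrable[OF k f x] kconv_integrable[OF k f' x]
        by (simp add: kconv_def del: scaleR_scaleR)
      finally show ?thesis ..
    qed
    obtain B where B: "B \<ge> 0" "\<And>t. t \<ge> 0 \<Longrightarrow> cmod (f' t) \<le> B / (1 + t) ^ 2"
      using f' rapid_bound by blast
    have "(\<lambda>n. \<integral>z. R n z \<partial>lborel) \<longlonglongrightarrow> (\<integral>z. 0 \<partial>(lborel::real measure))"
    proof (rule integral_dominated_convergence[where w = "\<lambda>z. (2 * B) * norm (k z / (1 + z)\<^sup>2)"])
      show "integrable lborel (\<lambda>z. (2 * B) * norm (k z / (1 + z)\<^sup>2))" using k by (rule admissible_integrable)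
      show "AE z in lborel. (\<lambda>n. R n z) \<longlonglongrightarrow> 0"
      proof (intro always_eventually allI)
        fix z show "(\<lambda>n. R n z) \<longlonglongrightarrow> 0"
        proof (cases "z < 0")
          case True
          then show ?thesis using k by (simp add: R_def admissible_def)
        next
          case False
          have "(\<lambda>n. (f (y n + z) - f (x + z)) /\<^sub>R ((y n + z) - (x + z)) - f' (x + z)) \<longlonglongrightarrow> 0"
            using h x y False by (intro hderiv_tendsto_sequentially tendsto_intros yx) (auto intro: add_nonneg_nonneg)
          then have "(\<lambda>n. k z *\<^sub>R ((f (y n + z) - f (x + z)) /\<^sub>R ((y n + z) - (x + z)) - f' (x + z))) \<longlonglongrightarrow> k z *\<^sub>R 0"
            by (intro tendsto_intros)
          then show ?thesis using False x y by (simp add: R_def zext_eq)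
        qed
      qed
      show "AE z in lborel. norm (R n z) \<le> (2 * B) * norm (k z / (1 + z)\<^sup>2)" for n
      proof (intro always_eventually allI)
        fix z show "norm (R n z) \<le> (2 * B) * norm (k z / (1 + z)\<^sup>2)"
        proof (cases "z < 0")
          case True
          then show ?thesis using k by (simp add: R_def admissible_def)
        next
          case False
          \<comment> \<open>A bound for \<open>f'\<close> on the whole ray from \<open>z\<close>,
            which contains both \<open>y n + z\<close> and \<open>x + z\<close>. Difference quotient
            and derivative are each at most \<open>b\<close>, whence the factor 2 in the dominating
            function.\<close>
          define b where "b = B / (1 + z)\<^sup>2"
          have bb: "cmod (f' t) \<le> b" if "t \<ge> z" for t
          proof -
            have "cmod (f' t) \<le> B / (1 + t)\<^sup>2" using that False by (intro B) auto
            also have "\<dots> \<le> b" unfolding b_def using that False B(1) by (intro divide_left_mono power_mono mult_pos_pos) auto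
            finally show ?thesis .
          qed
          have "cmod (f (y n + z) - f (x + z)) \<le> b * \<bar>(y n + z) - (x + z)\<bar>"
            by (rule hderiv_Lipschitz[OF h, of z]) (use False bb x y in auto)
          then have 1: "cmod ((f (y n + z) - f (x + z)) /\<^sub>R (y n - x)) \<le> b"
            using y(2)[of n] unfolding norm_scaleR abs_inverse
            by (simp only: inverse_eq_divide times_divide_eq_left mult_1 pos_divide_le_eq zero_less_abs_iff) simp
          have "cmod ((f (y n + z) - f (x + z)) /\<^sub>R (y n - x) - f' (x + z)) \<le> b + b"
            by (rule order_trans[OF norm_triangle_ineq4]) (use 1 bb[of "x + z"] x in auto)
          then have "\<bar>k z\<bar> * cmod ((f (y n + z) - f (x + z)) /\<^sub>R (y n - x) - f' (x + z)) \<le> \<bar>k z\<bar> * (b + b)"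
            by (rule mult_left_mono) auto
          then show ?thesis using False x y[of n] by (simp add: R_def zext_eq b_def mult_ac)
        qed
      qed
    qed (auto simp: R_def)
    then have "(\<lambda>n. norm (\<integral>z. R n z \<partial>lborel)) \<longlonglongrightarrow> 0" by (simp add: tendsto_norm_zero)
    moreover have "norm (\<integral>z. R n z \<partial>lborel) = norm (kconv k f (y n) - kconv k f x - (y n - x) *\<^sub>R kconv k f' x) / norm (y n - x)" for n
      unfolding R using y(2)[of n] by simp
    ultimately show "(\<lambda>n. norm (kconv k f (y n) - kconv k f x - (y n - x) *\<^sub>R kconv k f' x) / norm (y n - x)) \<longlonglongrightarrow> 0"
      by simp
  qed
qed

lemma kconv_schwartz:
  assumes "admissible k" "f \<in> schwartz_halfline"
  shows "kconv k f \<in> schwartz_halfline"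
proof (rule schwartz_coinduct[where P = "\<lambda>h. \<exists>f\<in>schwartz_halfline. h = kconv k f"])
  fix h assume "\<exists>f\<in>schwartz_halfline. h = kconv k f"
  then obtain f where fg: "f \<in> schwartz_halfline" "h = kconv k f" by blast
  show "rapid h \<and> (\<exists>h'. (\<exists>f\<in>schwartz_halfline. h' = kconv k f) \<and> hderiv h h')"
    unfolding fg(2) using fg(1) assms(1)
    by (blast intro: kconv_rapid schwartz_rapid kconv_hderiv schwartz_hderiv schwartz_nderiv)
qed (use assms in blast)

lemma nderiv_kconv:
  assumes "admissible k" "f \<in> schwartz_halfline" "t \<ge> 0"
  shows "nderiv n (kconv k f) t = kconv k (nderiv n f) t"
  using assms(2)
proof (induction n arbitrary: f)
  case (Suc n)
  have "nderiv (Suc n) (kconv k f) t = nderiv n (kconv k (nderiv 1 f)) t"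
    using Suc.prems assms by (intro nderiv_hderiv kconv_hderiv schwartz_rapid schwartz_nderiv schwartz_hderiv) auto
  also have "\<dots> = kconv k (nderiv n (nderiv 1 f)) t"
    using Suc.prems by (intro Suc.IH schwartz_nderiv)
  finally show ?case by (simp only: nderiv_Suc_right)
qed auto

lemma kconv_add:
  assumes "admissible k" "rapid f" "rapid g" "t \<ge> 0"
  shows "kconv k (\<lambda>t. f t + g t) t = kconv k f t + kconv k g t"
proof -
  have "kconv k (\<lambda>t. f t + g t) t = (\<integral>z. k z *\<^sub>R zext f (t + z) + k z *\<^sub>R zext g (t + z) \<partial>lborel)"
    unfolding kconv_def by (intro Bochner_Integration.integral_cong) (auto simp: zext_def algebra_simps)
  also have "\<dots> = kconv k f t + kconv k g t"
    unfolding kconv_def using kconv_integrable assms by (intro Bochner_Integration.integral_add) auto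
  finally show ?thesis .
qed

lemma kconv_cong: "(\<And>t. t \<ge> 0 \<Longrightarrow> f t = g t) \<Longrightarrow> kconv k f t = kconv k g t"
  unfolding kconv_def by (intro Bochner_Integration.integral_cong) (auto simp: zext_def indicator_def)

lemma nn_integral_inverse_square: "(\<integral>\<^sup>+z. ennreal (1 / (1 + z)\<^sup>2) * indicator {0..} z \<partial>lborel) = 1"
proof -
  have "(\<integral>\<^sup>+z. ennreal (1 / (1 + z)\<^sup>2) * indicator {0..} z \<partial>lborel) = 0 - (- 1 / (1 + 0::real))"
  proof (rule nn_integral_FTC_atLeast)
    show "((\<lambda>z::real. - 1 / (1 + z)) \<longlongrightarrow> 0) at_top" by real_asymp
  qed (auto intro!: derivative_eq_intros simp: power2_eq_square)
  then show ?thesis by simp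
qed

text \<open>This is \<open>W_+^{-1} f' = - f\<close>: the fundamental theorem on intervals of length
  \<open>n\<close>, where the upper boundary term vanishes by the decay of \<open>f\<close> and the
  integrals converge by dominated convergence.\<close>

lemma rapid_FTC:
  assumes f: "rapid f" "rapid f'" "hderiv f f'" and s: "s \<ge> 0"
  shows "f s = - (\<integral>z. indicator {0..} z *\<^sub>R zext f' (s + z) \<partial>lborel)"
    and "integrable lborel (\<lambda>z. indicator {0..} z *\<^sub>R zext f' (s + z))"
proof -
  have admissible1: "admissible (indicator {0..})"
    unfolding admissible_def
  proof (intro conjI)
    have eq: "(\<lambda>z::real. indicator {0..} z / (1 + z)\<^sup>2) = (\<lambda>z. indicator {0..} z *\<^sub>R (1 / (1 + z)\<^sup>2))" by auto
    have "(\<integral>\<^sup>+z. ennreal (norm (indicator {0..} z *\<^sub>R (1 / (1 + z::real)\<^sup>2))) \<partial>lborel)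
        = (\<integral>\<^sup>+z. ennreal (1 / (1 + z)\<^sup>2) * indicator {0..} z \<partial>lborel)"
      by (intro nn_integral_cong) (auto simp: indicator_def)
    then have "(\<integral>\<^sup>+z. ennreal (norm (indicator {0..} z *\<^sub>R (1 / (1 + z::real)\<^sup>2))) \<partial>lborel) < \<infinity>"
      by (simp add: nn_integral_inverse_square)
    then show "integrable lborel (\<lambda>z::real. indicator {0..} z / (1 + z)\<^sup>2)"
      unfolding eq by (intro integrableI_bounded) auto
  qed auto
  show int: "integrable lborel (\<lambda>z. indicator {0..} z *\<^sub>R zext f' (s + z))"
    using kconv_integrable[OF admissible1 f(2) s] .
  have [measurable]: "zext f' \<in> borel_measurable borel" using f by (simp add: zext_borel)
  have "(\<lambda>n::nat. \<integral>z. indicator {0..real n} z *\<^sub>R zext f' (s + z) \<partial>lborel) \<longlonglongrightarrow> (\<integral>z. indicator {0..} z *\<^sub>R zext f' (s + z) \<partial>lborel)"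
  proof (rule integral_dominated_convergence[where w = "\<lambda>z. norm (indicator {0..} z *\<^sub>R zext f' (s + z))"])
    show "AE z in lborel. (\<lambda>n. indicator {0..real n} z *\<^sub>R zext f' (s + z)) \<longlonglongrightarrow> indicator {0..} z *\<^sub>R zext f' (s + z)"
    proof (intro always_eventually allI)
      fix z :: real
      obtain N where N: "z \<le> real N" using real_arch_simple by blast
      show "(\<lambda>n. indicator {0..real n} z *\<^sub>R zext f' (s + z)) \<longlonglongrightarrow> indicator {0..} z *\<^sub>R zext f' (s + z)"
        by (rule tendsto_eventually) (use N in \<open>auto simp: eventually_sequentially indicator_def intro!: exI[of _ N]\<close>)
    qed
    show "integrable lborel (\<lambda>z. norm (indicator {0..} z *\<^sub>R zext f' (s + z)))" using int by (rule integrable_norm)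
  qed (auto split: split_indicator)
  moreover have "(\<integral>z. indicator {0..real n} z *\<^sub>R zext f' (s + z) \<partial>lborel) = f (s + n) - f s" for n :: nat
  proof -
    have "(\<integral>z. indicator {0..real n} z *\<^sub>R f' (z + s) \<partial>lborel) = f (real n + s) - f (0 + s)"
    proof (rule integral_FTC_Icc)
      fix z assume z: "0 \<le> z" "z \<le> real n"
      have "hderiv (\<lambda>t. f (t + s)) (\<lambda>t. f' (t + s))" using f s by (intro hderiv_shift)
      then show "((\<lambda>z. f (z + s)) has_vector_derivative f' (z + s)) (at z within {0..real n})"
        using z unfolding hderiv_def by (auto intro: has_vector_derivative_within_subset)
    next
      show "continuous_on {0..real n} (\<lambda>z. f' (z + s))"
        using f(2) s by (auto simp: rapid_def intro!: continuous_intros continuous_on_compose2[of "{0..}" f'])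
    qed auto
    also have "(\<integral>z. indicator {0..real n} z *\<^sub>R f' (z + s) \<partial>lborel) = (\<integral>z. indicator {0..real n} z *\<^sub>R zext f' (s + z) \<partial>lborel)"
      using s by (intro Bochner_Integration.integral_cong) (auto simp: zext_def add.commute split: split_indicator)
    finally show ?thesis by (simp add: add.commute)
  qed
  ultimately have L: "(\<lambda>n::nat. f (s + n) - f s) \<longlonglongrightarrow> (\<integral>z. indicator {0..} z *\<^sub>R zext f' (s + z) \<partial>lborel)" by simp
  obtain B where B: "B \<ge> 0" "\<And>t. t \<ge> 0 \<Longrightarrow> cmod (f t) \<le> B / (1 + t) ^ 1"
    using f(1) rapid_bound by blast
  have "(\<lambda>n::nat. f (s + n)) \<longlonglongrightarrow> 0"
  proof (rule Lim_null_comparison)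
    show "\<forall>\<^sub>F n in sequentially. norm (f (s + real n)) \<le> B / (1 + (s + real n)) ^ 1"
      using B(2) s by (intro always_eventually allI) auto
    show "(\<lambda>n. B / (1 + (s + real n)) ^ 1) \<longlonglongrightarrow> 0" by real_asymp
  qed
  then have "(\<lambda>n::nat. f (s + n) - f s) \<longlonglongrightarrow> 0 - f s" by (intro tendsto_intros)
  from LIMSEQ_unique[OF this L] show "f s = - (\<integral>z. indicator {0..} z *\<^sub>R zext f' (s + z) \<partial>lborel)" 
    by (metis diff_0 minus_minus)
qed

section \<open>The Weyl fractional calculus\<close>

text \<open>The kernel of \<open>W_+^{-\<gamma>}\<close> as a function of the displacement
  \<open>s - t\<close>.\<close>

definition weylk :: "real \<Rightarrow> real \<Rightarrow> real" where
  "weylk \<gamma> z = (if z > 0 then z powr (\<gamma> - 1) / Gamma \<gamma> else 0)"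

lemma weylk_measurable [measurable]: "weylk \<gamma> \<in> borel_measurable borel"
  unfolding weylk_def[abs_def] by measurable

lemma weylk_nonneg: "\<gamma> > 0 \<Longrightarrow> weylk \<gamma> z \<ge> 0"
  by (simp add: weylk_def Gamma_real_nonneg)

lemma nn_integral_powr_01:
  assumes "a > -1" "c \<ge> 0"
  shows "(\<integral>\<^sup>+z. ennreal (z powr a * indicator {0<..c} z) \<partial>lborel) = ennreal (c powr (a + 1) / (a + 1))"
proof -
  have "((\<lambda>x. x powr a) has_integral (c powr (a + 1) / (a + 1))) {0..c}"
    using assms by (rule has_integral_powr_from_0)
  then have "((\<lambda>x. if x \<in> {0..c} then x powr a else 0) has_integral (c powr (a + 1) / (a + 1))) UNIV"
    by (simp only: has_integral_restrict_UNIV)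
  then have "((\<lambda>x. x powr a * indicator {0<..c} x) has_integral (c powr (a + 1) / (a + 1))) UNIV"
    by (rule has_integral_spike[of "{0}", rotated 2]) (auto simp: indicator_def)
  then show ?thesis by (intro nn_integral_has_integral_lborel) auto
qed

text \<open>The two ends use the two bounds on \<gamma>: on \<open>{0<..1}\<close> the power is
  integrable because \<gamma> > 0, and beyond 1 it is at most 1 because \<gamma> \<le> 1.\<close>

lemma admissible_weylk:
  assumes "0 < \<gamma>" "\<gamma> \<le> 1"
  shows "admissible (weylk \<gamma>)"
  unfolding admissible_def
proof (intro conjI)
  have G: "Gamma \<gamma> > 0" using assms by (simp add: Gamma_real_pos)
  have i2: "(\<integral>\<^sup>+z. ennreal (z powr (\<gamma> - 1) * indicator {0<..1} z) \<partial>lborel) < \<infinity>"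
    by (subst nn_integral_powr_01) (use assms in auto)
  have "(\<integral>\<^sup>+z. ennreal (norm (weylk \<gamma> z / (1 + z)\<^sup>2)) \<partial>lborel)
      \<le> (\<integral>\<^sup>+z. ennreal (1 / Gamma \<gamma>) * (ennreal (z powr (\<gamma> - 1) * indicator {0<..1} z) + ennreal (1 / (1 + z)\<^sup>2) * indicator {0..} z) \<partial>lborel)"
  proof (rule nn_integral_mono)
    fix z :: real
    have "norm (weylk \<gamma> z / (1 + z)\<^sup>2) \<le> 1 / Gamma \<gamma> * (z powr (\<gamma> - 1) * indicator {0<..1} z + (1 / (1 + z)\<^sup>2) * indicator {0..} z)"
    proof (cases "z > 0")
      case True
      have "z powr (\<gamma> - 1) / (1 + z)\<^sup>2 \<le> z powr (\<gamma> - 1) * indicator {0<..1} z + (1 / (1 + z)\<^sup>2) * indicator {0..} z"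
      proof (cases "z \<le> 1")
        case le: True
        have "z powr (\<gamma> - 1) / (1 + z)\<^sup>2 \<le> z powr (\<gamma> - 1) / 1"
          using True by (intro divide_left_mono) auto
        then show ?thesis using True le by (simp add: add_increasing2)
      next
        case False
        have "z powr (\<gamma> - 1) \<le> z powr 0" using False assms by (intro powr_mono) auto
        then show ?thesis using False by (simp add: divide_right_mono)
      qed
      then have "1 / Gamma \<gamma> * (z powr (\<gamma> - 1) / (1 + z)\<^sup>2) \<le> 1 / Gamma \<gamma> * (z powr (\<gamma> - 1) * indicator {0<..1} z + (1 / (1 + z)\<^sup>2) * indicator {0..} z)"
        using G by (intro mult_left_mono) auto
      then show ?thesis using True G by (simp add: weylk_def)
    qed (use G in \<open>auto simp: weylk_def\<close>)
    then have "ennreal (norm (weylk \<gamma> z / (1 + z)\<^sup>2)) \<le> ennreal (1 / Gamma \<gamma> * (z powr (\<gamma> - 1) * indicator {0<..1} z + (1 / (1 + z)\<^sup>2) * indicator {0..} z))"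
      by (rule ennreal_leI)
    also have "\<dots> = ennreal (1 / Gamma \<gamma>) * (ennreal (z powr (\<gamma> - 1) * indicator {0<..1} z) + ennreal (1 / (1 + z)\<^sup>2) * indicator {0..} z)"
      using G by (auto simp: indicator_def ennreal_mult[symmetric] ennreal_plus[symmetric] simp del: ennreal_plus)
    finally show "ennreal (norm (weylk \<gamma> z / (1 + z)\<^sup>2)) \<le> \<dots>" .
  qed
  also have "\<dots> = ennreal (1 / Gamma \<gamma>) * ((\<integral>\<^sup>+z. ennreal (z powr (\<gamma> - 1) * indicator {0<..1} z) \<partial>lborel) + (\<integral>\<^sup>+z. ennreal (1 / (1 + z)\<^sup>2) * indicator {0..} z \<partial>lborel))"
    by (simp add: nn_integral_cmult nn_integral_add)
  also have "\<dots> < \<infinity>" unfolding nn_integral_inverse_square using i2 by (auto simp: ennreal_mult_less_top)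
  finally show "integrable lborel (\<lambda>z. weylk \<gamma> z / (1 + z)\<^sup>2)"
    by (intro integrableI_bounded) auto
qed (auto simp: weylk_def)

lemma weyl_integral_kconv:
  assumes "rapid f" "t \<ge> 0"
  shows "weyl_integral \<gamma> f t = kconv (weylk \<gamma>) f t"
proof -
  have [measurable]: "zext f \<in> borel_measurable borel" using assms by (simp add: zext_borel)
  have "weyl_integral \<gamma> f t = (1 / Gamma \<gamma>) *\<^sub>R (\<integral>s. indicator {t<..} s *\<^sub>R ((s - t) powr (\<gamma> - 1) *\<^sub>R zext f s) \<partial>lebesgue)"
    unfolding weyl_integral_def set_lebesgue_integral_def using assms(2)
    by (rule_tac arg_cong[of _ _ "\<lambda>x. (1 / Gamma \<gamma>) *\<^sub>R x"], rule_tac Bochner_Integration.integral_cong, rule_tac refl, case_tac "t < x") (simp_all add: zext_eq)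
  also have "(\<integral>s. indicator {t<..} s *\<^sub>R ((s - t) powr (\<gamma> - 1) *\<^sub>R zext f s) \<partial>lebesgue)
     = (\<integral>s. indicator {t<..} s *\<^sub>R ((s - t) powr (\<gamma> - 1) *\<^sub>R zext f s) \<partial>lborel)"
    by (rule integral_completion) auto
  also have "\<dots> = (\<integral>z. indicator {t<..} (t + z) *\<^sub>R ((t + z - t) powr (\<gamma> - 1) *\<^sub>R zext f (t + z)) \<partial>lborel)"
    by (subst lborel_integral_real_affine[of 1 _ t]) auto
  also have "(1 / Gamma \<gamma>) *\<^sub>R \<dots> = kconv (weylk \<gamma>) f t"
    unfolding kconv_def integral_scaleR_right[symmetric]
    by (intro Bochner_Integration.integral_cong refl) (auto simp: weylk_def split: split_indicator)
  finally show ?thesis .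
qed

text \<open>The order \<open>0\<close> is set to be the identity by hand: \<open>weylk 0\<close> is junk because \<open>Gamma 0 = 0\<close>.\<close>

definition weylJ :: "real \<Rightarrow> (real \<Rightarrow> complex) \<Rightarrow> real \<Rightarrow> complex" where
  "weylJ \<gamma> f = (if \<gamma> = 0 then f else kconv (weylk \<gamma>) f)"

lemma weylJ_schwartz: "f \<in> schwartz_halfline \<Longrightarrow> 0 \<le> \<gamma> \<Longrightarrow> \<gamma> \<le> 1 \<Longrightarrow> weylJ \<gamma> f \<in> schwartz_halfline"
  by (auto simp: weylJ_def intro!: kconv_schwartz admissible_weylk)

lemma nderiv_weylJ: "f \<in> schwartz_halfline \<Longrightarrow> 0 \<le> \<gamma> \<Longrightarrow> \<gamma> \<le> 1 \<Longrightarrow> t \<ge> 0 \<Longrightarrow> nderiv n (weylJ \<gamma> f) t = weylJ \<gamma> (nderiv n f) t"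
  by (auto simp: weylJ_def intro!: nderiv_kconv admissible_weylk)

lemma weylJ_add:
  "f \<in> schwartz_halfline \<Longrightarrow> g \<in> schwartz_halfline \<Longrightarrow> 0 \<le> \<gamma> \<Longrightarrow> \<gamma> \<le> 1 \<Longrightarrow> t \<ge> 0 \<Longrightarrow>
   weylJ \<gamma> (\<lambda>t. f t + g t) t = weylJ \<gamma> f t + weylJ \<gamma> g t"
  by (auto simp: weylJ_def intro!: kconv_add admissible_weylk schwartz_rapid)

lemma weylJ_cong: "(\<And>t. t \<ge> 0 \<Longrightarrow> f t = g t) \<Longrightarrow> t \<ge> 0 \<Longrightarrow> weylJ \<gamma> f t = weylJ \<gamma> g t"
  by (auto simp: weylJ_def intro: kconv_cong)

section \<open>Hardy inequalities\<close>

text \<open>Vanishing off the open half-line turns weighted half-line norms into norms over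
  \<open>lborel\<close>. The point 0 is left out because \<open>0 powr a\<close> is 0 even for
  \<open>a = 0\<close>; being a null set, it does not affect norms.\<close>

definition wt :: "real \<Rightarrow> (real \<Rightarrow> complex) \<Rightarrow> real \<Rightarrow> real" where
  "wt a w t = (if t > 0 then t powr a * cmod (w t) else 0)"

lemma wt_nonneg [simp]: "wt a w t \<ge> 0" "t \<le> 0 \<Longrightarrow> wt a w t = 0"
  by (simp_all add: wt_def)

lemma wt_borel [measurable]:
  assumes "rapid w" shows "wt a w \<in> borel_measurable borel"
proof -
  have [measurable]: "zext w \<in> borel_measurable borel" using assms by (rule zext_borel)
  have "wt a w = (\<lambda>t. if t > 0 then t powr a * cmod (zext w t) else 0)"
    by (auto simp: wt_def zext_eq)
  then show ?thesis by simp
qed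

lemma wt_cong: "(\<And>t. t > 0 \<Longrightarrow> cmod (f t) = cmod (g t)) \<Longrightarrow> wt a f = wt a g"
  by (auto simp: wt_def)

text \<open>Of \<open>m + 2\<close> orders of decay, \<open>m\<close> absorb the weight and two
  leave an integrable majorant. This provides the finiteness without which a norm defined by a
  Bochner integral bounds nothing.\<close>

lemma wt_Lp:
  assumes "rapid w" "a \<ge> 0" "p \<ge> 1"
  shows "\<exists>K. Lp_le lborel p (wt a w) K"
proof -
  obtain m :: nat where m: "a \<le> real m" using real_arch_simple by blast
  obtain B where B: "B \<ge> 0" "\<And>t. t \<ge> 0 \<Longrightarrow> cmod (w t) \<le> B / (1 + t) ^ (m + 2)"
    using assms(1) rapid_bound by blast
  have bd: "norm (wt a w t) powr p \<le> B powr p * (indicator {0..} t * (1 / (1 + t)\<^sup>2))" for t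
  proof (cases "t > 0")
    case True
    have "t powr a \<le> (1 + t) powr a" using True assms by (intro powr_mono2) auto
    also have "\<dots> \<le> (1 + t) powr real m" using True m by (intro powr_mono) auto
    also have "\<dots> = (1 + t) ^ m" using True by (simp add: powr_realpow)
    finally have "t powr a * cmod (w t) \<le> (1 + t) ^ m * (B / (1 + t) ^ (m + 2))"
      using True B by (intro mult_mono) auto
    also have "\<dots> = B / (1 + t)\<^sup>2" using True by (simp add: power_add power2_eq_square)
    finally have "norm (wt a w t) powr p \<le> (B / (1 + t)\<^sup>2) powr p"
      using True assms by (intro powr_mono2) (auto simp: wt_def)
    also have "\<dots> = B powr p * (1 / (1 + t)\<^sup>2) powr p"
      using True B(1) by (simp add: powr_divide)
    also have "(1 / (1 + t)\<^sup>2) powr p \<le> (1 / (1 + t)\<^sup>2) powr 1"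
      using True assms by (intro powr_mono') (auto simp: divide_le_eq one_le_power)
    finally show ?thesis using True by (simp add: mult_left_mono)
  qed (auto simp: wt_def)
  have "(\<integral>\<^sup>+t. ennreal (norm (wt a w t) powr p) \<partial>lborel) \<le> (\<integral>\<^sup>+t. ennreal (B powr p) * (ennreal (1 / (1 + t)\<^sup>2) * indicator {0..} t) \<partial>lborel)"
  proof (rule nn_integral_mono)
    fix t :: real
    show "ennreal (norm (wt a w t) powr p) \<le> ennreal (B powr p) * (ennreal (1 / (1 + t)\<^sup>2) * indicator {0..} t)"
      using ennreal_leI[OF bd[of t]] by (cases "t \<ge> 0") (auto simp: ennreal_mult[symmetric])
  qed
  also have "\<dots> = ennreal (B powr p)"
    by (subst nn_integral_cmult) (auto simp: nn_integral_inverse_square)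
  finally show ?thesis using assms B(1) by (intro exI[of _ B]) (auto simp: Lp_le_def)
qed

lemma Lp_le_dilate:
  assumes "Lp_le lborel p U K" "z > 0" "p \<ge> 1"
  shows "Lp_le lborel p (\<lambda>x::real. U (z * x)) (z powr (-1/p) * K)"
proof -
  have [measurable]: "U \<in> borel_measurable borel" using Lp_leD(1)[OF assms(1)] by simp
  have "(\<integral>\<^sup>+x. ennreal (norm (U x) powr p) \<partial>lborel) = ennreal \<bar>z\<bar> * (\<integral>\<^sup>+x. ennreal (norm (U (0 + z * x)) powr p) \<partial>lborel)"
    using assms by (intro nn_integral_real_affine) auto
  then have "(\<integral>\<^sup>+x. ennreal (norm (U (z * x)) powr p) \<partial>lborel) = ennreal (1/z) * (\<integral>\<^sup>+x. ennreal (norm (U x) powr p) \<partial>lborel)"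
    using assms by (simp add: mult.assoc[symmetric] ennreal_mult[symmetric])
  also have "\<dots> \<le> ennreal (1/z) * ennreal (K powr p)"
    using Lp_leD(3)[OF assms(1)] by (intro mult_left_mono) auto
  also have "\<dots> = ennreal ((z powr (-1/p) * K) powr p)"
  proof -
    have "(z powr (-1/p) * K) powr p = z powr (-1/p * p) * K powr p"
      using Lp_leD(2)[OF assms(1)] by (simp add: powr_mult powr_powr)
    also have "\<dots> = 1 / z * K powr p" using assms by (simp add: powr_minus_divide)
    finally show ?thesis using assms by (simp add: ennreal_mult[symmetric])
  qed
  finally show ?thesis using Lp_leD[OF assms(1)] by (auto simp: Lp_le_def)
qed

text \<open>Writing \<open>w x\<close> as an integral of \<open>w'\<close> over the ray from
  \<open>x\<close> and scaling by \<open>x\<close> bounds \<open>wt a w x\<close> by the integral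
  over \<open>z \<ge> 1\<close> of \<open>z powr (-a-1) * wt (a + 1) w' (z * x)\<close>. Minkowski's
  inequality for integrals applies to these dilates, each of norm at most
  \<open>z powr (-1/p) * K\<close>.\<close>

lemma Hardy_pos:
  assumes w: "rapid w" "rapid w'" "hderiv w w'" and a: "a \<ge> 0" and p: "p \<ge> 1"
    and K: "Lp_le lborel p (wt (a + 1) w') K" "K > 0"
  shows "Lp_le lborel p (wt a w) (p * K)"
proof -
  have [measurable]: "zext w' \<in> borel_measurable borel" using w by (simp add: zext_borel)
  have [measurable]: "wt a w \<in> borel_measurable borel" "wt (a + 1) w' \<in> borel_measurable borel"
    using w by (auto intro: wt_borel)
  define h where "h z x = (if z \<ge> 1 then z powr (-a-1) * wt (a + 1) w' (z * x) else 0)" for z x :: real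
  define c where "c z = (if z \<ge> 1 then z powr (-a-1) * (z powr (-1/p) * K) else 0)" for z :: real
  show ?thesis
  proof (rule Lp_le_integral_Minkowski[where h = h and c = c and N = lborel])
    show "(\<lambda>(z, x). h z x) \<in> borel_measurable (lborel \<Otimes>\<^sub>M lborel)"
      unfolding h_def[abs_def] by measurable
    show "c \<in> borel_measurable lborel" unfolding c_def[abs_def] by measurable
    show "Lp_le lborel p (h z) (c z)" for z
    proof (cases "z \<ge> 1")
      case True
      have "Lp_le lborel p (\<lambda>x. z powr (-a-1) *\<^sub>R wt (a + 1) w' (z * x)) (\<bar>z powr (-a-1)\<bar> * (z powr (-1/p) * K))"
        using True K p by (intro Lp_le_scaleR Lp_le_dilate) auto
      then show ?thesis using True by (simp add: h_def[abs_def] c_def)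
    next
      case False
      then show ?thesis using p by (simp add: h_def[abs_def] c_def Lp_le_def)
    qed
    show "h z x \<ge> 0" for z x by (simp add: h_def)
    show "h z x = 0" if "c z = 0" for z x
      using that K(2) by (auto simp: c_def h_def split: if_splits)
    show "sigma_finite_measure (lborel :: real measure)" "sigma_finite_measure (lborel :: real measure)"
      by (rule sigma_finite_lborel)+
    have I0: "((\<lambda>z. z powr (-a-1-1/p)) has_integral (- (1 powr (-a-1-1/p + 1)) / (-a-1-1/p + 1))) {1..}"
    proof (rule has_integral_powr_to_inf)
      have "1 / p > 0" using p by simp
      then show "-a-1-1/p < -1" using a by linarith
    qed simp
    have I: "((\<lambda>z. z powr (-a-1-1/p)) has_integral (1 / (a + 1/p))) {1..}"
    proof -
      have "-a-1-1/p + 1 = - (a + 1/p)" by simp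
      then have "- (1 powr (-a-1-1/p + 1)) / (-a-1-1/p + 1) = 1 / (a + 1/p)"
        by (simp only: powr_one_eq_one minus_divide_divide)
      then show ?thesis using I0 by (simp only:)
    qed
    have "((\<lambda>z. (z powr (-a-1-1/p)) * K) has_integral (1 / (a + 1/p)) * K) {1..}"
      using I by (rule has_integral_mult_left)
    then have "((\<lambda>z. if z \<in> {1..} then (z powr (-a-1-1/p)) * K else 0) has_integral (1 / (a + 1/p)) * K) UNIV"
      by (simp only: has_integral_restrict_UNIV)
    then have "(\<integral>\<^sup>+z. ennreal (if z \<in> {1..} then (z powr (-a-1-1/p)) * K else 0) \<partial>lborel) = ennreal ((1 / (a + 1/p)) * K)"
      by (intro nn_integral_has_integral_lborel) (use K in auto)
    moreover have "c z = (if z \<in> {1..} then (z powr (-a-1-1/p)) * K else 0)" for z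
      by (simp add: c_def powr_add[symmetric] mult.assoc[symmetric])
    ultimately have "(\<integral>\<^sup>+z. ennreal (c z) \<partial>lborel) = ennreal ((1 / (a + 1/p)) * K)" by simp
    also have "\<dots> \<le> ennreal (p * K)"
    \<comment> \<open>The integral of \<open>z powr (-a-1-1/p)\<close> over \<open>z \<ge> 1\<close>
      is \<open>1 / (a + 1/p)\<close>, largest at \<open>a = 0\<close>. Replacing it by
      \<open>p\<close> gives a constant that is uniform in the weight exponent.\<close>
    proof (intro ennreal_leI mult_right_mono)
      have "1 / (a + 1/p) \<le> 1 / (1/p)" using a p by (intro divide_left_mono mult_pos_pos) (auto intro: add_nonneg_pos)
      then show "1 / (a + 1/p) \<le> p" by simp
    qed (use K in auto)
    finally show "(\<integral>\<^sup>+z. ennreal (c z) \<partial>lborel) \<le> ennreal (p * K)" .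
    fix x :: real
    show "ennreal (norm (wt a w x)) \<le> (\<integral>\<^sup>+z. ennreal (h z x) \<partial>lborel)"
    proof (cases "x > 0")
      case True
      note F = rapid_FTC[OF w, of x]
      have "ennreal (cmod (w x)) \<le> (\<integral>\<^sup>+z. ennreal (norm (indicator {0..} z *\<^sub>R zext w' (x + z))) \<partial>lborel)"
        using F True integral_norm_bound_ennreal[of lborel "\<lambda>z. indicator {0..} z *\<^sub>R zext w' (x + z)"] by simp
      \<comment> \<open>The substitution \<open>z = x * (y - 1)\<close> turns the translate
        \<open>x + z\<close> into the dilate \<open>x * y\<close> and the range
        \<open>z \<ge> 0\<close> into \<open>y \<ge> 1\<close>.\<close>
      also have "\<dots> = ennreal \<bar>x\<bar> * (\<integral>\<^sup>+y. ennreal (norm (indicator {0..} (-x + x * y) *\<^sub>R zext w' (x + (-x + x * y)))) \<partial>lborel)"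
        using True by (intro nn_integral_real_affine) auto
      also have "\<dots> = (\<integral>\<^sup>+y. ennreal \<bar>x\<bar> * ennreal (norm (indicator {0..} (-x + x * y) *\<^sub>R zext w' (x + (-x + x * y)))) \<partial>lborel)"
        by (intro nn_integral_cmult[symmetric]) measurable
      finally have 1: "ennreal (cmod (w x)) \<le> \<dots>" .
      have "ennreal (norm (wt a w x)) = ennreal (x powr a) * ennreal (cmod (w x))"
        using True by (simp add: wt_def ennreal_mult[symmetric])
      also have "\<dots> \<le> ennreal (x powr a) * (\<integral>\<^sup>+y. ennreal \<bar>x\<bar> * ennreal (norm (indicator {0..} (-x + x * y) *\<^sub>R zext w' (x + (-x + x * y)))) \<partial>lborel)"
        using 1 by (intro mult_left_mono) auto
      also have "\<dots> = (\<integral>\<^sup>+y. ennreal (x powr a) * (ennreal \<bar>x\<bar> * ennreal (norm (indicator {0..} (-x + x * y) *\<^sub>R zext w' (x + (-x + x * y))))) \<partial>lborel)"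
        by (intro nn_integral_cmult[symmetric]) measurable
      also have "\<dots> = (\<integral>\<^sup>+z. ennreal (h z x) \<partial>lborel)"
      proof (intro nn_integral_cong)
        fix y :: real
        have *: "-x + x * y \<ge> 0 \<longleftrightarrow> y \<ge> 1" using True by (simp add: algebra_simps)
        have "x powr a * (\<bar>x\<bar> * norm (indicator {0..} (-x + x * y) *\<^sub>R zext w' (x + (-x + x * y)))) = h y x"
        proof (cases "y \<ge> 1")
          case y: True
          have "(y * x) powr (a + 1) = y powr (a + 1) * x powr (a + 1)" using y True by (intro powr_mult)
          moreover have "y powr (- a - 1) * y powr (a + 1) = 1" using y by (simp add: powr_add[symmetric])
          moreover have "x powr (a + 1) = x powr a * x" using True by (simp add: powr_add)
          ultimately show ?thesis using y True *
            by (simp add: h_def wt_def zext_eq mult.commute[of x y] mult.assoc[symmetric])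
        next
          case False
          then show ?thesis using * by (simp add: h_def)
        qed
        then show "ennreal (x powr a) * (ennreal \<bar>x\<bar> * ennreal (norm (indicator {0..} (-x + x * y) *\<^sub>R zext w' (x + (-x + x * y))))) = ennreal (h y x)"
          by (simp only: ennreal_mult[symmetric] abs_ge_zero norm_ge_zero mult_nonneg_nonneg powr_ge_zero)
      qed
      finally show ?thesis .
    qed simp
  qed (use p K in auto)
qed

lemma Hardy:
  assumes w: "rapid w" "rapid w'" "hderiv w w'" and a: "a \<ge> 0" and p: "p \<ge> 1"
    and K: "Lp_le lborel p (wt (a + 1) w') K"
  shows "Lp_le lborel p (wt a w) (p * K)"
proof (rule Lp_le_closed)
  fix \<epsilon> :: real assume e: "\<epsilon> > 0"
  have "Lp_le lborel p (wt (a + 1) w') (K + \<epsilon> / p)"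
    using p e by (intro Lp_le_mono[OF K Lp_leD(1)[OF K]]) auto
  from Hardy_pos[OF w a p this] have "Lp_le lborel p (wt a w) (p * (K + \<epsilon> / p))"
    using p e Lp_leD(2)[OF K] by (simp add: add_nonneg_pos)
  then show "Lp_le lborel p (wt a w) (p * K + \<epsilon>)" using p by (simp add: algebra_simps)
qed (use p Lp_leD(2)[OF K] in auto)

section \<open>A bilinear form with a kernel homogeneous of degree -1\<close>

lemma nn_integral_Beta:
  assumes "a > 0" "b > 0"
  shows "(\<integral>\<^sup>+t. ennreal (if 0 < t \<and> t < 1 then t powr (a - 1) * (1 - t) powr (b - 1) else 0) \<partial>lborel) = ennreal (Beta a b)"
proof -
  have "((\<lambda>t. t powr (a - 1) * (1 - t) powr (b - 1)) has_integral Beta a b) {0..1}"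
    using assms by (rule has_integral_Beta_real)
  then have "((\<lambda>t. if t \<in> {0..1} then t powr (a - 1) * (1 - t) powr (b - 1) else 0) has_integral Beta a b) UNIV"
    by (simp only: has_integral_restrict_UNIV)
  then have "((\<lambda>t. if 0 < t \<and> t < 1 then t powr (a - 1) * (1 - t) powr (b - 1) else 0) has_integral Beta a b) UNIV"
    by (rule has_integral_spike[of "{0,1}", rotated 2]) auto
  then show ?thesis by (intro nn_integral_has_integral_lborel) auto
qed

lemma Beta_real_nonneg: "a > 0 \<Longrightarrow> b > 0 \<Longrightarrow> Beta a b \<ge> (0::real)"
  by (simp add: Beta_def Gamma_real_nonneg)

text \<open>With \<open>x = z * y\<close> the powers of \<open>y\<close> in the kernel cancel
  against the Jacobian, because the kernel has degree -1. For fixed \<open>z\<close>, Hoelder's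
  inequality bounds the integral over \<open>y\<close> by \<open>z powr (-1/p) * K * L\<close>, the
  power being the norm of the dilation. What remains is the Beta integral of
  \<open>z powr (-1/p) * (1 - z) powr (\<beta> - 1)\<close>, which converges at 0 since p >
  1.\<close>

lemma bilinear_Hardy:
  fixes U V :: "real \<Rightarrow> real"
  assumes U: "Lp_le lborel p U K" "\<And>x. U x \<ge> 0" and V: "Lp_le lborel q V L" "\<And>x. V x \<ge> 0" "\<And>x. x \<le> 0 \<Longrightarrow> V x = 0"
    and pq: "p > 1" "q > 1" "1 / p + 1 / q = 1" and b: "\<beta> > 0"
  shows "(\<integral>\<^sup>+y. \<integral>\<^sup>+x. ennreal (if 0 < x \<and> x < y then U x * V y * ((y - x) powr (\<beta> - 1) * y powr (-\<beta>)) else 0) \<partial>lborel \<partial>lborel)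
     \<le> ennreal (Beta (1 - 1/p) \<beta> * (K * L))"
proof -
  have [measurable]: "U \<in> borel_measurable borel" "V \<in> borel_measurable borel"
    using Lp_leD(1)[OF U(1)] Lp_leD(1)[OF V(1)] by auto
  have "(\<integral>\<^sup>+y. \<integral>\<^sup>+x. ennreal (if 0 < x \<and> x < y then U x * V y * ((y - x) powr (\<beta> - 1) * y powr (-\<beta>)) else 0) \<partial>lborel \<partial>lborel)
     = (\<integral>\<^sup>+y. \<integral>\<^sup>+z. ennreal (if 0 < z \<and> z < 1 then (1 - z) powr (\<beta> - 1) * (U (z * y) * V y) else 0) \<partial>lborel \<partial>lborel)"
  proof (rule nn_integral_cong)
    fix y :: real
    show "(\<integral>\<^sup>+x. ennreal (if 0 < x \<and> x < y then U x * V y * ((y - x) powr (\<beta> - 1) * y powr (-\<beta>)) else 0) \<partial>lborel)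
       = (\<integral>\<^sup>+z. ennreal (if 0 < z \<and> z < 1 then (1 - z) powr (\<beta> - 1) * (U (z * y) * V y) else 0) \<partial>lborel)"
    proof (cases "y > 0")
      case True
      have "(\<integral>\<^sup>+x. ennreal (if 0 < x \<and> x < y then U x * V y * ((y - x) powr (\<beta> - 1) * y powr (-\<beta>)) else 0) \<partial>lborel)
        = ennreal \<bar>y\<bar> * (\<integral>\<^sup>+z. ennreal (if 0 < 0 + y * z \<and> 0 + y * z < y then U (0 + y * z) * V y * ((y - (0 + y * z)) powr (\<beta> - 1) * y powr (-\<beta>)) else 0) \<partial>lborel)"
        using True by (intro nn_integral_real_affine) auto
      also have "\<dots> = (\<integral>\<^sup>+z. ennreal \<bar>y\<bar> * ennreal (if 0 < 0 + y * z \<and> 0 + y * z < y then U (0 + y * z) * V y * ((y - (0 + y * z)) powr (\<beta> - 1) * y powr (-\<beta>)) else 0) \<partial>lborel)"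
        by (intro nn_integral_cmult[symmetric]) measurable
      also have "\<dots> = (\<integral>\<^sup>+z. ennreal (if 0 < z \<and> z < 1 then (1 - z) powr (\<beta> - 1) * (U (z * y) * V y) else 0) \<partial>lborel)"
      proof (rule nn_integral_cong)
        fix z :: real
        have iff: "0 < 0 + y * z \<and> 0 + y * z < y \<longleftrightarrow> 0 < z \<and> z < 1"
          using True by (auto simp: zero_less_mult_iff)
        show "ennreal \<bar>y\<bar> * ennreal (if 0 < 0 + y * z \<and> 0 + y * z < y then U (0 + y * z) * V y * ((y - (0 + y * z)) powr (\<beta> - 1) * y powr (-\<beta>)) else 0)
          = ennreal (if 0 < z \<and> z < 1 then (1 - z) powr (\<beta> - 1) * (U (z * y) * V y) else 0)"
        proof (cases "0 < z \<and> z < 1")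
          case z: True
          have "(y - (0 + y * z)) powr (\<beta> - 1) = (y * (1 - z)) powr (\<beta> - 1)" by (simp add: algebra_simps)
          also have "\<dots> = y powr (\<beta> - 1) * (1 - z) powr (\<beta> - 1)" using True z by (intro powr_mult)
          finally have e1: "(y - (0 + y * z)) powr (\<beta> - 1) = y powr (\<beta> - 1) * (1 - z) powr (\<beta> - 1)" .
          have "y powr (\<beta> - 1) * y powr (-\<beta>) = y powr ((\<beta> - 1) + (-\<beta>))" by (rule powr_add[symmetric])
          also have "\<dots> = 1 / y" using True by (simp add: powr_minus_divide)
          finally have "y * (y powr (\<beta> - 1) * y powr (-\<beta>)) = 1" using True by simp
          then have "y * (U (0 + y * z) * V y * ((y - (0 + y * z)) powr (\<beta> - 1) * y powr (-\<beta>))) = (1 - z) powr (\<beta> - 1) * (U (z * y) * V y)"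
            unfolding e1 by (simp add: mult_ac)
          then show ?thesis using True z iff U(2) V(2) by (simp add: ennreal_mult[symmetric])
        qed (use iff in auto)
      qed
      finally show ?thesis .
    next
      case False
      then show ?thesis using V(3) by (auto intro!: nn_integral_cong)
    qed
  qed
  also have "\<dots> = (\<integral>\<^sup>+z. \<integral>\<^sup>+y. ennreal (if 0 < z \<and> z < 1 then (1 - z) powr (\<beta> - 1) * (U (z * y) * V y) else 0) \<partial>lborel \<partial>lborel)"
    by (rule lborel_pair.Fubini'[of "\<lambda>z y. ennreal (if 0 < z \<and> z < 1 then (1 - z) powr (\<beta> - 1) * (U (z * y) * V y) else 0)"]) measurable
  also have "\<dots> \<le> (\<integral>\<^sup>+z. ennreal (if 0 < z \<and> z < 1 then z powr ((1 - 1/p) - 1) * (1 - z) powr (\<beta> - 1) else 0) * ennreal (K * L) \<partial>lborel)"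
  proof (rule nn_integral_mono)
    fix z :: real
    show "(\<integral>\<^sup>+y. ennreal (if 0 < z \<and> z < 1 then (1 - z) powr (\<beta> - 1) * (U (z * y) * V y) else 0) \<partial>lborel)
      \<le> ennreal (if 0 < z \<and> z < 1 then z powr ((1 - 1/p) - 1) * (1 - z) powr (\<beta> - 1) else 0) * ennreal (K * L)"
    proof (cases "0 < z \<and> z < 1")
      case True
      have "(\<integral>\<^sup>+y. ennreal (if 0 < z \<and> z < 1 then (1 - z) powr (\<beta> - 1) * (U (z * y) * V y) else 0) \<partial>lborel)
         = ennreal ((1 - z) powr (\<beta> - 1)) * (\<integral>\<^sup>+y. ennreal (norm (U (z * y)) * norm (V y)) \<partial>lborel)"
        using True U(2) V(2) by (subst nn_integral_cmult[symmetric]) (auto simp: ennreal_mult)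
      also have "\<dots> \<le> ennreal ((1 - z) powr (\<beta> - 1)) * ennreal ((z powr (-1/p) * K) * L)"
        using True U(1) V(1) pq by (intro mult_left_mono Lp_le_Holder[of _ p _ _ q] Lp_le_dilate) auto
      finally show ?thesis using True Lp_leD(2)[OF U(1)] Lp_leD(2)[OF V(1)]
        by (simp add: ennreal_mult[symmetric] mult_ac)
    qed auto
  qed
  also have "\<dots> = ennreal (Beta (1 - 1/p) \<beta>) * ennreal (K * L)"
    using pq b by (subst nn_integral_multc) (auto simp: nn_integral_Beta)
  also have "\<dots> = ennreal (Beta (1 - 1/p) \<beta> * (K * L))"
    using Beta_real_nonneg[of "1 - 1/p" \<beta>] pq b Lp_leD(2)[OF U(1)] Lp_leD(2)[OF V(1)]
    by (simp add: ennreal_mult[symmetric])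
  finally show ?thesis .
qed

section \<open>Products of Weyl integrals\<close>

text \<open>The semigroup law for orders \<beta> and 1 - \<beta>, whose sum 1 belongs to the kernel
  constant 1 on the positive half-line. Scaling by \<open>r\<close> removes \<open>r\<close>
  altogether and leaves \<open>Beta \<beta> (1 - \<beta>)\<close>, which is the product of the two
  Gamma factors since \<open>Gamma 1 = 1\<close>.\<close>

lemma weylk_convolution:
  assumes "0 < \<beta>" "\<beta> < 1" "r > 0"
  shows "(\<integral>\<^sup>+z. ennreal (weylk \<beta> z * weylk (1 - \<beta>) (r - z)) \<partial>lborel) = 1"
proof -
  have G: "Gamma \<beta> > 0" "Gamma (1 - \<beta>) > 0" using assms by (auto simp: Gamma_real_pos)
  have "(\<integral>\<^sup>+z. ennreal (weylk \<beta> z * weylk (1 - \<beta>) (r - z)) \<partial>lborel)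
     = ennreal \<bar>r\<bar> * (\<integral>\<^sup>+z. ennreal (weylk \<beta> (0 + r * z) * weylk (1 - \<beta>) (r - (0 + r * z))) \<partial>lborel)"
    using assms by (intro nn_integral_real_affine) auto
  also have "\<dots> = (\<integral>\<^sup>+z. ennreal \<bar>r\<bar> * ennreal (weylk \<beta> (0 + r * z) * weylk (1 - \<beta>) (r - (0 + r * z))) \<partial>lborel)"
    by (intro nn_integral_cmult[symmetric]) measurable
  also have "\<dots> = (\<integral>\<^sup>+z. ennreal (1 / (Gamma \<beta> * Gamma (1 - \<beta>))) * ennreal (if 0 < z \<and> z < 1 then z powr (\<beta> - 1) * (1 - z) powr ((1 - \<beta>) - 1) else 0) \<partial>lborel)"
  proof (rule nn_integral_cong)
    fix z :: real
    have pos: "r - (0 + r * z) > 0 \<longleftrightarrow> z < 1" "0 + r * z > 0 \<longleftrightarrow> z > 0"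
      using assms by (auto simp: zero_less_mult_iff)
    have "\<bar>r\<bar> * (weylk \<beta> (0 + r * z) * weylk (1 - \<beta>) (r - (0 + r * z))) =
      1 / (Gamma \<beta> * Gamma (1 - \<beta>)) * (if 0 < z \<and> z < 1 then z powr (\<beta> - 1) * (1 - z) powr ((1 - \<beta>) - 1) else 0)"
    proof (cases "0 < z \<and> z < 1")
      case True
      have "r - (0 + r * z) = r * (1 - z)" by (simp add: algebra_simps)
      then have "(r - (0 + r * z)) powr (1 - \<beta> - 1) = r powr (1 - \<beta> - 1) * (1 - z) powr (1 - \<beta> - 1)"
        using True assms by (simp add: powr_mult)
      moreover have "(0 + r * z) powr (\<beta> - 1) = r powr (\<beta> - 1) * z powr (\<beta> - 1)"
        using True assms by (simp add: powr_mult)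
      moreover have "r * (r powr (\<beta> - 1) * r powr (1 - \<beta> - 1)) = 1"
      proof -
        have "r powr (\<beta> - 1) * r powr (1 - \<beta> - 1) = r powr ((\<beta> - 1) + (1 - \<beta> - 1))" by (rule powr_add[symmetric])
        also have "\<dots> = 1 / r" using assms by (simp add: powr_minus_divide)
        finally show ?thesis using assms by simp
      qed
      ultimately have "\<bar>r\<bar> * ((0 + r * z) powr (\<beta> - 1) / Gamma \<beta> * ((r - (0 + r * z)) powr (1 - \<beta> - 1) / Gamma (1 - \<beta>)))
         = 1 / (Gamma \<beta> * Gamma (1 - \<beta>)) * (z powr (\<beta> - 1) * (1 - z) powr (1 - \<beta> - 1)) * (r * (r powr (\<beta> - 1) * r powr (1 - \<beta> - 1)))"
        using assms by (simp only: abs_of_pos) (simp add: mult_ac)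
      then show ?thesis using True pos \<open>r * (r powr (\<beta> - 1) * r powr (1 - \<beta> - 1)) = 1\<close> by (simp add: weylk_def)
    next
      case False
      then have "weylk \<beta> (0 + r * z) = 0 \<or> weylk (1 - \<beta>) (r - (0 + r * z)) = 0"
        using pos by (auto simp: weylk_def)
      then show ?thesis using False by auto
    qed
    then show "ennreal \<bar>r\<bar> * ennreal (weylk \<beta> (0 + r * z) * weylk (1 - \<beta>) (r - (0 + r * z)))
      = ennreal (1 / (Gamma \<beta> * Gamma (1 - \<beta>))) * ennreal (if 0 < z \<and> z < 1 then z powr (\<beta> - 1) * (1 - z) powr ((1 - \<beta>) - 1) else 0)"
      using G assms by (simp only: ennreal_mult[symmetric] abs_ge_zero weylk_nonneg mult_nonneg_nonneg)
        (subst ennreal_mult[symmetric], auto)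
  qed
  also have "\<dots> = ennreal (1 / (Gamma \<beta> * Gamma (1 - \<beta>))) * ennreal (Beta \<beta> (1 - \<beta>))"
    using assms by (subst nn_integral_cmult) (auto simp: nn_integral_Beta)
  also have "\<dots> = ennreal (1 / (Gamma \<beta> * Gamma (1 - \<beta>)) * Beta \<beta> (1 - \<beta>))"
    using G assms Beta_real_nonneg by (intro ennreal_mult[symmetric]) auto
  also have "1 / (Gamma \<beta> * Gamma (1 - \<beta>)) * Beta \<beta> (1 - \<beta>) = 1"
    using G by (simp add: Beta_def)
  finally show ?thesis by simp
qed

text \<open>By Fubini the composed kernels collapse to the kernel of order 1, and
  \<open>rapid_FTC\<close> identifies the resulting integral of \<open>u'\<close> as
  \<open>- u s\<close>. The inner \<open>kconv\<close> is \<open>W_+^\<beta> u\<close> up to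
  sign.\<close>

lemma weyl_inversion:
  assumes b: "0 < \<beta>" "\<beta> < 1" and u: "rapid u" "rapid u'" "hderiv u u'" and s: "s \<ge> 0"
  shows "u s = - kconv (weylk \<beta>) (kconv (weylk (1 - \<beta>)) u') s"
proof -
  let ?g = "1 - \<beta>"
  have [measurable]: "zext u' \<in> borel_measurable borel" using u by (simp add: zext_borel)
  have nn: "weylk \<beta> z \<ge> 0" "weylk ?g z \<ge> 0" for z using b by (auto intro: weylk_nonneg)
  \<comment> \<open>Here \<open>r\<close> is the total displacement of the two nested integrals.
    With \<open>r\<close> as variable the factor \<open>zext u' (s + r)\<close> is free of
    \<open>z\<close>, so that integrating over \<open>z\<close> first yields the convolution of the
    kernels.\<close>
  define H where "H z r = complex_of_real (weylk \<beta> z * weylk ?g (r - z)) * zext u' (s + r)" for z r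
  have Hm [measurable]: "case_prod H \<in> borel_measurable (lborel \<Otimes>\<^sub>M lborel)"
    unfolding H_def[abs_def] by measurable
  have inner: "(\<integral>\<^sup>+z. ennreal (weylk \<beta> z * weylk ?g (r - z)) \<partial>lborel) = indicator {0<..} r" for r
  proof (cases "r > 0")
    case True
    then show ?thesis using weylk_convolution[OF b] by simp
  next
    case False
    have z: "weylk \<beta> z * weylk ?g (r - z) = 0" for z using False by (auto simp: weylk_def)
    show ?thesis using False unfolding z by simp
  qed
  have inner': "(\<integral>z. weylk \<beta> z * weylk ?g (r - z) \<partial>lborel) = indicator {0<..} r" for r
    using inner[of r] nn by (subst integral_eq_nn_integral) (auto simp: indicator_def)
  have "(\<integral>\<^sup>+p. ennreal (norm (case_prod H p)) \<partial>(lborel \<Otimes>\<^sub>M lborel)) = (\<integral>\<^sup>+r. \<integral>\<^sup>+z. ennreal (norm (H z r)) \<partial>lborel \<partial>lborel)"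
    using lborel_pair.nn_integral_snd[of "\<lambda>p. ennreal (norm (case_prod H p))"] by simp
  also have "\<dots> = (\<integral>\<^sup>+r. \<integral>\<^sup>+z. ennreal (weylk \<beta> z * weylk ?g (r - z)) * ennreal (norm (zext u' (s + r))) \<partial>lborel \<partial>lborel)"
    using nn by (intro nn_integral_cong) (simp add: H_def norm_mult ennreal_mult[symmetric])
  also have "\<dots> = (\<integral>\<^sup>+r. indicator {0<..} r * ennreal (norm (zext u' (s + r))) \<partial>lborel)"
    by (subst nn_integral_multc) (auto simp: inner)
  also have "\<dots> \<le> (\<integral>\<^sup>+r. ennreal (norm (indicator {0..} r *\<^sub>R zext u' (s + r))) \<partial>lborel)"
    by (intro nn_integral_mono) (auto simp: indicator_def)
  also have "\<dots> < \<infinity>" using rapid_FTC(2)[OF u s] by (simp add: integrable_iff_bounded)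
  finally have int: "integrable (lborel \<Otimes>\<^sub>M lborel) (case_prod H)"
    by (intro integrableI_bounded Hm)
  have "kconv (weylk \<beta>) (kconv (weylk ?g) u') s = (\<integral>z. \<integral>r. H z r \<partial>lborel \<partial>lborel)"
    unfolding kconv_def[of "weylk \<beta>"]
  proof (intro Bochner_Integration.integral_cong refl)
    fix z :: real
    show "weylk \<beta> z *\<^sub>R zext (kconv (weylk ?g) u') (s + z) = (\<integral>r. H z r \<partial>lborel)"
    proof (cases "z > 0")
      case True
      have "(\<integral>r. H z r \<partial>lborel) = weylk \<beta> z * (\<integral>r. weylk ?g (r - z) *\<^sub>R zext u' (s + r) \<partial>lborel)"
        by (subst integral_mult_right_zero[symmetric], intro Bochner_Integration.integral_cong refl)
           (simp add: H_def scaleR_conv_of_real)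
      also have "(\<integral>r. weylk ?g (r - z) *\<^sub>R zext u' (s + r) \<partial>lborel) = (\<integral>r. weylk ?g ((z + 1 * r) - z) *\<^sub>R zext u' (s + (z + 1 * r)) \<partial>lborel)"
        by (subst lborel_integral_real_affine[of 1 _ z]) auto
      also have "\<dots> = zext (kconv (weylk ?g) u') (s + z)" using True s by (simp add: zext_eq kconv_def add.assoc)
      finally show ?thesis by (simp add: scaleR_conv_of_real)
    qed (simp add: H_def weylk_def)
  qed
  also have "\<dots> = (\<integral>r. \<integral>z. H z r \<partial>lborel \<partial>lborel)"
    using lborel_pair.Fubini_integral[OF int] by simp
  also have "\<dots> = (\<integral>r. indicator {0..} r *\<^sub>R zext u' (s + r) \<partial>lborel)"
  proof (intro integral_cong_AE)
    \<comment> \<open>The convolution gives the indicator of the open half-line, whereas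
      \<open>rapid_FTC\<close> has the closed one; they differ at 0 only.\<close>
    have "AE r in lborel. r \<noteq> (0::real)" by (rule AE_lborel_singleton)
    then show "AE r in lborel. (\<integral>z. H z r \<partial>lborel) = indicator {0..} r *\<^sub>R zext u' (s + r)"
    proof eventually_elim
      fix r :: real assume "r \<noteq> 0"
      have "(\<integral>z. H z r \<partial>lborel) = (\<integral>z. complex_of_real (weylk \<beta> z * weylk ?g (r - z)) \<partial>lborel) * zext u' (s + r)"
        unfolding H_def by (rule integral_mult_left_zero)
      also have "(\<integral>z. complex_of_real (weylk \<beta> z * weylk ?g (r - z)) \<partial>lborel) = complex_of_real (indicator {0<..} r)"
        unfolding integral_complex_of_real inner' ..
      finally show "(\<integral>z. H z r \<partial>lborel) = indicator {0..} r *\<^sub>R zext u' (s + r)"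
        using \<open>r \<noteq> 0\<close> by (auto simp: indicator_def)
    qed
  qed measurable
  also have "\<dots> = - u s" using rapid_FTC(1)[OF u s] by simp
  finally show ?thesis by simp
qed

text \<open>While \<open>m\<close> increases, \<open>\<bar>m (t + h) - m t\<bar>\<close> is the
  difference itself and telescopes under integration; the final drop to 0 is seen only by
  \<open>t\<close> in a stretch of length \<open>h\<close>. Rise and drop contribute at most
  \<open>h * K\<close> each. The weight costs its value at the right end \<open>x\<close>, beyond
  which the integrand vanishes.\<close>

lemma weighted_variation_bound:
  fixes m :: "real \<Rightarrow> real"
  assumes [measurable]: "m \<in> borel_measurable borel" and m0: "\<And>t. m t \<ge> 0" and x: "x > 0"
    and mx: "\<And>t. t \<ge> x \<Longrightarrow> m t = 0" and mono: "\<And>s t. 0 \<le> s \<Longrightarrow> s \<le> t \<Longrightarrow> t < x \<Longrightarrow> m s \<le> m t"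
    and K: "\<And>t. 0 \<le> t \<Longrightarrow> m t \<le> K" and h: "h > 0" and c: "c \<ge> 0"
  shows "(\<integral>\<^sup>+t. ennreal (if t > 0 then t powr c * \<bar>m (t + h) - m t\<bar> else 0) \<partial>lborel) \<le> ennreal (2 * h * K * x powr c)"
proof -
  have K0: "K \<ge> 0" using K[of 0] m0[of 0] by simp
  define f where "f t = (if t > 0 then \<bar>m (t + h) - m t\<bar> else 0)" for t
  define g where "g t = (if t > 0 then m t else 0)" for t
  have [measurable]: "f \<in> borel_measurable borel" "g \<in> borel_measurable borel"
    unfolding f_def[abs_def] g_def[abs_def] by measurable
  have g0: "g t \<ge> 0" for t using m0 by (simp add: g_def)
  \<comment> \<open>The telescoping is stated with sums instead of differences so that it survives
    in \<open>ennreal\<close>. On the last stretch before \<open>x\<close>,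
    \<open>m (t + h) = 0\<close>, so both \<open>f t\<close> and \<open>g t\<close> equal
    \<open>m t\<close>; this explains \<open>2 * K\<close>.\<close>
  have le: "f t + g t \<le> g (h + 1 * t) + 2 * K * indicator {x - h..x} t" for t
  proof (cases "t > 0")
    case t: True
    have mt: "m t \<le> K" using K t by simp
    show ?thesis
    proof (cases "t + h < x")
      case True
      then have "m t \<le> m (t + h)" using mono[of t "t + h"] t h by simp
      then show ?thesis using t h K0 by (simp add: f_def g_def add.commute)
    next
      case False
      then have z: "m (t + h) = 0" using mx by simp
      show ?thesis
      proof (cases "t \<le> x")
        case True
        then show ?thesis using False z t h mt m0[of t] by (simp add: f_def g_def add.commute)
      next
        case False
        then show ?thesis using z t h mx[of t] K0 by (simp add: f_def g_def add.commute)
      qed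
    qed
  next
    case False
    then show ?thesis using g0[of "h + 1*t"] K0 by (simp add: f_def g_def)
  qed
  \<comment> \<open>Translation leaves the integral of \<open>g\<close> unchanged on the other side;
    its finiteness is what permits cancelling it there.\<close>
  have Ig: "(\<integral>\<^sup>+t. ennreal (g t) \<partial>lborel) < \<infinity>"
  proof -
    have "(\<integral>\<^sup>+t. ennreal (g t) \<partial>lborel) \<le> (\<integral>\<^sup>+t. ennreal K * indicator {0..x} t \<partial>lborel)"
      using K mx by (intro nn_integral_mono) (auto simp: g_def indicator_def not_le intro!: ennreal_leI)
    also have "\<dots> = ennreal K * ennreal x" using x by (simp add: nn_integral_cmult_indicator)
    finally show ?thesis by (auto simp: ennreal_mult[symmetric] K0 x less_imp_le intro: le_less_trans)
  qed
  have "(\<integral>\<^sup>+t. ennreal (f t) \<partial>lborel) + (\<integral>\<^sup>+t. ennreal (g t) \<partial>lborel) = (\<integral>\<^sup>+t. ennreal (f t + g t) \<partial>lborel)"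
    by (subst nn_integral_add[symmetric]) (auto simp: ennreal_plus f_def g0)
  also have "\<dots> \<le> (\<integral>\<^sup>+t. ennreal (g (h + 1 * t) + 2 * K * indicator {x - h..x} t) \<partial>lborel)"
    by (intro nn_integral_mono ennreal_leI le)
  also have "\<dots> = (\<integral>\<^sup>+t. ennreal (g (h + 1 * t)) + ennreal (2 * K) * indicator {x - h..x} t \<partial>lborel)"
    using K0 g0 by (intro nn_integral_cong) (auto simp: ennreal_plus indicator_def)
  also have "\<dots> = (\<integral>\<^sup>+t. ennreal (g (h + 1 * t)) \<partial>lborel) + (\<integral>\<^sup>+t. ennreal (2 * K) * indicator {x - h..x} t \<partial>lborel)"
    by (rule nn_integral_add) auto
  also have "(\<integral>\<^sup>+t. ennreal (2 * K) * indicator {x - h..x} t \<partial>lborel) = ennreal (2 * K * h)"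
    using h K0 by (subst nn_integral_cmult_indicator) (auto simp: ennreal_mult)
  also have "(\<integral>\<^sup>+t. ennreal (g (h + 1 * t)) \<partial>lborel) = (\<integral>\<^sup>+t. ennreal (g t) \<partial>lborel)"
    using nn_integral_real_affine[of "\<lambda>t. ennreal (g t)" 1 h] by simp
  finally have "(\<integral>\<^sup>+t. ennreal (g t) \<partial>lborel) + (\<integral>\<^sup>+t. ennreal (f t) \<partial>lborel) \<le> (\<integral>\<^sup>+t. ennreal (g t) \<partial>lborel) + ennreal (2 * K * h)"
    by (simp add: add.commute)
  then have If: "(\<integral>\<^sup>+t. ennreal (f t) \<partial>lborel) \<le> ennreal (2 * K * h)"
    using Ig by (auto simp: ennreal_add_left_cancel_le)
  have "(\<integral>\<^sup>+t. ennreal (if t > 0 then t powr c * \<bar>m (t + h) - m t\<bar> else 0) \<partial>lborel) \<le> (\<integral>\<^sup>+t. ennreal (x powr c) * ennreal (f t) \<partial>lborel)"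
  proof (rule nn_integral_mono)
    fix t :: real
    have "(if t > 0 then t powr c * \<bar>m (t + h) - m t\<bar> else 0) \<le> x powr c * f t"
    proof (cases "0 < t \<and> t < x")
      case True
      then have "t powr c \<le> x powr c" using c by (intro powr_mono2) auto
      then show ?thesis using True by (auto simp: f_def intro: mult_right_mono)
    next
      case False
      then show ?thesis using mx[of t] mx[of "t + h"] h by (auto simp: f_def)
    qed
    then show "ennreal (if t > 0 then t powr c * \<bar>m (t + h) - m t\<bar> else 0) \<le> ennreal (x powr c) * ennreal (f t)"
      by (simp add: ennreal_mult[symmetric] ennreal_leI f_def)
  qed
  also have "\<dots> = ennreal (x powr c) * (\<integral>\<^sup>+t. ennreal (f t) \<partial>lborel)" by (rule nn_integral_cmult) auto
  also have "\<dots> \<le> ennreal (x powr c) * ennreal (2 * K * h)" using If by (intro mult_left_mono) auto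
  also have "\<dots> = ennreal (2 * h * K * x powr c)" using K0 h by (simp add: ennreal_mult[symmetric] mult_ac)
  finally show ?thesis .
qed

text \<open>
  If \<open>u\<close> and \<open>v\<close> are the Weyl integrals of order \<open>\<beta>\<close> of \<open>F\<close> and \<open>G\<close>, then \<open>W\<^sub>+\<^bsup>\<beta>-1\<^esup>(u v)(t)\<close> is the
  double integral of \<open>F x G y\<close> against \<open>pkernel \<beta> (x - t) (y - t)\<close>. As a function of \<open>t\<close> this kernel
  increases up to \<open>min x y\<close> and vanishes afterwards, so its variation is twice its supremum.
\<close>

definition pkernel :: "real \<Rightarrow> real \<Rightarrow> real \<Rightarrow> real" where
  "pkernel \<beta> a b = (\<integral>z. weylk (1 - \<beta>) z * (weylk \<beta> (a - z) * weylk \<beta> (b - z)) \<partial>lborel)"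

lemma pkernel_measurable [measurable (raw)]:
  assumes [measurable]: "f \<in> borel_measurable M" "g \<in> borel_measurable M"
  shows "(\<lambda>w. pkernel \<beta> (f w) (g w)) \<in> borel_measurable M"
  unfolding pkernel_def by measurable

lemma pkernel_commute: "pkernel \<beta> a b = pkernel \<beta> b a"
  unfolding pkernel_def by (simp add: mult_ac)

lemma pkernel_nonneg: "0 < \<beta> \<Longrightarrow> \<beta> < 1 \<Longrightarrow> pkernel \<beta> a b \<ge> 0"
  unfolding pkernel_def by (intro integral_nonneg_AE always_eventually allI mult_nonneg_nonneg weylk_nonneg) auto

lemma pkernel_zero: "a \<le> 0 \<Longrightarrow> pkernel \<beta> a b = 0"
proof -
  assume "a \<le> 0"
  then have "(\<lambda>z. weylk (1 - \<beta>) z * (weylk \<beta> (a - z) * weylk \<beta> (b - z))) = (\<lambda>z. 0)"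
    by (auto simp: weylk_def fun_eq_iff)
  then show ?thesis by (simp add: pkernel_def)
qed

lemma weylk_antimono: "0 < \<beta> \<Longrightarrow> \<beta> \<le> 1 \<Longrightarrow> 0 < x \<Longrightarrow> x \<le> y \<Longrightarrow> weylk \<beta> y \<le> weylk \<beta> x"
  by (auto simp: weylk_def intro!: divide_right_mono powr_mono2' Gamma_real_nonneg)

text \<open>The substitution \<open>z = a * v\<close> produces powers of \<open>a\<close> with total
  exponent \<open>1 - \<beta> + (\<beta> - 1) = 0\<close>. All dependence on \<open>a\<close> and
  \<open>b\<close> is thereby concentrated in one decreasing factor, integrated against a fixed
  density in \<open>v\<close>, from which monotonicity and supremum can be read off.\<close>

lemma pkernel_eq:
  assumes "0 < \<beta>" "\<beta> < 1" "0 < a" "a < b"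
  shows "pkernel \<beta> a b = (\<integral>v. weylk (1 - \<beta>) v * weylk \<beta> (1 - v) * weylk \<beta> (b - a * v) \<partial>lborel)"
proof -
  have "pkernel \<beta> a b = \<bar>a\<bar> *\<^sub>R (\<integral>v. weylk (1 - \<beta>) (0 + a * v) * (weylk \<beta> (a - (0 + a * v)) * weylk \<beta> (b - (0 + a * v))) \<partial>lborel)"
    unfolding pkernel_def using assms by (intro lborel_integral_real_affine) auto
  also have "\<dots> = (\<integral>v. \<bar>a\<bar> * (weylk (1 - \<beta>) (0 + a * v) * (weylk \<beta> (a - (0 + a * v)) * weylk \<beta> (b - (0 + a * v)))) \<partial>lborel)"
    by simp
  also have "\<dots> = (\<integral>v. weylk (1 - \<beta>) v * weylk \<beta> (1 - v) * weylk \<beta> (b - a * v) \<partial>lborel)"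
  proof (intro Bochner_Integration.integral_cong refl)
    fix v :: real
    show "\<bar>a\<bar> * (weylk (1 - \<beta>) (0 + a * v) * (weylk \<beta> (a - (0 + a * v)) * weylk \<beta> (b - (0 + a * v))))
      = weylk (1 - \<beta>) v * weylk \<beta> (1 - v) * weylk \<beta> (b - a * v)"
    proof (cases "0 < v \<and> v < 1")
      case True
      have e: "a - (0 + a * v) = a * (1 - v)" by (simp add: algebra_simps)
      have 1: "weylk (1 - \<beta>) (0 + a * v) = a powr (-\<beta>) * weylk (1 - \<beta>) v"
        using True assms by (simp add: weylk_def powr_mult)
      have 2: "weylk \<beta> (a - (0 + a * v)) = a powr (\<beta> - 1) * weylk \<beta> (1 - v)"
        unfolding e using True assms by (simp add: weylk_def powr_mult)
      have "a powr (-\<beta>) * a powr (\<beta> - 1) = a powr (-\<beta> + (\<beta> - 1))" by (rule powr_add[symmetric])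
      also have "\<dots> = 1 / a" using assms by (simp add: powr_minus_divide)
      finally have 3: "a * (a powr (-\<beta>) * a powr (\<beta> - 1)) = 1" using assms by simp
      have "\<bar>a\<bar> * (weylk (1 - \<beta>) (0 + a * v) * (weylk \<beta> (a - (0 + a * v)) * weylk \<beta> (b - (0 + a * v))))
        = (a * (a powr (-\<beta>) * a powr (\<beta> - 1))) * (weylk (1 - \<beta>) v * weylk \<beta> (1 - v) * weylk \<beta> (b - a * v))"
        unfolding 1 2 using assms by (simp add: mult_ac)
      then show ?thesis unfolding 3 by simp
    next
      case False
      then show ?thesis using assms by (auto simp: weylk_def zero_less_mult_iff)
    qed
  qed
  finally show ?thesis .
qed

text \<open>By \<open>weylk_convolution\<close> with \<open>r = 1\<close> the first two factors form
  a probability density on (0,1). There \<open>b - a * v\<close> is at least \<open>b - a\<close>,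
  and \<open>weylk \<beta>\<close> decreases.\<close>

lemma pkernel_integrable_aux:
  assumes "0 < \<beta>" "\<beta> < 1" "0 \<le> a" "a < b"
  shows "integrable lborel (\<lambda>v. weylk (1 - \<beta>) v * weylk \<beta> (1 - v) * weylk \<beta> (b - a * v))"
    and "(\<integral>v. weylk (1 - \<beta>) v * weylk \<beta> (1 - v) * weylk \<beta> (b - a * v) \<partial>lborel) \<le> weylk \<beta> (b - a)"
proof -
  have "(\<integral>\<^sup>+v. ennreal (weylk (1 - \<beta>) v * weylk \<beta> (1 - v)) \<partial>lborel) = 1"
    using weylk_convolution[of "1 - \<beta>" 1] assms by simp
  then have i1: "integrable lborel (\<lambda>v. weylk (1 - \<beta>) v * weylk \<beta> (1 - v))"
    and i1': "(\<integral>v. weylk (1 - \<beta>) v * weylk \<beta> (1 - v) \<partial>lborel) = 1"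
    using assms by (auto intro!: integrableI_nonneg weylk_nonneg mult_nonneg_nonneg simp: integral_eq_nn_integral weylk_nonneg)
  have le: "weylk (1 - \<beta>) v * weylk \<beta> (1 - v) * weylk \<beta> (b - a * v) \<le> weylk (1 - \<beta>) v * weylk \<beta> (1 - v) * weylk \<beta> (b - a)" for v
  proof (cases "0 < v \<and> v < 1")
    case True
    have "a * v \<le> a * 1" using True assms by (intro mult_left_mono) auto
    then have "weylk \<beta> (b - a * v) \<le> weylk \<beta> (b - a)" using assms by (intro weylk_antimono) auto
    then show ?thesis using assms by (intro mult_left_mono mult_nonneg_nonneg weylk_nonneg) auto
  next
    case False
    then show ?thesis by (auto simp: weylk_def)
  qed
  have nn: "weylk (1 - \<beta>) v * weylk \<beta> (1 - v) * weylk \<beta> (b - a * v) \<ge> 0" for v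
    using assms by (intro mult_nonneg_nonneg weylk_nonneg) auto
  have i2: "integrable lborel (\<lambda>v. weylk (1 - \<beta>) v * weylk \<beta> (1 - v) * weylk \<beta> (b - a))"
    by (rule integrable_mult_left) (rule i1)
  show i3: "integrable lborel (\<lambda>v. weylk (1 - \<beta>) v * weylk \<beta> (1 - v) * weylk \<beta> (b - a * v))"
    by (rule Bochner_Integration.integrable_bound[OF i2]) (use le nn in \<open>auto intro!: always_eventually order_trans[OF le]\<close>)
  have "(\<integral>v. weylk (1 - \<beta>) v * weylk \<beta> (1 - v) * weylk \<beta> (b - a * v) \<partial>lborel) \<le> (\<integral>v. weylk (1 - \<beta>) v * weylk \<beta> (1 - v) * weylk \<beta> (b - a) \<partial>lborel)"
    by (intro integral_mono i2 i3 le)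
  then show "(\<integral>v. weylk (1 - \<beta>) v * weylk \<beta> (1 - v) * weylk \<beta> (b - a * v) \<partial>lborel) \<le> weylk \<beta> (b - a)"
    using i1' by simp
qed

text \<open>After \<open>pkernel_eq\<close> the kernel is an average of \<open>weylk \<beta>\<close>
  at \<open>y - x * v - t * (1 - v)\<close>. For \<open>v\<close> in (0,1) this argument decreases
  in \<open>t\<close>, so the kernel increases until \<open>t\<close> reaches \<open>x\<close>,
  always below \<open>weylk \<beta> (y - x)\<close>.\<close>

lemma pkernel_variation:
  assumes b: "0 < \<beta>" "\<beta> < 1" and x: "0 < x" "x < y" and h: "h > 0" and c: "c \<ge> 0"
  shows "(\<integral>\<^sup>+t. ennreal (if t > 0 then t powr c * \<bar>pkernel \<beta> (x - (t + h)) (y - (t + h)) - pkernel \<beta> (x - t) (y - t)\<bar> else 0) \<partial>lborel)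
    \<le> ennreal (2 * h * weylk \<beta> (y - x) * x powr c)"
proof (rule weighted_variation_bound)
  show "(\<lambda>t. pkernel \<beta> (x - t) (y - t)) \<in> borel_measurable borel" by measurable
  show "pkernel \<beta> (x - t) (y - t) \<ge> 0" for t using b by (rule pkernel_nonneg)
  show "pkernel \<beta> (x - t) (y - t) = 0" if "t \<ge> x" for t using that by (intro pkernel_zero) auto
  show "pkernel \<beta> (x - t) (y - t) \<le> weylk \<beta> (y - x)" for t
  proof (cases "t < x")
    case True
    then show ?thesis using pkernel_eq[of \<beta> "x - t" "y - t"] pkernel_integrable_aux(2)[of \<beta> "x - t" "y - t"] b x by simp
  next
    case False
    then show ?thesis using pkernel_zero[of "x - t"] b by (simp add: weylk_nonneg)
  qed
  show "pkernel \<beta> (x - s) (y - s) \<le> pkernel \<beta> (x - t) (y - t)" if "0 \<le> s" "s \<le> t" "t < x" for s t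
  proof -
    have "(\<integral>v. weylk (1 - \<beta>) v * weylk \<beta> (1 - v) * weylk \<beta> ((y - s) - (x - s) * v) \<partial>lborel)
      \<le> (\<integral>v. weylk (1 - \<beta>) v * weylk \<beta> (1 - v) * weylk \<beta> ((y - t) - (x - t) * v) \<partial>lborel)"
    proof (intro integral_mono pkernel_integrable_aux)
      fix v :: real
      show "weylk (1 - \<beta>) v * weylk \<beta> (1 - v) * weylk \<beta> ((y - s) - (x - s) * v)
        \<le> weylk (1 - \<beta>) v * weylk \<beta> (1 - v) * weylk \<beta> ((y - t) - (x - t) * v)"
      proof (cases "0 < v \<and> v < 1")
        case True
        have "(x - t) * v \<le> (x - t) * 1" using True that by (intro mult_left_mono) auto
        then have 1: "0 < (y - t) - (x - t) * v" using x by simp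
        have "s * (1 - v) \<le> t * (1 - v)" using True that by (intro mult_right_mono) auto
        then have "(y - t) - (x - t) * v \<le> (y - s) - (x - s) * v" by (simp add: algebra_simps)
        then have "weylk \<beta> ((y - s) - (x - s) * v) \<le> weylk \<beta> ((y - t) - (x - t) * v)"
          using 1 b by (intro weylk_antimono) auto
        then show ?thesis using b by (intro mult_left_mono mult_nonneg_nonneg weylk_nonneg) auto
      next
        case False
        then show ?thesis by (auto simp: weylk_def)
      qed
    qed (use that x b in auto)
    then show ?thesis using pkernel_eq[of \<beta> "x - s" "y - s"] pkernel_eq[of \<beta> "x - t" "y - t"] that x b by simp
  qed
qed (use x h c in auto)

section \<open>The product of two Weyl integrals as a double integral\<close>

lemma kconv_shift_form:
  assumes "admissible k" "rapid F" "s \<ge> 0"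
  shows "kconv k F s = (\<integral>x. complex_of_real (k (x - s)) * zext F x \<partial>lborel)"
proof -
  have "(\<integral>x. complex_of_real (k (x - s)) * zext F x \<partial>lborel) = \<bar>1\<bar> *\<^sub>R (\<integral>x. complex_of_real (k ((s + 1 * x) - s)) * zext F (s + 1 * x) \<partial>lborel)"
    by (intro lborel_integral_real_affine) auto
  then show ?thesis by (simp add: kconv_def scaleR_conv_of_real)
qed

text \<open>The absolute counterpart of the decay of \<open>kconv\<close>, stated with the
  nonnegative integral so that it can justify Fubini for products.\<close>

lemma kconv_shift_bound:
  assumes k: "admissible k" "\<And>z. k z \<ge> 0" and F: "rapid F"
  obtains C where "C \<ge> 0" "\<And>s. s \<ge> 0 \<Longrightarrow> (\<integral>\<^sup>+x. ennreal (k (x - s) * cmod (zext F x)) \<partial>lborel) \<le> ennreal (C / (1 + s) ^ m)"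
proof -
  have [measurable]: "zext F \<in> borel_measurable borel" "k \<in> borel_measurable borel"
    using assms by (auto simp: admissible_def intro: zext_borel)
  obtain B where B: "B \<ge> 0" "\<And>t z. t \<ge> 0 \<Longrightarrow> norm (k z *\<^sub>R zext F (t + z)) \<le> (B / (1 + t) ^ m) * norm (k z / (1 + z)\<^sup>2)"
    using kernel_norm_bound[OF k(1) F] by metis
  define J where "J = (\<integral>z. norm (k z / (1 + z)\<^sup>2) \<partial>lborel)"
  have J: "J \<ge> 0" by (simp add: J_def)
  have JI: "(\<integral>\<^sup>+z. ennreal (norm (k z / (1 + z)\<^sup>2)) \<partial>lborel) = ennreal J"
    unfolding J_def using k(1) by (intro nn_integral_eq_integral integrable_norm) (auto simp: admissible_def)
  have "(\<integral>\<^sup>+x. ennreal (k (x - s) * cmod (zext F x)) \<partial>lborel) \<le> ennreal ((B * J) / (1 + s) ^ m)" if s: "s \<ge> 0" for s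
  proof -
    have "(\<integral>\<^sup>+x. ennreal (k (x - s) * cmod (zext F x)) \<partial>lborel) = ennreal \<bar>1\<bar> * (\<integral>\<^sup>+x. ennreal (k ((s + 1 * x) - s) * cmod (zext F (s + 1 * x))) \<partial>lborel)"
      by (intro nn_integral_real_affine) auto
    also have "\<dots> \<le> (\<integral>\<^sup>+x. ennreal (B / (1 + s) ^ m) * ennreal (norm (k x / (1 + x)\<^sup>2)) \<partial>lborel)"
      using B(2)[OF s] B(1) s k(2) by (auto intro!: nn_integral_mono ennreal_leI simp: ennreal_mult[symmetric])
    also have "\<dots> = ennreal (B / (1 + s) ^ m) * ennreal J"
      using JI by (subst nn_integral_cmult) auto
    also have "\<dots> = ennreal ((B * J) / (1 + s) ^ m)" using B(1) J s by (simp add: ennreal_mult[symmetric])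
    finally show ?thesis .
  qed
  then show ?thesis using that[of "B * J"] B(1) J by simp
qed

text \<open>Both inner integrals are expanded at the same point \<open>s = t + z\<close>, and the
  integration over \<open>z\<close> is then carried out first; what it produces is
  \<open>pkernel\<close>.\<close>

lemma weyl_product_representation:
  assumes b: "0 < \<beta>" "\<beta> < 1" and F: "rapid F" and G: "rapid G" and t: "t \<ge> 0"
  shows "integrable (lborel \<Otimes>\<^sub>M lborel) (\<lambda>(x, y). complex_of_real (pkernel \<beta> (x - t) (y - t)) * (zext F x * zext G y))" (is ?A)
    and "kconv (weylk (1 - \<beta>)) (\<lambda>s. kconv (weylk \<beta>) F s * kconv (weylk \<beta>) G s) t
      = (\<integral>(x, y). complex_of_real (pkernel \<beta> (x - t) (y - t)) * (zext F x * zext G y) \<partial>(lborel \<Otimes>\<^sub>M lborel))" (is ?B)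
proof -
  let ?g = "weylk (1 - \<beta>)" and ?k = "weylk \<beta>"
  have [measurable]: "zext F \<in> borel_measurable borel" "zext G \<in> borel_measurable borel" using F G by (auto intro: zext_borel)
  have admissible: "admissible ?g" "admissible ?k" using b by (auto intro: admissible_weylk)
  have nn: "?g z \<ge> 0" "?k z \<ge> 0" for z using b by (auto intro: weylk_nonneg)
  have S: "sigma_finite_measure (lborel \<Otimes>\<^sub>M lborel :: (real \<times> real) measure)"
    unfolding lborel_prod by (rule sigma_finite_lborel)
  interpret P: pair_sigma_finite "lborel :: real measure" "lborel \<Otimes>\<^sub>M lborel :: (real \<times> real) measure"
    by (intro pair_sigma_finite.intro sigma_finite_lborel S)
  define T where "T z w = complex_of_real (?g z * (?k (fst w - t - z) * ?k (snd w - t - z))) * (zext F (fst w) * zext G (snd w))" for z w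
  have Tm [measurable]: "case_prod T \<in> borel_measurable (lborel \<Otimes>\<^sub>M (lborel \<Otimes>\<^sub>M lborel))"
    unfolding T_def[abs_def] by measurable
  \<comment> \<open>For absolute integrability over \<open>z\<close> the kernel of order
    \<open>1 - \<beta>\<close> needs quadratic decay. It is taken from \<open>F\<close> alone; for
    \<open>G\<close> boundedness, exponent 0, suffices.\<close>
  obtain C1 where C1: "C1 \<ge> 0" "\<And>s. s \<ge> 0 \<Longrightarrow> (\<integral>\<^sup>+x. ennreal (?k (x - s) * cmod (zext F x)) \<partial>lborel) \<le> ennreal (C1 / (1 + s) ^ 2)"
    using kconv_shift_bound[OF admissible(2) nn(2) F] by metis
  obtain C2 where C2: "C2 \<ge> 0" "\<And>s. s \<ge> 0 \<Longrightarrow> (\<integral>\<^sup>+x. ennreal (?k (x - s) * cmod (zext G x)) \<partial>lborel) \<le> ennreal (C2 / (1 + s) ^ 0)"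
    using kconv_shift_bound[OF admissible(2) nn(2) G] by metis
  have inner: "(\<integral>\<^sup>+w. ennreal (norm (T z w)) \<partial>(lborel \<Otimes>\<^sub>M lborel)) \<le> ennreal (C1 * C2) * ennreal (norm (?g z / (1 + z)\<^sup>2))" for z
  proof (cases "z > 0")
    case True
    have "(\<integral>\<^sup>+w. ennreal (norm (T z w)) \<partial>(lborel \<Otimes>\<^sub>M lborel)) = (\<integral>\<^sup>+x. \<integral>\<^sup>+y. ennreal (norm (T z (x, y))) \<partial>lborel \<partial>lborel)"
      by (rule lborel.nn_integral_fst[symmetric]) measurable
    also have "\<dots> = (\<integral>\<^sup>+x. \<integral>\<^sup>+y. (ennreal (?g z) * ennreal (?k (x - (t + z)) * cmod (zext F x))) * ennreal (?k (y - (t + z)) * cmod (zext G y)) \<partial>lborel \<partial>lborel)"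
      using nn by (intro nn_integral_cong) (simp add: T_def norm_mult ennreal_mult[symmetric] mult_ac diff_diff_eq)
    also have "\<dots> = (\<integral>\<^sup>+x. (ennreal (?g z) * ennreal (?k (x - (t + z)) * cmod (zext F x))) * (\<integral>\<^sup>+y. ennreal (?k (y - (t + z)) * cmod (zext G y)) \<partial>lborel) \<partial>lborel)"
      by (intro nn_integral_cong nn_integral_cmult) measurable
    also have "\<dots> = (\<integral>\<^sup>+x. (ennreal (?g z) * ennreal (?k (x - (t + z)) * cmod (zext F x))) \<partial>lborel) * (\<integral>\<^sup>+y. ennreal (?k (y - (t + z)) * cmod (zext G y)) \<partial>lborel)"
      by (intro nn_integral_multc) measurable
    also have "\<dots> = ennreal (?g z) * (\<integral>\<^sup>+x. ennreal (?k (x - (t + z)) * cmod (zext F x)) \<partial>lborel) * (\<integral>\<^sup>+y. ennreal (?k (y - (t + z)) * cmod (zext G y)) \<partial>lborel)"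
      by (subst nn_integral_cmult) auto
    also have "\<dots> \<le> ennreal (?g z) * ennreal (C1 / (1 + (t + z)) ^ 2) * ennreal (C2 / (1 + (t + z)) ^ 0)"
      using True t by (intro mult_mono C1 C2) auto
    also have "\<dots> = ennreal (?g z * (C1 * C2) / (1 + (t + z)) ^ 2)"
      using C1(1) C2(1) nn[of z] t True by (simp add: ennreal_mult[symmetric])
    also have "\<dots> \<le> ennreal (?g z * (C1 * C2) / (1 + z) ^ 2)"
      using C1(1) C2(1) nn[of z] t True by (intro ennreal_leI divide_left_mono power_mono mult_pos_pos) auto
    also have "\<dots> = ennreal (C1 * C2) * ennreal (norm (?g z / (1 + z)\<^sup>2))"
      using C1(1) C2(1) nn[of z] by (simp add: ennreal_mult[symmetric] mult_ac)
    finally show ?thesis .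
  next
    case False
    then have "T z w = 0" for w by (simp add: T_def weylk_def)
    then show ?thesis by simp
  qed
  have "(\<integral>\<^sup>+p. ennreal (norm (case_prod T p)) \<partial>(lborel \<Otimes>\<^sub>M (lborel \<Otimes>\<^sub>M lborel))) = (\<integral>\<^sup>+z. \<integral>\<^sup>+w. ennreal (norm (T z w)) \<partial>(lborel \<Otimes>\<^sub>M lborel) \<partial>lborel)"
    using sigma_finite_measure.nn_integral_fst[OF S, of "\<lambda>p. ennreal (norm (case_prod T p))" "lborel :: real measure"] by simp
  also have "\<dots> \<le> (\<integral>\<^sup>+z. ennreal (C1 * C2) * ennreal (norm (?g z / (1 + z)\<^sup>2)) \<partial>lborel)"
    by (intro nn_integral_mono inner)
  also have "\<dots> = ennreal (C1 * C2) * (\<integral>\<^sup>+z. ennreal (norm (?g z / (1 + z)\<^sup>2)) \<partial>lborel)"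
    by (intro nn_integral_cmult) measurable
  also have "\<dots> < \<infinity>"
    using admissible(1) by (auto simp: admissible_def integrable_iff_bounded ennreal_mult_less_top)
  finally have int: "integrable (lborel \<Otimes>\<^sub>M (lborel \<Otimes>\<^sub>M lborel)) (case_prod T)"
    by (intro integrableI_bounded Tm)
  have Tz: "(\<integral>z. T z w \<partial>lborel) = (case w of (x, y) \<Rightarrow> complex_of_real (pkernel \<beta> (x - t) (y - t)) * (zext F x * zext G y))" for w
  proof -
    have "(\<integral>z. T z w \<partial>lborel) = (\<integral>z. complex_of_real (?g z * (?k (fst w - t - z) * ?k (snd w - t - z))) \<partial>lborel) * (zext F (fst w) * zext G (snd w))"
      unfolding T_def by (rule integral_mult_left_zero)
    also have "(\<integral>z. complex_of_real (?g z * (?k (fst w - t - z) * ?k (snd w - t - z))) \<partial>lborel) = complex_of_real (pkernel \<beta> (fst w - t) (snd w - t))"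
      unfolding integral_complex_of_real pkernel_def ..
    finally show ?thesis by (simp add: case_prod_unfold)
  qed
  show ?A using P.integrable_snd[OF int] unfolding Tz .
  have "kconv ?g (\<lambda>s. kconv ?k F s * kconv ?k G s) t = (\<integral>z. \<integral>w. T z w \<partial>(lborel \<Otimes>\<^sub>M lborel) \<partial>lborel)"
    unfolding kconv_def[of ?g]
  proof (intro integral_cong_AE)
    show "AE z in lborel. ?g z *\<^sub>R zext (\<lambda>s. kconv ?k F s * kconv ?k G s) (t + z) = (\<integral>w. T z w \<partial>(lborel \<Otimes>\<^sub>M lborel))"
      using P.AE_integrable_fst[OF int]
    proof eventually_elim
      fix z assume i: "integrable (lborel \<Otimes>\<^sub>M lborel) (\<lambda>w. T z w)"
      show "?g z *\<^sub>R zext (\<lambda>s. kconv ?k F s * kconv ?k G s) (t + z) = (\<integral>w. T z w \<partial>(lborel \<Otimes>\<^sub>M lborel))"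
      proof (cases "z > 0")
        case True
        define s where "s = t + z"
        have s: "s \<ge> 0" using True t by (simp add: s_def)
        have "(\<integral>w. T z w \<partial>(lborel \<Otimes>\<^sub>M lborel)) = (\<integral>x. \<integral>y. T z (x, y) \<partial>lborel \<partial>lborel)"
          by (rule lborel_pair.integral_fst'[symmetric]) (rule i)
        also have "\<dots> = (\<integral>x. \<integral>y. (complex_of_real (?g z) * (complex_of_real (?k (x - s)) * zext F x)) * (complex_of_real (?k (y - s)) * zext G y) \<partial>lborel \<partial>lborel)"
          by (intro Bochner_Integration.integral_cong refl) (simp add: T_def s_def diff_diff_eq mult_ac)
        also have "\<dots> = complex_of_real (?g z) * (kconv ?k F s * kconv ?k G s)"
          unfolding integral_mult_right_zero integral_mult_left_zero kconv_shift_form[OF admissible(2) F s] kconv_shift_form[OF admissible(2) G s]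
          by (simp add: mult_ac)
        finally show ?thesis using s by (simp add: s_def[symmetric] zext_eq scaleR_conv_of_real)
      next
        case False
        then show ?thesis by (simp add: T_def weylk_def)
      qed
    qed
    have "rapid (\<lambda>s. kconv ?k F s * kconv ?k G s)" using F G admissible by (intro rapid_mult kconv_rapid)
    then have [measurable]: "zext (\<lambda>s. kconv ?k F s * kconv ?k G s) \<in> borel_measurable borel" by (rule zext_borel)
    show "(\<lambda>z. ?g z *\<^sub>R zext (\<lambda>s. kconv ?k F s * kconv ?k G s) (t + z)) \<in> borel_measurable lborel" by measurable
    show "(\<lambda>z. \<integral>w. T z w \<partial>(lborel \<Otimes>\<^sub>M lborel)) \<in> borel_measurable lborel"
      using P.integrable_fst[OF int] by (rule borel_measurable_integrable)
  qed
  also have "\<dots> = (\<integral>w. \<integral>z. T z w \<partial>lborel \<partial>(lborel \<Otimes>\<^sub>M lborel))"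
    using P.Fubini_integral[OF int] by simp
  finally show ?B unfolding Tz .
qed

lemma weyl_product_difference:
  assumes b: "0 < \<beta>" "\<beta> < 1" and F: "rapid F" and G: "rapid G" and t: "t \<ge> 0" and h: "h \<ge> 0"
  defines "Q \<equiv> kconv (weylk (1 - \<beta>)) (\<lambda>s. kconv (weylk \<beta>) F s * kconv (weylk \<beta>) G s)"
  shows "ennreal (cmod (Q (t + h) - Q t)) \<le> (\<integral>\<^sup>+x. \<integral>\<^sup>+y. ennreal (\<bar>pkernel \<beta> (x - (t + h)) (y - (t + h)) - pkernel \<beta> (x - t) (y - t)\<bar> * (cmod (zext F x) * cmod (zext G y))) \<partial>lborel \<partial>lborel)"
proof -
  have [measurable]: "zext F \<in> borel_measurable borel" "zext G \<in> borel_measurable borel" using F G by (auto intro: zext_borel)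
  have th: "t + h \<ge> 0" using t h by simp
  note R0 = weyl_product_representation[OF b F G t] and R1 = weyl_product_representation[OF b F G th]
  let ?M = "lborel \<Otimes>\<^sub>M lborel :: (real \<times> real) measure"
  let ?D = "\<lambda>w. complex_of_real (pkernel \<beta> (fst w - (t + h)) (snd w - (t + h)) - pkernel \<beta> (fst w - t) (snd w - t)) * (zext F (fst w) * zext G (snd w))"
  have i: "integrable ?M ?D" and e: "Q (t + h) - Q t = (\<integral>w. ?D w \<partial>?M)"
    using Bochner_Integration.integrable_diff[OF R1(1) R0(1)] Bochner_Integration.integral_diff[OF R1(1) R0(1)]
    unfolding Q_def R1(2) R0(2) by (simp_all add: case_prod_unfold left_diff_distrib)
  have "ennreal (cmod (Q (t + h) - Q t)) \<le> (\<integral>\<^sup>+w. ennreal (norm (?D w)) \<partial>?M)"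
    unfolding e by (rule integral_norm_bound_ennreal) (rule i)
  also have "\<dots> = (\<integral>\<^sup>+x. \<integral>\<^sup>+y. ennreal (norm (?D (x, y))) \<partial>lborel \<partial>lborel)"
    by (rule lborel.nn_integral_fst[symmetric]) measurable
  also have "\<dots> = (\<integral>\<^sup>+x. \<integral>\<^sup>+y. ennreal (\<bar>pkernel \<beta> (x - (t + h)) (y - (t + h)) - pkernel \<beta> (x - t) (y - t)\<bar> * (cmod (zext F x) * cmod (zext G y))) \<partial>lborel \<partial>lborel)"
    by (simp only: fst_conv snd_conv norm_mult norm_of_real)
  finally show ?thesis .
qed

text \<open>The variation bound carries its whole weight on the smaller variable \<open>x\<close>.
  As \<open>b \<ge> 0\<close>, the part \<open>x powr b\<close> may be moved to \<open>y\<close>;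
  completing it to \<open>y powr (\<beta> + b)\<close> leaves \<open>y powr (-\<beta>)\<close>,
  exactly what makes the kernel homogeneous of degree -1.\<close>

lemma kernel_weight_bound:
  assumes b: "0 < \<beta>" "\<beta> < 1" and ab: "a \<ge> 0" "b \<ge> 0" and xy: "0 < x" "x < y"
  shows "weylk \<beta> (y - x) * x powr (\<beta> + a + b) * (cmod f * cmod g)
    \<le> 1 / Gamma \<beta> * ((x powr (\<beta> + a) * cmod f) * (y powr (\<beta> + b) * cmod g) * ((y - x) powr (\<beta> - 1) * y powr (-\<beta>)))"
proof -
  have G: "Gamma \<beta> > 0" using b by (simp add: Gamma_real_pos)
  have "x powr b \<le> y powr b" using xy ab by (intro powr_mono2) auto
  also have "y powr b = y powr (\<beta> + b) * y powr (-\<beta>)" by (simp add: powr_add[symmetric])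
  finally have "x powr (\<beta> + a) * x powr b \<le> x powr (\<beta> + a) * (y powr (\<beta> + b) * y powr (-\<beta>))"
    by (intro mult_left_mono) auto
  then have "x powr (\<beta> + a + b) \<le> x powr (\<beta> + a) * (y powr (\<beta> + b) * y powr (-\<beta>))"
    by (simp add: powr_add[symmetric])
  then have "weylk \<beta> (y - x) * x powr (\<beta> + a + b) * (cmod f * cmod g)
    \<le> weylk \<beta> (y - x) * (x powr (\<beta> + a) * (y powr (\<beta> + b) * y powr (-\<beta>))) * (cmod f * cmod g)"
    using b by (intro mult_right_mono mult_left_mono weylk_nonneg mult_nonneg_nonneg) auto
  also have "\<dots> = 1 / Gamma \<beta> * ((x powr (\<beta> + a) * cmod f) * (y powr (\<beta> + b) * cmod g) * ((y - x) powr (\<beta> - 1) * y powr (-\<beta>)))"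
    using xy by (simp add: weylk_def mult_ac)
  finally show ?thesis .
qed

text \<open>Tonelli makes the \<open>t\<close>-integral innermost, where
  \<open>pkernel_variation\<close> evaluates it for fixed \<open>x\<close> and \<open>y\<close>. The
  plane then splits into the triangles \<open>x < y\<close> and \<open>y < x\<close>, exchanged by
  the symmetry of the kernel, and \<open>bilinear_Hardy\<close> treats each one, with the roles of
  \<open>p\<close> and \<open>q\<close> swapped.\<close>

lemma weyl_product_difference_bound:
  assumes b: "0 < \<beta>" "\<beta> < 1" and F: "rapid F" and G: "rapid G" and h: "h > 0"
    and ab: "a \<ge> 0" "b \<ge> 0" and pq: "p > 1" "q > 1" "1 / p + 1 / q = 1"
    and K: "Lp_le lborel p (wt (\<beta> + a) F) K" and L: "Lp_le lborel q (wt (\<beta> + b) G) L"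
  defines "Q \<equiv> kconv (weylk (1 - \<beta>)) (\<lambda>s. kconv (weylk \<beta>) F s * kconv (weylk \<beta>) G s)"
  shows "(\<integral>\<^sup>+t. ennreal (if t > 0 then t powr (\<beta> + a + b) * cmod (Q (t + h) - Q t) else 0) \<partial>lborel)
     \<le> ennreal (2 * h / Gamma \<beta> * (Beta (1 - 1/p) \<beta> + Beta (1 - 1/q) \<beta>) * (K * L))"
proof -
  define c where "c = \<beta> + a + b"
  have c: "c \<ge> 0" using b ab by (simp add: c_def)
  have Gp: "Gamma \<beta> > 0" using b by (simp add: Gamma_real_pos)
  have [measurable]: "zext F \<in> borel_measurable borel" "zext G \<in> borel_measurable borel" using F G by (auto intro: zext_borel)
  define U where "U = wt (\<beta> + a) F"
  define V where "V = wt (\<beta> + b) G"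
  have [measurable]: "U \<in> borel_measurable borel" "V \<in> borel_measurable borel" unfolding U_def V_def using F G by auto
  define D where "D t x y = (if t > 0 then t powr c * \<bar>pkernel \<beta> (x - (t + h)) (y - (t + h)) - pkernel \<beta> (x - t) (y - t)\<bar> else 0)" for t x y
  have D0: "D t x y \<ge> 0" for t x y by (simp add: D_def)
  have Dm [measurable (raw)]: "(\<lambda>w. D (f w) (g w) (k w)) \<in> borel_measurable M"
    if [measurable]: "f \<in> borel_measurable M" "g \<in> borel_measurable M" "k \<in> borel_measurable M" for f g k and M :: "'x measure"
    unfolding D_def by measurable
  define W where "W x y = cmod (zext F x) * cmod (zext G y)" for x y
  have W0: "W x y \<ge> 0" for x y by (simp add: W_def)
  have Wm [measurable (raw)]: "(\<lambda>w. W (f w) (g w)) \<in> borel_measurable M"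
    if [measurable]: "f \<in> borel_measurable M" "g \<in> borel_measurable M" for f g and M :: "'x measure"
    unfolding W_def by measurable
  define E1 where "E1 x y = (if 0 < x \<and> x < y then U x * V y * ((y - x) powr (\<beta> - 1) * y powr (-\<beta>)) else 0)" for x y
  define E2 where "E2 x y = (if 0 < y \<and> y < x then V y * U x * ((x - y) powr (\<beta> - 1) * x powr (-\<beta>)) else 0)" for x y
  have E0: "E1 x y \<ge> 0" "E2 x y \<ge> 0" for x y by (auto simp: E1_def E2_def U_def V_def)
  have Em: "case_prod E1 \<in> borel_measurable (lborel \<Otimes>\<^sub>M lborel)" "case_prod E2 \<in> borel_measurable (lborel \<Otimes>\<^sub>M lborel)"
    unfolding E1_def[abs_def] E2_def[abs_def] by measurable
  have "(\<integral>\<^sup>+t. ennreal (if t > 0 then t powr c * cmod (Q (t + h) - Q t) else 0) \<partial>lborel)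
    \<le> (\<integral>\<^sup>+t. \<integral>\<^sup>+x. \<integral>\<^sup>+y. ennreal (D t x y * W x y) \<partial>lborel \<partial>lborel \<partial>lborel)"
  proof (rule nn_integral_mono)
    fix t :: real
    show "ennreal (if t > 0 then t powr c * cmod (Q (t + h) - Q t) else 0) \<le> (\<integral>\<^sup>+x. \<integral>\<^sup>+y. ennreal (D t x y * W x y) \<partial>lborel \<partial>lborel)"
    proof (cases "t > 0")
      case True
      have "ennreal (if t > 0 then t powr c * cmod (Q (t + h) - Q t) else 0) = ennreal (t powr c) * ennreal (cmod (Q (t + h) - Q t))"
        using True by (simp add: ennreal_mult)
      also have "\<dots> \<le> ennreal (t powr c) * (\<integral>\<^sup>+x. \<integral>\<^sup>+y. ennreal (\<bar>pkernel \<beta> (x - (t + h)) (y - (t + h)) - pkernel \<beta> (x - t) (y - t)\<bar> * W x y) \<partial>lborel \<partial>lborel)"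
        unfolding Q_def W_def using True h by (intro mult_left_mono weyl_product_difference[OF b F G]) auto
      also have "\<dots> = (\<integral>\<^sup>+x. \<integral>\<^sup>+y. ennreal (t powr c) * ennreal (\<bar>pkernel \<beta> (x - (t + h)) (y - (t + h)) - pkernel \<beta> (x - t) (y - t)\<bar> * W x y) \<partial>lborel \<partial>lborel)"
        by (subst nn_integral_cmult[symmetric], measurable, subst nn_integral_cmult[symmetric], measurable)
      also have "\<dots> = (\<integral>\<^sup>+x. \<integral>\<^sup>+y. ennreal (D t x y * W x y) \<partial>lborel \<partial>lborel)"
        using True W0 by (intro nn_integral_cong) (simp add: D_def ennreal_mult[symmetric] mult.assoc)
      finally show ?thesis .
    qed simp
  qed
  also have "\<dots> = (\<integral>\<^sup>+x. \<integral>\<^sup>+t. \<integral>\<^sup>+y. ennreal (D t x y * W x y) \<partial>lborel \<partial>lborel \<partial>lborel)"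
    by (rule lborel_pair.Fubini'[of "\<lambda>x t. \<integral>\<^sup>+y. ennreal (D t x y * W x y) \<partial>lborel"]) measurable
  also have "\<dots> = (\<integral>\<^sup>+x. \<integral>\<^sup>+y. \<integral>\<^sup>+t. ennreal (D t x y * W x y) \<partial>lborel \<partial>lborel \<partial>lborel)"
    by (intro nn_integral_cong lborel_pair.Fubini'[of "\<lambda>y t. ennreal (D t _ y * W _ y)"]) measurable
  also have "\<dots> \<le> (\<integral>\<^sup>+x. \<integral>\<^sup>+y. ennreal (2 * h / Gamma \<beta>) * (ennreal (E1 x y) + ennreal (E2 x y)) \<partial>lborel \<partial>lborel)"
  proof (rule nn_integral_mono, rule nn_integral_mono_AE)
    fix x :: real
    \<comment> \<open>The variation bound requires distinct \<open>x\<close> and \<open>y\<close>;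
      the diagonal is null.\<close>
    have "AE y in lborel. y \<noteq> x" by (rule AE_lborel_singleton)
    then show "AE y in lborel. (\<integral>\<^sup>+t. ennreal (D t x y * W x y) \<partial>lborel) \<le> ennreal (2 * h / Gamma \<beta>) * (ennreal (E1 x y) + ennreal (E2 x y))"
    proof eventually_elim
      fix y :: real assume yx: "y \<noteq> x"
      have dc: "pkernel \<beta> (x - s) (y - s) = pkernel \<beta> (y - s) (x - s)" for s by (rule pkernel_commute)
      have e: "(\<integral>\<^sup>+t. ennreal (D t x y * W x y) \<partial>lborel) = (\<integral>\<^sup>+t. ennreal (D t x y) \<partial>lborel) * ennreal (W x y)"
        using D0 W0 by (subst nn_integral_multc[symmetric]) (auto simp: ennreal_mult)
      consider "x \<le> 0 \<or> y \<le> 0" | "0 < x" "x < y" | "0 < y" "y < x" using yx by linarith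
      then show "(\<integral>\<^sup>+t. ennreal (D t x y * W x y) \<partial>lborel) \<le> ennreal (2 * h / Gamma \<beta>) * (ennreal (E1 x y) + ennreal (E2 x y))"
      proof cases
        case 1
        have "D t x y = 0" for t
        proof (cases "x \<le> 0")
          case True
          then show ?thesis using h pkernel_zero[of "x - t" \<beta>] pkernel_zero[of "x - (t + h)" \<beta>] by (auto simp: D_def)
        next
          case False
          then have "y \<le> 0" using 1 by simp
          then show ?thesis using h pkernel_zero[of "y - t" \<beta>] pkernel_zero[of "y - (t + h)" \<beta>] by (auto simp: D_def dc)
        qed
        then show ?thesis by simp
      next
        case 2
        have "(\<integral>\<^sup>+t. ennreal (D t x y) \<partial>lborel) * ennreal (W x y) \<le> ennreal (2 * h * weylk \<beta> (y - x) * x powr c) * ennreal (W x y)"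
          unfolding D_def using b 2 h c by (intro mult_right_mono pkernel_variation) auto
        also have "\<dots> = ennreal (2 * h) * ennreal (weylk \<beta> (y - x) * x powr c * W x y)"
          using h W0 b by (simp add: ennreal_mult[symmetric] weylk_nonneg mult_ac)
        also have "\<dots> \<le> ennreal (2 * h) * ennreal (1 / Gamma \<beta> * E1 x y)"
          using kernel_weight_bound[OF b ab 2, of "F x" "G y"] 2
          by (intro mult_left_mono ennreal_leI) (auto simp: W_def E1_def U_def V_def wt_def zext_eq c_def)
        also have "\<dots> = ennreal (2 * h / Gamma \<beta>) * ennreal (E1 x y)"
          using h Gp E0 by (simp add: ennreal_mult[symmetric])
        also have "\<dots> \<le> ennreal (2 * h / Gamma \<beta>) * (ennreal (E1 x y) + ennreal (E2 x y))"
          by (intro mult_left_mono) auto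
        finally show ?thesis unfolding e .
      next
        case 3
        have "(\<integral>\<^sup>+t. ennreal (D t x y) \<partial>lborel) * ennreal (W x y) \<le> ennreal (2 * h * weylk \<beta> (x - y) * y powr c) * ennreal (W x y)"
          unfolding D_def dc using b 3 h c by (intro mult_right_mono pkernel_variation) auto
        also have "\<dots> = ennreal (2 * h) * ennreal (weylk \<beta> (x - y) * y powr c * W x y)"
          using h W0 b by (simp add: ennreal_mult[symmetric] weylk_nonneg mult_ac)
        also have "\<dots> \<le> ennreal (2 * h) * ennreal (1 / Gamma \<beta> * E2 x y)"
          using kernel_weight_bound[OF b ab(2,1) 3, of "G y" "F x"] 3
          by (intro mult_left_mono ennreal_leI) (auto simp: W_def E2_def U_def V_def wt_def zext_eq c_def mult_ac add_ac)
        also have "\<dots> = ennreal (2 * h / Gamma \<beta>) * ennreal (E2 x y)"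
          using h Gp E0 by (simp add: ennreal_mult[symmetric])
        also have "\<dots> \<le> ennreal (2 * h / Gamma \<beta>) * (ennreal (E1 x y) + ennreal (E2 x y))"
          by (intro mult_left_mono) auto
        finally show ?thesis unfolding e .
      qed
    qed
  qed
  also have "\<dots> = ennreal (2 * h / Gamma \<beta>) * ((\<integral>\<^sup>+x. \<integral>\<^sup>+y. ennreal (E1 x y) \<partial>lborel \<partial>lborel) + (\<integral>\<^sup>+x. \<integral>\<^sup>+y. ennreal (E2 x y) \<partial>lborel \<partial>lborel))"
    unfolding E1_def E2_def
    by (subst nn_integral_cmult, measurable, subst nn_integral_add, measurable, subst nn_integral_cmult, measurable, subst nn_integral_add, measurable)
  also have "\<dots> \<le> ennreal (2 * h / Gamma \<beta>) * (ennreal (Beta (1 - 1/p) \<beta> * (K * L)) + ennreal (Beta (1 - 1/q) \<beta> * (L * K)))"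
  proof (intro mult_left_mono add_mono)
    \<comment> \<open>\<open>bilinear_Hardy\<close> has the smaller variable inside. For
      \<open>E1\<close> this asks for an exchange of the integrals; for \<open>E2\<close> the order
      is already right.\<close>
    have "(\<integral>\<^sup>+x. \<integral>\<^sup>+y. ennreal (E1 x y) \<partial>lborel \<partial>lborel) = (\<integral>\<^sup>+y. \<integral>\<^sup>+x. ennreal (E1 x y) \<partial>lborel \<partial>lborel)"
      unfolding E1_def by (rule lborel_pair.Fubini'[symmetric]) measurable
    also have "\<dots> \<le> ennreal (Beta (1 - 1/p) \<beta> * (K * L))"
      unfolding E1_def U_def V_def using K L pq b by (intro bilinear_Hardy) auto
    finally show "(\<integral>\<^sup>+x. \<integral>\<^sup>+y. ennreal (E1 x y) \<partial>lborel \<partial>lborel) \<le> ennreal (Beta (1 - 1/p) \<beta> * (K * L))" .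
    show "(\<integral>\<^sup>+x. \<integral>\<^sup>+y. ennreal (E2 x y) \<partial>lborel \<partial>lborel) \<le> ennreal (Beta (1 - 1/q) \<beta> * (L * K))"
      unfolding E2_def U_def V_def using K L pq b by (intro bilinear_Hardy) auto
  qed auto
  also have "\<dots> = ennreal (2 * h / Gamma \<beta> * (Beta (1 - 1/p) \<beta> + Beta (1 - 1/q) \<beta>) * (K * L))"
  proof -
    have "Beta (1 - 1/p) \<beta> \<ge> 0" "Beta (1 - 1/q) \<beta> \<ge> 0" using pq b by (auto intro!: Beta_real_nonneg)
    then show ?thesis using h Gp Lp_leD(2)[OF K] Lp_leD(2)[OF L]
      by (simp add: ennreal_mult[symmetric] ennreal_plus[symmetric] algebra_simps del: ennreal_plus)
  qed
  finally show ?thesis unfolding c_def by (simp add: mult_left_mono)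
qed

lemma Lp_le_Fatou:
  fixes f :: "nat \<Rightarrow> 'a \<Rightarrow> 'b::{real_normed_vector, second_countable_topology}"
  assumes "\<And>j. Lp_le M p (f j) K" "\<And>x. x \<in> space M \<Longrightarrow> (\<lambda>j. norm (f j x)) \<longlonglongrightarrow> norm (g x)"
    "g \<in> borel_measurable M" "p > 0"
  shows "Lp_le M p g K"
proof -
  have [measurable]: "f j \<in> borel_measurable M" for j using assms(1) Lp_leD by blast
  have "(\<integral>\<^sup>+x. ennreal (norm (g x) powr p) \<partial>M) = (\<integral>\<^sup>+x. liminf (\<lambda>j. ennreal (norm (f j x) powr p)) \<partial>M)"
  proof (rule nn_integral_cong)
    fix x assume "x \<in> space M"
    then have "(\<lambda>j. ennreal (norm (f j x) powr p)) \<longlonglongrightarrow> ennreal (norm (g x) powr p)"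
      using assms(2,4) by (intro tendsto_ennrealI tendsto_powr') auto
    then show "ennreal (norm (g x) powr p) = liminf (\<lambda>j. ennreal (norm (f j x) powr p))"
      using lim_imp_Liminf trivial_limit_sequentially by metis
  qed
  also have "\<dots> \<le> liminf (\<lambda>j. \<integral>\<^sup>+x. ennreal (norm (f j x) powr p) \<partial>M)"
    by (rule nn_integral_liminf) measurable
  also have "\<dots> \<le> liminf (\<lambda>j::nat. ennreal (K powr p))"
    using assms(1) Lp_leD(3) by (intro Liminf_mono always_eventually allI) blast
  also have "\<dots> = ennreal (K powr p)" by (simp add: Liminf_const)
  finally show ?thesis using assms Lp_leD(2)[OF assms(1)] by (auto simp: Lp_le_def)
qed

text \<open>\<open>Q\<close> is the Weyl integral of order \<open>1 - \<beta>\<close> of the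
  product. Since \<open>weyl_product_difference_bound\<close> is linear in the step, the difference
  quotients of \<open>Q\<close> are bounded in weighted L1 uniformly in the step, and Fatou's lemma
  carries the bound to \<open>Q'\<close>.\<close>

lemma weyl_product_fractional:
  assumes b: "0 < \<beta>" "\<beta> < 1" and u: "u \<in> schwartz_halfline" and v: "v \<in> schwartz_halfline"
    and ab: "a \<ge> 0" "b \<ge> 0" and pq: "p > 1" "q > 1" "1 / p + 1 / q = 1"
    and K: "Lp_le lborel p (wt (\<beta> + a) (weylJ (1 - \<beta>) (nderiv 1 u))) K"
    and L: "Lp_le lborel q (wt (\<beta> + b) (weylJ (1 - \<beta>) (nderiv 1 v))) L"
  shows "Lp_le lborel 1 (wt (\<beta> + a + b) (weylJ (1 - \<beta>) (nderiv 1 (\<lambda>t. u t * v t))))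
     (2 / Gamma \<beta> * (Beta (1 - 1/p) \<beta> + Beta (1 - 1/q) \<beta>) * (K * L))"
proof -
  let ?c = "\<beta> + a + b" and ?g = "weylk (1 - \<beta>)" and ?k = "weylk \<beta>"
  define C where "C = 2 / Gamma \<beta> * (Beta (1 - 1/p) \<beta> + Beta (1 - 1/q) \<beta>) * (K * L)"
  have admissible: "admissible ?g" "admissible ?k" using b by (auto intro: admissible_weylk)
  have weylJ: "weylJ (1 - \<beta>) f = kconv ?g f" for f using b by (simp add: weylJ_def)
  define F where "F = kconv ?g (nderiv 1 u)"
  define G where "G = kconv ?g (nderiv 1 v)"
  have FG: "rapid F" "rapid G" unfolding F_def G_def
    using kconv_rapid[OF admissible(1) schwartz_rapid[OF schwartz_nderiv]] u v by blast+
  have Gp: "Gamma \<beta> > 0" using b by (simp add: Gamma_real_pos)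
  have "Beta (1 - 1/p) \<beta> \<ge> 0" "Beta (1 - 1/q) \<beta> \<ge> 0" using pq b by (auto intro!: Beta_real_nonneg)
  then have C0: "C \<ge> 0" unfolding C_def using Gp Lp_leD(2)[OF K] Lp_leD(2)[OF L]
    by (intro mult_nonneg_nonneg add_nonneg_nonneg divide_nonneg_nonneg) auto
  define Q where "Q = kconv ?g (\<lambda>s. kconv ?k F s * kconv ?k G s)"
  define Q' where "Q' = kconv ?g (nderiv 1 (\<lambda>t. u t * v t))"
  have uv: "(\<lambda>t. u t * v t) \<in> schwartz_halfline" using u v by (rule schwartz_mult)
  have "Q t = kconv ?g (\<lambda>t. u t * v t) t" for t
    unfolding Q_def
  proof (rule kconv_cong)
    fix s :: real assume s: "s \<ge> 0"
    \<comment> \<open>The inversion carries a minus sign for each factor, and the two signs cancel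
      in the product.\<close>
    have "u s = - kconv ?k F s" "v s = - kconv ?k G s"
      unfolding F_def G_def using s u v b by (auto intro!: weyl_inversion schwartz_rapid schwartz_hderiv schwartz_nderiv simp del: nderiv.simps One_nat_def)
    then show "kconv ?k F s * kconv ?k G s = u s * v s" by simp
  qed
  then have "Q = kconv ?g (\<lambda>t. u t * v t)" by auto
  then have hQ: "hderiv Q Q'" unfolding Q'_def using uv admissible
    by (auto intro!: kconv_hderiv schwartz_rapid schwartz_hderiv schwartz_nderiv simp del: nderiv.simps One_nat_def)
  have "rapid Q" unfolding Q_def using FG admissible by (intro kconv_rapid rapid_mult)
  have Q'r: "rapid Q'" unfolding Q'_def
    by (rule kconv_rapid[OF admissible(1) schwartz_rapid[OF schwartz_nderiv[OF uv]]])
  have [measurable]: "zext Q \<in> borel_measurable borel" using \<open>rapid Q\<close> by (rule zext_borel)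
  \<comment> \<open>Difference quotients with step \<open>1 / (j + 1)\<close>. The use of
    \<open>zext Q\<close> makes them measurable on the whole line; at the arguments that occur it
    agrees with \<open>Q\<close>.\<close>
  define f where "f j t = (if t > 0 then t powr ?c * (real (Suc j) * cmod (zext Q (t + 1 / real (Suc j)) - zext Q t)) else 0)" for j t
  have meas: "(\<lambda>t. if t > 0 then t powr ?c * (r * cmod (zext Q (t + d) - zext Q t)) else 0) \<in> borel_measurable lborel" for r d
    by measurable
  have "Lp_le lborel 1 (wt ?c Q') C"
  proof (rule Lp_le_Fatou[where f = f])
    fix j
    have "(\<integral>\<^sup>+t. ennreal (norm (f j t) powr 1) \<partial>lborel) = (\<integral>\<^sup>+t. ennreal (real (Suc j)) * ennreal (if t > 0 then t powr ?c * cmod (Q (t + 1 / real (Suc j)) - Q t) else 0) \<partial>lborel)"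
      by (intro nn_integral_cong) (auto simp: f_def ennreal_mult[symmetric] zext_eq mult_ac simp del: of_nat_Suc)
    also have "\<dots> = (\<integral>\<^sup>+t. ennreal (real (Suc j)) * ennreal (if t > 0 then t powr ?c * cmod (zext Q (t + 1 / real (Suc j)) - zext Q t) else 0) \<partial>lborel)"
      by (intro nn_integral_cong) (auto simp: zext_eq simp del: of_nat_Suc)
    also have "\<dots> = ennreal (real (Suc j)) * (\<integral>\<^sup>+t. ennreal (if t > 0 then t powr ?c * cmod (zext Q (t + 1 / real (Suc j)) - zext Q t) else 0) \<partial>lborel)"
      by (intro nn_integral_cmult) measurable
    also have "(\<integral>\<^sup>+t. ennreal (if t > 0 then t powr ?c * cmod (zext Q (t + 1 / real (Suc j)) - zext Q t) else 0) \<partial>lborel)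
      = (\<integral>\<^sup>+t. ennreal (if t > 0 then t powr ?c * cmod (Q (t + 1 / real (Suc j)) - Q t) else 0) \<partial>lborel)"
      by (intro nn_integral_cong) (auto simp: zext_eq simp del: of_nat_Suc)
    also have "ennreal (real (Suc j)) * \<dots> \<le> ennreal (real (Suc j)) * ennreal (2 * (1 / real (Suc j)) / Gamma \<beta> * (Beta (1 - 1/p) \<beta> + Beta (1 - 1/q) \<beta>) * (K * L))"
      unfolding Q_def using K L unfolding weylJ F_def[symmetric] G_def[symmetric]
      by (intro mult_left_mono weyl_product_difference_bound[OF b FG _ ab pq]) auto
    also have "\<dots> = ennreal (real (Suc j) * (2 * (1 / real (Suc j)) / Gamma \<beta> * (Beta (1 - 1/p) \<beta> + Beta (1 - 1/q) \<beta>) * (K * L)))"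
      by (rule ennreal_mult'[symmetric]) simp
    also have "real (Suc j) * (2 * (1 / real (Suc j)) / Gamma \<beta> * (Beta (1 - 1/p) \<beta> + Beta (1 - 1/q) \<beta>) * (K * L)) = C"
      by (simp add: C_def del: of_nat_Suc)
    finally have le: "(\<integral>\<^sup>+t. ennreal (norm (f j t) powr 1) \<partial>lborel) \<le> ennreal C" .
    have fm: "f j \<in> borel_measurable lborel" unfolding f_def by (rule meas)
    show "Lp_le lborel 1 (f j) C" unfolding Lp_le_def powr_one[OF C0] using fm C0 le by blast
  next
    fix t :: real
    show "(\<lambda>j. norm (f j t)) \<longlonglongrightarrow> norm (wt ?c Q' t)"
    proof (cases "t > 0")
      case True
      have "(\<lambda>j. (Q (t + 1 / real (Suc j)) - Q t) /\<^sub>R ((t + 1 / real (Suc j)) - t) - Q' t) \<longlonglongrightarrow> 0"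
      proof (rule hderiv_tendsto_sequentially[OF hQ])
        have "(\<lambda>j. t + 1 / real (Suc j)) \<longlonglongrightarrow> t + 0" by (intro tendsto_intros LIMSEQ_Suc[OF lim_1_over_n])
        then show "(\<lambda>j. t + 1 / real (Suc j)) \<longlonglongrightarrow> t" by simp
      qed (use True in \<open>auto intro: add_nonneg_nonneg\<close>)
      then have "(\<lambda>j. (Q (t + 1 / real (Suc j)) - Q t) /\<^sub>R ((t + 1 / real (Suc j)) - t)) \<longlonglongrightarrow> Q' t"
        by (rule LIM_zero_cancel)
      then have "(\<lambda>j. t powr ?c * cmod ((Q (t + 1 / real (Suc j)) - Q t) /\<^sub>R ((t + 1 / real (Suc j)) - t))) \<longlonglongrightarrow> t powr ?c * cmod (Q' t)"
        by (intro tendsto_intros)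
      then show ?thesis using True by (simp add: f_def wt_def zext_eq del: of_nat_Suc)
    qed (simp add: f_def)
  qed (use Q'r in auto)
  then show ?thesis unfolding C_def Q'_def weylJ .
qed

section \<open>From fractional orders to arbitrary orders\<close>

lemma wt_Holder:
  assumes "rapid f" "rapid g" and pq: "p > 1" "q > 1" "1 / p + 1 / q = 1"
    and K: "Lp_le lborel p (wt a f) K" and L: "Lp_le lborel q (wt b g) L"
  shows "Lp_le lborel 1 (wt (a + b) (\<lambda>t. f t * g t)) (K * L)"
proof -
  have "(\<integral>\<^sup>+t. ennreal (norm (wt (a + b) (\<lambda>t. f t * g t) t) powr 1) \<partial>lborel) = (\<integral>\<^sup>+t. ennreal (norm (wt a f t) * norm (wt b g t)) \<partial>lborel)"
    by (intro nn_integral_cong) (auto simp: wt_def norm_mult powr_add mult_ac)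
  also have "\<dots> \<le> ennreal (K * L)" by (rule Lp_le_Holder[OF K L pq])
  finally show ?thesis using assms Lp_leD(2)[OF K] Lp_leD(2)[OF L] by (auto simp: Lp_le_def intro!: wt_borel rapid_mult)
qed

lemma wt_add_Lp_le:
  assumes "Lp_le lborel p (wt a f) K" "Lp_le lborel p (wt a g) L" "p \<ge> 1" "rapid h"
    "\<And>t. t > 0 \<Longrightarrow> cmod (h t) \<le> cmod (f t) + cmod (g t)"
  shows "Lp_le lborel p (wt a h) (K + L)"
proof (rule Lp_le_mono[OF Lp_le_Minkowski[OF assms(1-3)]])
  fix t :: real
  show "norm (wt a h t) \<le> norm (wt a f t + wt a g t)"
  proof (cases "t > 0")
    case True
    then show ?thesis using assms(5)[OF True] mult_left_mono[of "cmod (h t)" "cmod (f t) + cmod (g t)" "t powr a"]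
      by (simp add: wt_def ring_distribs)
  qed (simp add: wt_def)
qed (use assms in auto)

text \<open>For \<beta> = 1 the fractional integral is the identity, and the product rule leaves one
  undifferentiated factor in each term. Hardy's inequality bounds that factor by its derivative, at
  the cost of \<open>q\<close> for \<open>v\<close> and \<open>p\<close> for \<open>u\<close>; hence
  the constant \<open>q + p\<close>.\<close>

lemma weyl_product_base:
  assumes b: "0 < \<beta>" "\<beta> \<le> 1" and pq: "p > 1" "q > 1" "1 / p + 1 / q = 1"
  shows "\<exists>C\<ge>0. \<forall>u\<in>schwartz_halfline. \<forall>v\<in>schwartz_halfline. \<forall>a\<ge>0. \<forall>b\<ge>0. \<forall>K L.
     Lp_le lborel p (wt (\<beta> + a) (weylJ (1 - \<beta>) (nderiv 1 u))) K \<longrightarrow>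
     Lp_le lborel q (wt (\<beta> + b) (weylJ (1 - \<beta>) (nderiv 1 v))) L \<longrightarrow>
     Lp_le lborel 1 (wt (\<beta> + a + b) (weylJ (1 - \<beta>) (nderiv 1 (\<lambda>t. u t * v t)))) (C * (K * L))"
proof (cases "\<beta> < 1")
  case True
  show ?thesis
  proof (intro exI[of _ "2 / Gamma \<beta> * (Beta (1 - 1/p) \<beta> + Beta (1 - 1/q) \<beta>)"] conjI ballI allI impI)
    show "0 \<le> 2 / Gamma \<beta> * (Beta (1 - 1/p) \<beta> + Beta (1 - 1/q) \<beta>)"
      using b pq by (intro mult_nonneg_nonneg add_nonneg_nonneg Beta_real_nonneg divide_nonneg_nonneg Gamma_real_nonneg) auto
  qed (use weyl_product_fractional[OF b(1) True _ _ _ _ pq] in blast)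
next
  case False
  then have b1: "\<beta> = 1" using b by simp
  show ?thesis
  proof (intro exI[of _ "q + p"] conjI ballI allI impI)
    fix u v and a b K L :: real
    assume u: "u \<in> schwartz_halfline" and v: "v \<in> schwartz_halfline" and ab: "a \<ge> 0" "b \<ge> 0"
    assume "Lp_le lborel p (wt (\<beta> + a) (weylJ (1 - \<beta>) (nderiv 1 u))) K" "Lp_le lborel q (wt (\<beta> + b) (weylJ (1 - \<beta>) (nderiv 1 v))) L"
    then have K: "Lp_le lborel p (wt (a + 1) (nderiv 1 u)) K" and L: "Lp_le lborel q (wt (b + 1) (nderiv 1 v)) L"
      by (simp_all add: b1 weylJ_def add.commute del: nderiv.simps One_nat_def)
    note r = schwartz_rapid[OF u] schwartz_rapid[OF schwartz_nderiv[OF u, of 1]] schwartz_rapid[OF v] schwartz_rapid[OF schwartz_nderiv[OF v, of 1]]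
    have K': "Lp_le lborel p (wt a u) (p * K)" using Hardy[OF r(1,2) schwartz_hderiv[OF u] ab(1) _ K] pq by simp
    have L': "Lp_le lborel q (wt b v) (q * L)" using Hardy[OF r(3,4) schwartz_hderiv[OF v] ab(2) _ L] pq by simp
    have 1: "Lp_le lborel 1 (wt (a + 1 + b) (\<lambda>t. nderiv 1 u t * v t)) (K * (q * L))"
      by (rule wt_Holder[OF r(2,3) pq K L'])
    have 2: "Lp_le lborel 1 (wt (a + (b + 1)) (\<lambda>t. u t * nderiv 1 v t)) ((p * K) * L)"
      by (rule wt_Holder[OF r(1,4) pq K' L])
    have uv: "(\<lambda>t. u t * v t) \<in> schwartz_halfline" using u v by (rule schwartz_mult)
    have "Lp_le lborel 1 (wt (a + b + 1) (nderiv 1 (\<lambda>t. u t * v t))) (K * (q * L) + (p * K) * L)"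
    proof (rule wt_add_Lp_le)
      show "Lp_le lborel 1 (wt (a + b + 1) (\<lambda>t. nderiv 1 u t * v t)) (K * (q * L))" using 1 by (simp only: add_ac)
      show "Lp_le lborel 1 (wt (a + b + 1) (\<lambda>t. u t * nderiv 1 v t)) (p * K * L)" using 2 by (simp only: add_ac)
      fix t :: real assume t: "t > 0"
      have "nderiv 1 (\<lambda>t. u t * v t) t = nderiv 1 u t * v t + u t * nderiv 1 v t"
        using hderiv_vector_derivative[OF hderiv_mult[OF schwartz_hderiv[OF u] schwartz_hderiv[OF v]], of t] t by simp
      then show "cmod (nderiv 1 (\<lambda>t. u t * v t) t) \<le> cmod (nderiv 1 u t * v t) + cmod (u t * nderiv 1 v t)"
        using norm_triangle_ineq by metis
    qed (auto intro: schwartz_rapid schwartz_nderiv uv simp del: nderiv.simps One_nat_def)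
    then show "Lp_le lborel 1 (wt (\<beta> + a + b) (weylJ (1 - \<beta>) (nderiv 1 (\<lambda>t. u t * v t)))) ((q + p) * (K * L))"
      by (simp add: b1 weylJ_def algebra_simps del: nderiv.simps One_nat_def)
  qed (use pq in auto)
qed

lemma hderiv_weylJ:
  assumes "f \<in> schwartz_halfline" "0 \<le> \<gamma>" "\<gamma> \<le> 1"
  shows "hderiv (weylJ \<gamma> (nderiv n f)) (weylJ \<gamma> (nderiv (Suc n) f))"
  using assms by (auto simp: weylJ_def simp del: nderiv.simps intro!: schwartz_halflineD kconv_hderiv admissible_weylk)

text \<open>Induction on \<open>m\<close> through \<open>(u v)' = u' v + u v'\<close>. In the first
  term \<open>u'\<close> has one derivative fewer left and one unit of weight more, while Hardy's
  inequality lowers the order of \<open>v\<close>; the second term is symmetric. The exponents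
  \<open>a\<close> and \<open>b\<close> are kept free for this exchange.\<close>

lemma weyl_product_bound:
  assumes b: "0 < \<beta>" "\<beta> \<le> 1" and pq: "p > 1" "q > 1" "1 / p + 1 / q = 1"
  shows "\<exists>C\<ge>0. \<forall>u\<in>schwartz_halfline. \<forall>v\<in>schwartz_halfline. \<forall>a\<ge>0. \<forall>b\<ge>0. \<forall>K L.
     Lp_le lborel p (wt (\<beta> + a + real m) (weylJ (1 - \<beta>) (nderiv (Suc m) u))) K \<longrightarrow>
     Lp_le lborel q (wt (\<beta> + b + real m) (weylJ (1 - \<beta>) (nderiv (Suc m) v))) L \<longrightarrow>
     Lp_le lborel 1 (wt (\<beta> + a + b + real m) (weylJ (1 - \<beta>) (nderiv (Suc m) (\<lambda>t. u t * v t)))) (C * (K * L))"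
proof (induction m)
  case 0
  show ?case using weyl_product_base[OF b pq] by simp
next
  case (Suc m)
  then obtain C where C: "C \<ge> 0" and IH: "\<And>u v a b K L. u \<in> schwartz_halfline \<Longrightarrow> v \<in> schwartz_halfline \<Longrightarrow> a \<ge> 0 \<Longrightarrow> b \<ge> 0 \<Longrightarrow>
     Lp_le lborel p (wt (\<beta> + a + real m) (weylJ (1 - \<beta>) (nderiv (Suc m) u))) K \<Longrightarrow>
     Lp_le lborel q (wt (\<beta> + b + real m) (weylJ (1 - \<beta>) (nderiv (Suc m) v))) L \<Longrightarrow>
     Lp_le lborel 1 (wt (\<beta> + a + b + real m) (weylJ (1 - \<beta>) (nderiv (Suc m) (\<lambda>t. u t * v t)))) (C * (K * L))"
    by blast
  show ?case
  proof (intro exI[of _ "C * (q + p)"] conjI ballI allI impI)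
    fix u v and a b K L :: real
    assume u: "u \<in> schwartz_halfline" and v: "v \<in> schwartz_halfline" and ab: "a \<ge> 0" "b \<ge> 0"
    assume K0: "Lp_le lborel p (wt (\<beta> + a + real (Suc m)) (weylJ (1 - \<beta>) (nderiv (Suc (Suc m)) u))) K"
      and L0: "Lp_le lborel q (wt (\<beta> + b + real (Suc m)) (weylJ (1 - \<beta>) (nderiv (Suc (Suc m)) v))) L"
    have g: "0 \<le> 1 - \<beta>" "1 - \<beta> \<le> 1" using b by auto
    note u' = schwartz_nderiv[OF u, of 1] and v' = schwartz_nderiv[OF v, of 1]
    have K1: "Lp_le lborel p (wt (\<beta> + a + real m + 1) (weylJ (1 - \<beta>) (nderiv (Suc (Suc m)) u))) K"
      and L1: "Lp_le lborel q (wt (\<beta> + b + real m + 1) (weylJ (1 - \<beta>) (nderiv (Suc (Suc m)) v))) L"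
      using K0 L0 by (simp_all add: add_ac del: nderiv.simps)
    \<comment> \<open>The hypothesis on \<open>u\<close>, reread as the hypothesis of order
      \<open>m\<close> on \<open>u'\<close> with weight exponent \<open>a + 1\<close>.\<close>
    have K2: "Lp_le lborel p (wt (\<beta> + (a + 1) + real m) (weylJ (1 - \<beta>) (nderiv (Suc m) (nderiv 1 u)))) K"
      using K0 unfolding nderiv_Suc_right[of "Suc m" u] by (simp add: add_ac del: nderiv.simps One_nat_def)
    have L2: "Lp_le lborel q (wt (\<beta> + (b + 1) + real m) (weylJ (1 - \<beta>) (nderiv (Suc m) (nderiv 1 v)))) L"
      using L0 unfolding nderiv_Suc_right[of "Suc m" v] by (simp add: add_ac del: nderiv.simps One_nat_def)
    \<comment> \<open>The same hypothesis lowered by one derivative and one unit of weight through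
      Hardy's inequality, for use where the derivative falls on the other factor.\<close>
    have K': "Lp_le lborel p (wt (\<beta> + a + real m) (weylJ (1 - \<beta>) (nderiv (Suc m) u))) (p * K)"
      using b ab pq u g by (intro Hardy[OF _ _ hderiv_weylJ _ _ K1] schwartz_rapid weylJ_schwartz schwartz_nderiv) auto
    have L': "Lp_le lborel q (wt (\<beta> + b + real m) (weylJ (1 - \<beta>) (nderiv (Suc m) v))) (q * L)"
      using b ab pq v g by (intro Hardy[OF _ _ hderiv_weylJ _ _ L1] schwartz_rapid weylJ_schwartz schwartz_nderiv) auto
    have 1: "Lp_le lborel 1 (wt (\<beta> + (a + 1) + b + real m) (weylJ (1 - \<beta>) (nderiv (Suc m) (\<lambda>t. nderiv 1 u t * v t)))) (C * (K * (q * L)))"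
      using K2 ab by (intro IH[OF u' v _ _ _ L']) auto
    have 2: "Lp_le lborel 1 (wt (\<beta> + a + (b + 1) + real m) (weylJ (1 - \<beta>) (nderiv (Suc m) (\<lambda>t. u t * nderiv 1 v t)))) (C * ((p * K) * L))"
      using L2 ab by (intro IH[OF u v' _ _ K']) auto
    have uv: "(\<lambda>t. u t * v t) \<in> schwartz_halfline" using u v by (rule schwartz_mult)
    have "Lp_le lborel 1 (wt (\<beta> + a + b + real m + 1) (weylJ (1 - \<beta>) (nderiv (Suc (Suc m)) (\<lambda>t. u t * v t)))) (C * (K * (q * L)) + C * ((p * K) * L))"
    proof (rule wt_add_Lp_le)
      show "Lp_le lborel 1 (wt (\<beta> + a + b + real m + 1) (weylJ (1 - \<beta>) (nderiv (Suc m) (\<lambda>t. nderiv 1 u t * v t)))) (C * (K * (q * L)))"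
        using 1 by (simp only: add_ac)
      show "Lp_le lborel 1 (wt (\<beta> + a + b + real m + 1) (weylJ (1 - \<beta>) (nderiv (Suc m) (\<lambda>t. u t * nderiv 1 v t)))) (C * ((p * K) * L))"
        using 2 by (simp only: add_ac)
      show "rapid (weylJ (1 - \<beta>) (nderiv (Suc (Suc m)) (\<lambda>t. u t * v t)))"
        using g uv by (intro schwartz_rapid weylJ_schwartz schwartz_nderiv)
      fix t :: real assume t: "t > 0"
      have "weylJ (1 - \<beta>) (nderiv (Suc (Suc m)) (\<lambda>t. u t * v t)) t = weylJ (1 - \<beta>) (\<lambda>t. nderiv (Suc m) (\<lambda>t. nderiv 1 u t * v t) t + nderiv (Suc m) (\<lambda>t. u t * nderiv 1 v t) t) t"
      proof (rule weylJ_cong)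
        fix s :: real assume s: "s \<ge> 0"
        have "nderiv (Suc (Suc m)) (\<lambda>t. u t * v t) s = nderiv (Suc m) (\<lambda>t. nderiv 1 u t * v t + u t * nderiv 1 v t) s"
          using s u v by (intro nderiv_hderiv hderiv_mult schwartz_hderiv)
        also have "\<dots> = nderiv (Suc m) (\<lambda>t. nderiv 1 u t * v t) s + nderiv (Suc m) (\<lambda>t. u t * nderiv 1 v t) s"
          using u v u' v' s by (intro nderiv_plus schwartz_mult)
        finally show "nderiv (Suc (Suc m)) (\<lambda>t. u t * v t) s = nderiv (Suc m) (\<lambda>t. nderiv 1 u t * v t) s + nderiv (Suc m) (\<lambda>t. u t * nderiv 1 v t) s" .
      qed (use t in simp)
      also have "\<dots> = weylJ (1 - \<beta>) (nderiv (Suc m) (\<lambda>t. nderiv 1 u t * v t)) t + weylJ (1 - \<beta>) (nderiv (Suc m) (\<lambda>t. u t * nderiv 1 v t)) t"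
        using u v u' v' g t by (intro weylJ_add schwartz_nderiv schwartz_mult) auto
      finally show "cmod (weylJ (1 - \<beta>) (nderiv (Suc (Suc m)) (\<lambda>t. u t * v t)) t)
        \<le> cmod (weylJ (1 - \<beta>) (nderiv (Suc m) (\<lambda>t. nderiv 1 u t * v t)) t) + cmod (weylJ (1 - \<beta>) (nderiv (Suc m) (\<lambda>t. u t * nderiv 1 v t)) t)"
        using norm_triangle_ineq by metis
    qed simp
    then show "Lp_le lborel 1 (wt (\<beta> + a + b + real (Suc m)) (weylJ (1 - \<beta>) (nderiv (Suc (Suc m)) (\<lambda>t. u t * v t)))) (C * (q + p) * (K * L))"
      by (simp add: algebra_simps del: nderiv.simps)
  qed (use pq C in auto)
qed

section \<open>Iterated differences\<close>

text \<open>For a fixed step a difference is bounded on Lp, which differentiation is not. It is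
  therefore the tool for comparing a weighted norm of derivatives with plain Lp convergence.\<close>

definition fdiff :: "real \<Rightarrow> (real \<Rightarrow> complex) \<Rightarrow> real \<Rightarrow> complex" where
  "fdiff h g t = g (t + h) - g t"

lemma fdiff_schwartz: "g \<in> schwartz_halfline \<Longrightarrow> h \<ge> 0 \<Longrightarrow> fdiff h g \<in> schwartz_halfline"
  unfolding fdiff_def[abs_def] by (intro schwartz_diff schwartz_shift)

lemma fdiff_pow_schwartz: "g \<in> schwartz_halfline \<Longrightarrow> h \<ge> 0 \<Longrightarrow> (fdiff h ^^ k) g \<in> schwartz_halfline"
  by (induction k) (auto intro: fdiff_schwartz)

lemma rapid_fdiff: "rapid g \<Longrightarrow> h \<ge> 0 \<Longrightarrow> rapid (fdiff h g)"
  using rapid_add[of "\<lambda>t. g (t + h)" "\<lambda>t. (-1) * g t"] rapid_shift[of g h] rapid_cmult[of g "-1"]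
  by (simp add: fdiff_def[abs_def])

lemma nderiv_fdiff:
  assumes "g \<in> schwartz_halfline" "h \<ge> 0" "t \<ge> 0"
  shows "nderiv n (fdiff h g) t = fdiff h (nderiv n g) t"
proof -
  have "fdiff h g = (\<lambda>t. g (t + h) + (-1) * g t)" by (auto simp: fdiff_def)
  then have "nderiv n (fdiff h g) t = nderiv n (\<lambda>t. g (t + h)) t + nderiv n (\<lambda>t. (-1) * g t) t"
    using nderiv_plus[OF schwartz_shift[OF assms(1,2)] schwartz_cmult[OF assms(1), of "-1"] assms(3)] by simp
  then show ?thesis using nderiv_shift[OF assms] nderiv_cmult[OF assms(1,3), of n "-1"] by (simp add: fdiff_def)
qed

section \<open>Lp bounds for differences of functions and of Weyl integrals\<close>

lemma Lp_le_translate: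
  assumes "Lp_le lborel p U K" "p > 0" "\<And>x. U x \<ge> 0"
  shows "Lp_le lborel p (\<lambda>x::real. if x > 0 then U (x + z) else 0 :: real) K"
proof -
  have [measurable]: "U \<in> borel_measurable borel" using Lp_leD(1)[OF assms(1)] by simp
  have "(\<integral>\<^sup>+x. ennreal (norm (if x > 0 then U (x + z) else 0) powr p) \<partial>lborel) \<le> (\<integral>\<^sup>+x. ennreal (norm (U (z + 1 * x)) powr p) \<partial>lborel)"
    by (intro nn_integral_mono) (auto simp: add.commute)
  also have "\<dots> = (\<integral>\<^sup>+x. ennreal (norm (U x) powr p) \<partial>lborel)"
    using nn_integral_real_affine[of "\<lambda>x. ennreal (norm (U x) powr p)" 1 z] by simp
  also have "\<dots> \<le> ennreal (K powr p)" using Lp_leD(3)[OF assms(1)] .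
  finally show ?thesis using Lp_leD(2)[OF assms(1)] by (auto simp: Lp_le_def)
qed

text \<open>Young's inequality for convolution with an integrable one-sided average: all translates
  have norm at most \<open>K\<close>, and Minkowski's inequality for integrals sums them with total
  mass \<open>C\<close>.\<close>

lemma Lp_le_shift_average:
  fixes U g \<kappa> :: "real \<Rightarrow> real"
  assumes U: "Lp_le lborel p U K" "\<And>x. U x \<ge> 0" and p: "p \<ge> 1"
    and \<kappa> [measurable]: "\<kappa> \<in> borel_measurable borel" and \<kappa>0: "\<And>z. \<kappa> z \<ge> 0"
    and C: "(\<integral>\<^sup>+z. ennreal (\<kappa> z) \<partial>lborel) \<le> ennreal C" "C \<ge> 0"
    and g: "g \<in> borel_measurable borel" "\<And>t. t \<le> 0 \<Longrightarrow> g t = 0"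
    and gU: "\<And>t. t > 0 \<Longrightarrow> ennreal (norm (g t)) \<le> (\<integral>\<^sup>+z. ennreal (\<kappa> z * U (t + z)) \<partial>lborel)"
  shows "Lp_le lborel p g (C * K)"
proof (rule Lp_le_closed)
  fix \<epsilon> :: real assume e: "\<epsilon> > 0"
  \<comment> \<open>\<open>L\<close> is positive, so \<open>\<kappa> z * L = 0\<close> forces
    \<open>\<kappa> z = 0\<close>, as the integral Minkowski inequality demands. The slack,
    multiplied by \<open>C\<close>, is still at most \<epsilon>.\<close>
  define L where "L = K + \<epsilon> / (C + 1)"
  have L: "L > 0" "K \<le> L" "C * L \<le> C * K + \<epsilon>"
  proof -
    show "L > 0" "K \<le> L" using e C(2) Lp_leD(2)[OF U(1)] by (auto simp: L_def intro!: add_nonneg_pos)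
    have "C * (\<epsilon> / (C + 1)) \<le> \<epsilon>" using e C(2) by (simp add: field_simps)
    then show "C * L \<le> C * K + \<epsilon>" by (simp add: L_def distrib_left)
  qed
  have [measurable]: "U \<in> borel_measurable borel" using Lp_leD(1)[OF U(1)] by simp
  have UL: "Lp_le lborel p U L" using U p L by (intro Lp_le_mono[OF U(1)]) auto
  have "Lp_le lborel p g (C * L)"
  proof (rule Lp_le_integral_Minkowski[where N = lborel and h = "\<lambda>z x. \<kappa> z * (if x > 0 then U (x + z) else 0)" and c = "\<lambda>z. \<kappa> z * L"])
    show "(\<lambda>(z, x). \<kappa> z * (if x > 0 then U (x + z) else 0)) \<in> borel_measurable (lborel \<Otimes>\<^sub>M lborel)" by measurable
    show "Lp_le lborel p (\<lambda>x. \<kappa> z * (if x > 0 then U (x + z) else 0)) (\<kappa> z * L)" for z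
      using Lp_le_scaleR[OF Lp_le_translate[OF UL _ U(2)], of "\<kappa> z" z] p \<kappa>0 by simp
    show "(\<integral>\<^sup>+z. ennreal (\<kappa> z * L) \<partial>lborel) \<le> ennreal (C * L)"
    proof -
      have "(\<integral>\<^sup>+z. ennreal (\<kappa> z * L) \<partial>lborel) = (\<integral>\<^sup>+z. ennreal (\<kappa> z) \<partial>lborel) * ennreal L"
        using L \<kappa>0 by (subst nn_integral_multc[symmetric]) (auto simp: ennreal_mult)
      also have "\<dots> \<le> ennreal C * ennreal L" using C by (intro mult_right_mono) auto
      finally show ?thesis using C L by (simp add: ennreal_mult)
    qed
    show "ennreal (norm (g x)) \<le> (\<integral>\<^sup>+z. ennreal (\<kappa> z * (if x > 0 then U (x + z) else 0)) \<partial>lborel)" for x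
      using gU[of x] g(2)[of x] by (cases "x > 0") auto
  qed (use C L p U \<kappa>0 g in \<open>auto intro: sigma_finite_lborel\<close>)
  then show "Lp_le lborel p g (C * K + \<epsilon>)" using L p g by (rule_tac Lp_le_mono) auto
qed (use C p Lp_leD(2)[OF U(1)] in auto)

text \<open>The difference is the integral of \<open>g' (t + z)\<close> over \<open>z\<close> in
  \<open>{0..h}\<close>, and the weight increases, so \<open>t powr a\<close> may be replaced by
  \<open>(t + z) powr a\<close>. This is an average of translates with total mass
  \<open>h\<close>.\<close>

lemma Lp_le_wt_fdiff:
  assumes g: "rapid g" "rapid g'" "hderiv g g'" and a: "a \<ge> 0" and p: "p \<ge> 1" and h: "h > 0"
    and K: "Lp_le lborel p (wt a g') K"
  shows "Lp_le lborel p (wt a (fdiff h g)) (h * K)"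
proof (rule Lp_le_shift_average[OF K, where \<kappa> = "indicator {0..h}"])
  have [measurable]: "zext g' \<in> borel_measurable borel" using g by (simp add: zext_borel)
  show "(\<integral>\<^sup>+z. ennreal (indicator {0..h} z) \<partial>lborel) \<le> ennreal h" using h by (simp add: ennreal_indicator)
  show "wt a (fdiff h g) \<in> borel_measurable borel" using g h by (intro wt_borel rapid_fdiff) auto
  fix t :: real assume t: "t > 0"
  have "(\<integral>z. indicator {0..h} z *\<^sub>R g' (z + t) \<partial>lborel) = g (h + t) - g (0 + t)"
  proof (rule integral_FTC_Icc)
    fix z assume z: "0 \<le> z" "z \<le> h"
    have "hderiv (\<lambda>s. g (s + t)) (\<lambda>s. g' (s + t))" using g t by (intro hderiv_shift) auto
    then show "((\<lambda>z. g (z + t)) has_vector_derivative g' (z + t)) (at z within {0..h})"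
      using z unfolding hderiv_def by (auto intro: has_vector_derivative_within_subset)
  next
    show "continuous_on {0..h} (\<lambda>z. g' (z + t))"
      using g(2) t by (auto simp: rapid_def intro!: continuous_intros continuous_on_compose2[of "{0..}" g'])
  qed (use h in auto)
  also have "(\<integral>z. indicator {0..h} z *\<^sub>R g' (z + t) \<partial>lborel) = (\<integral>z. indicator {0..h} z *\<^sub>R zext g' (z + t) \<partial>lborel)"
    using t by (intro Bochner_Integration.integral_cong) (auto simp: zext_def split: split_indicator)
  finally have e: "fdiff h g t = (\<integral>z. indicator {0..h} z *\<^sub>R zext g' (z + t) \<partial>lborel)" by (simp add: fdiff_def add.commute)
  have "integrable lborel (\<lambda>z. indicator {0..} z *\<^sub>R zext g' (t + z))"
    using rapid_FTC(2)[OF g, of t] t by simp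
  then have "integrable lborel (\<lambda>z. indicator {0..h} z *\<^sub>R zext g' (z + t))"
    by (rule Bochner_Integration.integrable_bound) (auto simp: indicator_def add.commute)
  from integral_norm_bound_ennreal[OF this]
  have "ennreal (cmod (fdiff h g t)) \<le> (\<integral>\<^sup>+z. ennreal (norm (indicator {0..h} z *\<^sub>R zext g' (z + t))) \<partial>lborel)"
    unfolding e .
  then have "ennreal (t powr a) * ennreal (cmod (fdiff h g t)) \<le> ennreal (t powr a) * (\<integral>\<^sup>+z. ennreal (norm (indicator {0..h} z *\<^sub>R zext g' (z + t))) \<partial>lborel)"
    by (rule mult_left_mono) auto
  also have "\<dots> = (\<integral>\<^sup>+z. ennreal (t powr a) * ennreal (norm (indicator {0..h} z *\<^sub>R zext g' (z + t))) \<partial>lborel)"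
    by (intro nn_integral_cmult[symmetric]) measurable
  also have "\<dots> \<le> (\<integral>\<^sup>+z. ennreal (indicator {0..h} z * wt a g' (t + z)) \<partial>lborel)"
  proof (rule nn_integral_mono)
    fix z :: real
    show "ennreal (t powr a) * ennreal (norm (indicator {0..h} z *\<^sub>R zext g' (z + t))) \<le> ennreal (indicator {0..h} z * wt a g' (t + z))"
    proof (cases "z \<in> {0..h}")
      case True
      then have "t powr a \<le> (t + z) powr a" using t a by (intro powr_mono2) auto
      then have "t powr a * cmod (g' (t + z)) \<le> (t + z) powr a * cmod (g' (t + z))" by (rule mult_right_mono) auto
      then show ?thesis using True t by (auto simp: zext_eq wt_def ennreal_mult[symmetric] add.commute intro: ennreal_leI)
    qed simp
  qed
  finally show "ennreal (norm (wt a (fdiff h g) t)) \<le> (\<integral>\<^sup>+z. ennreal (indicator {0..h} z * wt a g' (t + z)) \<partial>lborel)"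
    using t by (simp add: wt_def ennreal_mult)
qed (use h p in auto)

lemma Lp_le_wt_fdiff_pow:
  assumes "g \<in> schwartz_halfline" "a \<ge> 0" "p \<ge> 1" "h > 0" "Lp_le lborel p (wt a (nderiv k g)) K"
  shows "Lp_le lborel p (wt a ((fdiff h ^^ k) g)) (h ^ k * K)"
  using assms
proof (induction k arbitrary: g K)
  case (Suc k)
  have "Lp_le lborel p (wt a (fdiff h (nderiv k g))) (h * K)"
    using Suc.prems by (intro Lp_le_wt_fdiff[OF schwartz_halflineD(1) schwartz_halflineD(1) schwartz_halflineD(2)])
  moreover have "wt a (fdiff h (nderiv k g)) = wt a (nderiv k (fdiff h g))"
    using nderiv_fdiff Suc.prems by (intro wt_cong) auto
  ultimately have "Lp_le lborel p (wt a ((fdiff h ^^ k) (fdiff h g))) (h ^ k * (h * K))"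
    using Suc.prems by (intro Suc.IH fdiff_schwartz) auto
  then show ?case by (simp add: funpow_swap1 mult_ac)
qed auto

lemma Lp_le_wt0_fdiff:
  assumes "rapid g" "p \<ge> 1" "h \<ge> 0" "Lp_le lborel p (wt 0 g) K"
  shows "Lp_le lborel p (wt 0 (fdiff h g)) (2 * K)"
proof -
  have "Lp_le lborel p (\<lambda>x. if x > 0 then wt 0 g (x + h) else 0) K"
    using assms by (intro Lp_le_translate) auto
  moreover have "(\<lambda>x. if x > 0 then wt 0 g (x + h) else 0) = wt 0 (\<lambda>t. g (t + h))"
    using assms by (auto simp: wt_def)
  ultimately have "Lp_le lborel p (wt 0 (\<lambda>t. g (t + h))) K" by simp
  then have "Lp_le lborel p (wt 0 (fdiff h g)) (K + K)"
    by (rule wt_add_Lp_le[OF _ assms(4,2) rapid_fdiff[OF assms(1,3)]]) (simp add: fdiff_def norm_triangle_ineq4)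
  then show ?thesis by simp
qed

lemma Lp_le_wt0_fdiff_pow:
  assumes "g \<in> schwartz_halfline" "p \<ge> 1" "h \<ge> 0" "Lp_le lborel p (wt 0 g) K"
  shows "Lp_le lborel p (wt 0 ((fdiff h ^^ k) g)) (2 ^ k * K)"
proof (induction k)
  case (Suc k)
  have "Lp_le lborel p (wt 0 (fdiff h ((fdiff h ^^ k) g))) (2 * (2 ^ k * K))"
    using assms by (intro Lp_le_wt0_fdiff Suc.IH schwartz_rapid fdiff_pow_schwartz)
  then show ?case by (simp add: mult_ac)
qed (use assms in auto)

text \<open>The kernel itself is not integrable at infinity. Up to \<open>2 * h\<close> both powers
  are integrable separately; beyond, the mean value theorem gains one power and gives decay of
  exponent \<open>\<gamma> - 2 < -1\<close>.\<close>

lemma weylk_difference_integrable: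
  assumes g: "0 < \<gamma>" "\<gamma> < 1" and h: "h > 0"
  shows "(\<integral>\<^sup>+z. ennreal \<bar>weylk \<gamma> (z - h) - weylk \<gamma> z\<bar> \<partial>lborel) < \<infinity>"
proof -
  have G: "Gamma \<gamma> > 0" using g by (simp add: Gamma_real_pos)
  define A where "A z = (1 / Gamma \<gamma>) * (z powr (\<gamma> - 1) * indicator {0<..2 * h} z)" for z
  \<comment> \<open>\<open>B\<close> at \<open>z - h\<close> is the mean value bound: on the
    interval from \<open>z - h\<close> to \<open>z\<close> the derivative of the power is largest in
    modulus at the left end.\<close>
  define B where "B z = (h * (1 - \<gamma>) / Gamma \<gamma>) * (if z \<in> {h..} then z powr (\<gamma> - 2) else 0)" for z
  have A0: "A z \<ge> 0" and B0: "B z \<ge> 0" for z using G h g by (auto simp: A_def B_def)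
  have bd: "\<bar>weylk \<gamma> (z - h) - weylk \<gamma> z\<bar> \<le> A z + A (-h + 1 * z) + B (-h + 1 * z)" for z
  proof (cases "z \<le> 2 * h")
    case True
    have e1: "weylk \<gamma> z = A z" using True by (auto simp: weylk_def A_def)
    have e2: "weylk \<gamma> (z - h) = A (-h + 1 * z)" using True h by (auto simp: weylk_def A_def)
    show ?thesis unfolding e1 e2
      using A0[of z] A0[of "-h + 1 * z"] B0[of "-h + 1 * z"] by linarith
  next
    case False
    then have z: "z > 2 * h" by simp
    have pos: "z - h > 0" using z h by simp
    have "\<exists>x>z - h. x < z \<and> z powr (\<gamma> - 1) - (z - h) powr (\<gamma> - 1) = (z - (z - h)) * ((\<gamma> - 1) * x powr (\<gamma> - 1 - 1))"
      using pos h by (intro MVT2 has_real_derivative_powr) auto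
    then obtain x where x: "x > z - h" "x < z" "z powr (\<gamma> - 1) - (z - h) powr (\<gamma> - 1) = h * ((\<gamma> - 1) * x powr (\<gamma> - 1 - 1))"
      by auto
    have "x powr (\<gamma> - 2) \<le> (z - h) powr (\<gamma> - 2)" using x pos g by (intro powr_mono2') auto
    then have "h * ((1 - \<gamma>) * x powr (\<gamma> - 2)) \<le> h * ((1 - \<gamma>) * (z - h) powr (\<gamma> - 2))"
      using h g by (intro mult_left_mono) auto
    moreover have "h * ((1 - \<gamma>) * x powr (\<gamma> - 2)) \<ge> 0" using h g by simp
    moreover have "(z - h) powr (\<gamma> - 1) - z powr (\<gamma> - 1) = h * ((1 - \<gamma>) * x powr (\<gamma> - 2))"
      using x(3) by (simp add: algebra_simps)
    ultimately have "\<bar>(z - h) powr (\<gamma> - 1) - z powr (\<gamma> - 1)\<bar> \<le> h * ((1 - \<gamma>) * (z - h) powr (\<gamma> - 2))" by simp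
    then have "\<bar>(z - h) powr (\<gamma> - 1) - z powr (\<gamma> - 1)\<bar> / Gamma \<gamma> \<le> h * ((1 - \<gamma>) * (z - h) powr (\<gamma> - 2)) / Gamma \<gamma>"
      using G by (intro divide_right_mono) auto
    moreover have "\<bar>weylk \<gamma> (z - h) - weylk \<gamma> z\<bar> = \<bar>(z - h) powr (\<gamma> - 1) - z powr (\<gamma> - 1)\<bar> / Gamma \<gamma>"
      using pos z h G by (simp add: weylk_def diff_divide_distrib[symmetric] abs_divide)
    moreover have "B (-h + 1 * z) = h * ((1 - \<gamma>) * (z - h) powr (\<gamma> - 2)) / Gamma \<gamma>"
      using z by (simp add: B_def)
    moreover have "A z \<ge> 0" "A (-h + 1 * z) \<ge> 0" using G by (auto simp: A_def)
    ultimately show ?thesis by linarith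
  qed
  have [measurable]: "A \<in> borel_measurable borel" "B \<in> borel_measurable borel"
    unfolding A_def[abs_def] B_def[abs_def] by measurable
  have IA: "(\<integral>\<^sup>+z. ennreal (A z) \<partial>lborel) < \<infinity>"
  proof -
    have "(\<integral>\<^sup>+z. ennreal (A z) \<partial>lborel) = ennreal (1 / Gamma \<gamma>) * (\<integral>\<^sup>+z. ennreal (z powr (\<gamma> - 1) * indicator {0<..2 * h} z) \<partial>lborel)"
      unfolding A_def using G by (subst nn_integral_cmult[symmetric]) (auto simp: ennreal_mult'[symmetric])
    also have "\<dots> < \<infinity>" using g h by (subst nn_integral_powr_01) (auto simp: ennreal_mult_less_top)
    finally show ?thesis .
  qed
  have IB: "(\<integral>\<^sup>+z. ennreal (B z) \<partial>lborel) < \<infinity>"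
  proof -
    have "((\<lambda>z. z powr (\<gamma> - 2)) has_integral (- (h powr (\<gamma> - 2 + 1)) / (\<gamma> - 2 + 1))) {h..}"
      using g h by (intro has_integral_powr_to_inf) auto
    then have "((\<lambda>z. if z \<in> {h..} then z powr (\<gamma> - 2) else 0) has_integral (- (h powr (\<gamma> - 2 + 1)) / (\<gamma> - 2 + 1))) UNIV"
      by (simp only: has_integral_restrict_UNIV)
    then have I: "(\<integral>\<^sup>+z. ennreal (if z \<in> {h..} then z powr (\<gamma> - 2) else 0) \<partial>lborel) = ennreal (- (h powr (\<gamma> - 2 + 1)) / (\<gamma> - 2 + 1))"
      by (intro nn_integral_has_integral_lborel) auto
    have "(\<integral>\<^sup>+z. ennreal (B z) \<partial>lborel) = ennreal (h * (1 - \<gamma>) / Gamma \<gamma>) * (\<integral>\<^sup>+z. ennreal (if z \<in> {h..} then z powr (\<gamma> - 2) else 0) \<partial>lborel)"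
      unfolding B_def using G h g by (subst nn_integral_cmult[symmetric]) (auto simp: ennreal_mult[symmetric])
    then show ?thesis unfolding I by (simp add: ennreal_mult_less_top)
  qed
  have "(\<integral>\<^sup>+z. ennreal \<bar>weylk \<gamma> (z - h) - weylk \<gamma> z\<bar> \<partial>lborel) \<le> (\<integral>\<^sup>+z. ennreal (A z) + ennreal (A (-h + 1 * z)) + ennreal (B (-h + 1 * z)) \<partial>lborel)"
    using A0 B0 bd by (intro nn_integral_mono) (simp add: ennreal_plus[symmetric] ennreal_leI del: ennreal_plus)
  also have "\<dots> = (\<integral>\<^sup>+z. ennreal (A z) \<partial>lborel) + (\<integral>\<^sup>+z. ennreal (A (-h + 1 * z)) \<partial>lborel) + (\<integral>\<^sup>+z. ennreal (B (-h + 1 * z)) \<partial>lborel)"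
    by (simp add: nn_integral_add)
  also have "\<dots> = (\<integral>\<^sup>+z. ennreal (A z) \<partial>lborel) + (\<integral>\<^sup>+z. ennreal (A z) \<partial>lborel) + (\<integral>\<^sup>+z. ennreal (B z) \<partial>lborel)"
    using nn_integral_real_affine[of "\<lambda>z. ennreal (A z)" 1 "-h"] nn_integral_real_affine[of "\<lambda>z. ennreal (B z)" 1 "-h"] by simp
  also have "\<dots> < \<infinity>" using IA IB by simp
  finally show ?thesis .
qed

text \<open>Differencing the Weyl integral amounts to convolving with the differenced kernel, which
  is integrable. For \<gamma> > 0 the constant \<open>C\<close> is its total mass and depends on the
  step \<open>h\<close>; for \<gamma> = 0 the triangle inequality gives 2.\<close>

lemma Lp_le_wt0_fdiff_weylJ:
  assumes g: "0 \<le> \<gamma>" "\<gamma> < 1" and h: "h > 0" and p: "p \<ge> 1"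
  shows "\<exists>C\<ge>0. \<forall>w\<in>schwartz_halfline. \<forall>K. Lp_le lborel p (wt 0 w) K \<longrightarrow> Lp_le lborel p (wt 0 (fdiff h (weylJ \<gamma> w))) (C * K)"
proof (cases "\<gamma> = 0")
  case True
  then show ?thesis using h p by (intro exI[of _ 2]) (auto simp: weylJ_def intro: Lp_le_wt0_fdiff schwartz_rapid)
next
  case False
  then have g0: "0 < \<gamma>" using g by simp
  have admissible: "admissible (weylk \<gamma>)" using g g0 by (intro admissible_weylk) auto
  define \<kappa> where "\<kappa> z = \<bar>weylk \<gamma> (z - h) - weylk \<gamma> z\<bar>" for z
  have [measurable]: "\<kappa> \<in> borel_measurable borel" unfolding \<kappa>_def[abs_def] by measurable
  obtain C where C: "C \<ge> 0" "(\<integral>\<^sup>+z. ennreal (\<kappa> z) \<partial>lborel) = ennreal C"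
    using weylk_difference_integrable[OF g0 g(2) h] unfolding \<kappa>_def[symmetric]
    by (cases "\<integral>\<^sup>+z. ennreal (\<kappa> z) \<partial>lborel" rule: ennreal_cases) auto
  show ?thesis
  proof (intro exI[of _ C] conjI ballI allI impI C(1))
    fix w K assume w: "w \<in> schwartz_halfline" and K: "Lp_le lborel p (wt 0 w) K"
    note wr = schwartz_rapid[OF w]
    have [measurable]: "zext w \<in> borel_measurable borel" using wr by (rule zext_borel)
    have weylJ: "weylJ \<gamma> w = kconv (weylk \<gamma>) w" using False by (simp add: weylJ_def)
    show "Lp_le lborel p (wt 0 (fdiff h (weylJ \<gamma> w))) (C * K)"
    proof (rule Lp_le_shift_average[OF K, where \<kappa> = \<kappa>])
      show "wt 0 (fdiff h (weylJ \<gamma> w)) \<in> borel_measurable borel"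
        unfolding weylJ using wr admissible h by (intro wt_borel rapid_fdiff kconv_rapid) auto
      fix t :: real assume t: "t > 0"
      \<comment> \<open>A translation of the integration variable moves the shift by
        \<open>h\<close> from the function to the kernel.\<close>
      have "kconv (weylk \<gamma>) w (t + h) = (\<integral>z. weylk \<gamma> (-h + 1 * z) *\<^sub>R zext w ((t + h) + (-h + 1 * z)) \<partial>lborel)"
        unfolding kconv_def by (subst lborel_integral_real_affine[of 1 _ "-h"]) auto
      also have "\<dots> = (\<integral>z. weylk \<gamma> (z - h) *\<^sub>R zext w (t + z) \<partial>lborel)" by simp
      finally have e1: "kconv (weylk \<gamma>) w (t + h) = (\<integral>z. weylk \<gamma> (z - h) *\<^sub>R zext w (t + z) \<partial>lborel)" .
      have i2: "integrable lborel (\<lambda>z. weylk \<gamma> z *\<^sub>R zext w (t + z))" using kconv_integrable[OF admissible wr] t by simp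
      have "integrable lborel (\<lambda>z. weylk \<gamma> z *\<^sub>R zext w ((t + h) + z))" using kconv_integrable[OF admissible wr, of "t + h"] t h by simp
      from lborel_integrable_real_affine[OF this, of 1 "-h"]
      have i1: "integrable lborel (\<lambda>z. weylk \<gamma> (z - h) *\<^sub>R zext w (t + z))" by simp
      have i: "integrable lborel (\<lambda>z. (weylk \<gamma> (z - h) - weylk \<gamma> z) *\<^sub>R zext w (t + z))"
        using Bochner_Integration.integrable_diff[OF i1 i2] by (simp add: scaleR_diff_left)
      have "fdiff h (weylJ \<gamma> w) t = (\<integral>z. (weylk \<gamma> (z - h) - weylk \<gamma> z) *\<^sub>R zext w (t + z) \<partial>lborel)"
        unfolding fdiff_def weylJ e1 scaleR_diff_left Bochner_Integration.integral_diff[OF i1 i2] by (simp add: kconv_def)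
      then have "ennreal (cmod (fdiff h (weylJ \<gamma> w) t)) \<le> (\<integral>\<^sup>+z. ennreal (norm ((weylk \<gamma> (z - h) - weylk \<gamma> z) *\<^sub>R zext w (t + z))) \<partial>lborel)"
        using integral_norm_bound_ennreal[OF i] by simp
      also have "\<dots> = (\<integral>\<^sup>+z. ennreal (\<kappa> z * wt 0 w (t + z)) \<partial>lborel)"
      proof (rule nn_integral_cong_AE)
        have "AE z in lborel. z \<noteq> -t" by (rule AE_lborel_singleton)
        then show "AE z in lborel. ennreal (norm ((weylk \<gamma> (z - h) - weylk \<gamma> z) *\<^sub>R zext w (t + z))) = ennreal (\<kappa> z * wt 0 w (t + z))"
          by eventually_elim (auto simp: \<kappa>_def wt_def zext_def indicator_def)
      qed
      finally show "ennreal (norm (wt 0 (fdiff h (weylJ \<gamma> w)) t)) \<le> (\<integral>\<^sup>+z. ennreal (\<kappa> z * wt 0 w (t + z)) \<partial>lborel)"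
        using t by (simp add: wt_def)
    qed (use C p in \<open>auto simp: \<kappa>_def wt_def\<close>)
  qed
qed

section \<open>Iterated difference quotients converge to derivatives\<close>

lemma hderiv_Taylor:
  assumes "hderiv g g'" "hderiv g' g''" "\<And>t. t \<ge> 0 \<Longrightarrow> cmod (g'' t) \<le> B" "t \<ge> 0" "h \<ge> 0"
  shows "cmod (g (t + h) - g t - h *\<^sub>R g' t) \<le> B * h * h"
proof -
  have "norm ((g (t + h) - (t + h) *\<^sub>R g' t) - (g t - t *\<^sub>R g' t)) \<le> (B * h) * norm ((t + h) - t)"
  \<comment> \<open>The mean value inequality is applied to \<open>g\<close> minus its linear part;
    the derivative \<open>g' s - g' t\<close> is at most \<open>B * h\<close> on the
    interval.\<close>
  proof (rule differentiable_bound[of "{t..t + h}" "\<lambda>s. g s - s *\<^sub>R g' t" "\<lambda>s k. k *\<^sub>R (g' s - g' t)"])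
    fix s assume s: "s \<in> {t..t + h}"
    have "(g has_vector_derivative g' s) (at s within {t..t + h})"
      by (rule has_vector_derivative_within_subset[of _ _ _ "{0..}"]) (use assms(1,4) s in \<open>auto simp: hderiv_def\<close>)
    then have "((\<lambda>s. g s - s *\<^sub>R g' t) has_vector_derivative (g' s - 1 *\<^sub>R g' t)) (at s within {t..t + h})"
      by (auto intro!: derivative_eq_intros)
    then show "((\<lambda>s. g s - s *\<^sub>R g' t) has_derivative (\<lambda>k. k *\<^sub>R (g' s - g' t))) (at s within {t..t + h})"
      by (simp add: has_vector_derivative_def)
    have B0: "B \<ge> 0" using assms(3)[OF assms(4)] norm_ge_zero order_trans by blast
    have "cmod (g' s - g' t) \<le> B * \<bar>s - t\<bar>"
      by (rule hderiv_Lipschitz[OF assms(2), of 0]) (use assms s in auto)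
    also have "\<dots> \<le> B * h" using s B0 by (intro mult_left_mono) auto
    finally show "onorm (\<lambda>k. k *\<^sub>R (g' s - g' t)) \<le> B * h"
      by (auto simp: onorm_scaleR_left bounded_linear_ident onorm_id)
  qed (use assms in auto)
  then show ?thesis using assms by (simp add: algebra_simps)
qed

text \<open>The induction peels off the innermost difference. Applied to \<open>fdiff h g\<close>,
  whose derivative of order \<open>k + 1\<close> is at most \<open>h * B\<close>, the induction
  hypothesis gives the error \<open>k * h^(k+2) * B\<close>; replacing the last difference by
  \<open>h\<close> times a derivative adds one more \<open>h^(k+2) * B\<close> by Taylor's
  bound.\<close>

lemma fdiff_pow_nderiv:
  assumes "g \<in> schwartz_halfline" "\<And>t. t \<ge> 0 \<Longrightarrow> cmod (nderiv (Suc k) g t) \<le> B" "t \<ge> 0" "h \<ge> 0"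
  shows "cmod ((fdiff h ^^ k) g t - h ^ k *\<^sub>R nderiv k g t) \<le> real k * h ^ Suc k * B"
  using assms
proof (induction k arbitrary: g B)
  case (Suc k)
  have dg: "fdiff h g \<in> schwartz_halfline" using Suc.prems by (intro fdiff_schwartz)
  have "cmod (nderiv (Suc k) (fdiff h g) s) \<le> h * B" if s: "s \<ge> 0" for s
  proof -
    have "nderiv (Suc k) (fdiff h g) s = nderiv (Suc k) g (s + h) - nderiv (Suc k) g s"
      using nderiv_fdiff[OF Suc.prems(1,4) s, of "Suc k"] by (simp add: fdiff_def del: nderiv.simps)
    also have "cmod \<dots> \<le> B * \<bar>(s + h) - s\<bar>"
      by (rule hderiv_Lipschitz[OF schwartz_halflineD(2)[OF Suc.prems(1)], of 0]) (use Suc.prems s in auto)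
    finally show ?thesis using Suc.prems by (simp add: mult.commute)
  qed
  then have 1: "cmod ((fdiff h ^^ k) (fdiff h g) t - h ^ k *\<^sub>R nderiv k (fdiff h g) t) \<le> real k * h ^ Suc k * (h * B)"
    using Suc.prems by (intro Suc.IH dg) auto
  have "cmod (nderiv k g (t + h) - nderiv k g t - h *\<^sub>R nderiv (Suc k) g t) \<le> B * h * h"
    using Suc.prems by (intro hderiv_Taylor[OF schwartz_halflineD(2) schwartz_halflineD(2)]) auto
  then have "h ^ k * cmod (nderiv k (fdiff h g) t - h *\<^sub>R nderiv (Suc k) g t) \<le> h ^ k * (B * h * h)"
    using Suc.prems nderiv_fdiff[OF Suc.prems(1,4,3), of k] by (intro mult_left_mono) (auto simp: fdiff_def simp del: nderiv.simps)
  then have 2: "cmod (h ^ k *\<^sub>R nderiv k (fdiff h g) t - h ^ Suc k *\<^sub>R nderiv (Suc k) g t) \<le> h ^ Suc (Suc k) * B"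
  proof -
    have "h ^ k *\<^sub>R nderiv k (fdiff h g) t - h ^ Suc k *\<^sub>R nderiv (Suc k) g t = h ^ k *\<^sub>R (nderiv k (fdiff h g) t - h *\<^sub>R nderiv (Suc k) g t)"
      by (simp add: scaleR_diff_right mult.commute del: nderiv.simps)
    moreover assume "h ^ k * cmod (nderiv k (fdiff h g) t - h *\<^sub>R nderiv (Suc k) g t) \<le> h ^ k * (B * h * h)"
    ultimately show ?thesis using Suc.prems(4) by (simp add: mult_ac del: nderiv.simps)
  qed
  have "cmod ((fdiff h ^^ k) (fdiff h g) t - h ^ Suc k *\<^sub>R nderiv (Suc k) g t) \<le> real k * h ^ Suc k * (h * B) + h ^ Suc (Suc k) * B"
    by (rule norm_diff_triangle_le[OF 1 2])
  then show ?case by (simp add: funpow_swap1 algebra_simps del: nderiv.simps)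
qed simp

lemma fdiff_pow_tendsto:
  assumes g: "g \<in> schwartz_halfline" and t: "t \<ge> 0"
  shows "(\<lambda>j. real (Suc j) ^ k *\<^sub>R (fdiff (1 / real (Suc j)) ^^ k) g t) \<longlonglongrightarrow> nderiv k g t"
proof -
  obtain B where B: "B \<ge> 0" "\<And>t. t \<ge> 0 \<Longrightarrow> cmod (nderiv (Suc k) g t) \<le> B / (1 + t) ^ 0"
    using rapid_bound[OF schwartz_halflineD(1)[OF g]] by metis
  have "(\<lambda>j. real (Suc j) ^ k *\<^sub>R (fdiff (1 / real (Suc j)) ^^ k) g t - nderiv k g t) \<longlonglongrightarrow> 0"
  proof (rule Lim_null_comparison)
    show "\<forall>\<^sub>F j in sequentially. norm (real (Suc j) ^ k *\<^sub>R (fdiff (1 / real (Suc j)) ^^ k) g t - nderiv k g t) \<le> real k * B * (1 / real (Suc j))"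
    proof (intro always_eventually allI)
      fix j
      define r where "r = real (Suc j)"
      have r: "r > 0" by (simp add: r_def)
      have "cmod ((fdiff (1 / r) ^^ k) g t - (1 / r) ^ k *\<^sub>R nderiv k g t) \<le> real k * (1 / r) ^ Suc k * B"
        using g t B(2) r by (intro fdiff_pow_nderiv) auto
      then have a: "r ^ k * cmod ((fdiff (1 / r) ^^ k) g t - (1 / r) ^ k *\<^sub>R nderiv k g t) \<le> r ^ k * (real k * (1 / r) ^ Suc k * B)"
        using r by (intro mult_left_mono) auto
      have b: "r ^ k *\<^sub>R (fdiff (1 / r) ^^ k) g t - nderiv k g t = r ^ k *\<^sub>R ((fdiff (1 / r) ^^ k) g t - (1 / r) ^ k *\<^sub>R nderiv k g t)"
        using r by (simp add: scaleR_diff_right power_one_over)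
      have c: "r ^ k * (real k * (1 / r) ^ Suc k * B) = real k * B * (1 / r)"
        using r by (simp add: power_one_over)
      have "norm (r ^ k *\<^sub>R (fdiff (1 / r) ^^ k) g t - nderiv k g t) \<le> real k * B * (1 / r)"
        unfolding b norm_scaleR c[symmetric] using a r by (simp only: abs_of_pos zero_less_power)
      then show "norm (real (Suc j) ^ k *\<^sub>R (fdiff (1 / real (Suc j)) ^^ k) g t - nderiv k g t) \<le> real k * B * (1 / real (Suc j))"
        unfolding r_def .
    qed
    have "(\<lambda>j. real k * B * (1 / real (Suc j))) \<longlonglongrightarrow> real k * B * 0"
      by (intro tendsto_intros LIMSEQ_Suc[OF lim_1_over_n])
    then show "(\<lambda>j. real k * B * (1 / real (Suc j))) \<longlonglongrightarrow> 0" by simp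
  qed
  then show ?thesis by (rule LIM_zero_cancel)
qed

section \<open>The norm on the Schwartz class\<close>

text \<open>One formula serves \<open>Lp_norm\<close>, over completed measure on the half-line, and
  the weighted norms over \<open>lborel\<close>.\<close>

definition pnorm :: "'a measure \<Rightarrow> real \<Rightarrow> ('a \<Rightarrow> 'b::{real_normed_vector, second_countable_topology}) \<Rightarrow> real" where
  "pnorm M p f = (\<integral>x. norm (f x) powr p \<partial>M) powr (1 / p)"

lemma Lp_le_integrable:
  fixes f :: "'a \<Rightarrow> 'b::{real_normed_vector, second_countable_topology}"
  assumes "Lp_le M p f K" shows "integrable M (\<lambda>x. norm (f x) powr p)"
proof -
  have [measurable]: "f \<in> borel_measurable M" using Lp_leD(1)[OF assms] .
  have "(\<integral>\<^sup>+x. ennreal (norm (norm (f x) powr p)) \<partial>M) \<le> ennreal (K powr p)"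
    using Lp_leD(3)[OF assms] by simp
  then show ?thesis by (intro integrableI_bounded) (auto intro: le_less_trans)
qed

lemma Lp_le_pnorm:
  fixes f :: "'a \<Rightarrow> 'b::{real_normed_vector, second_countable_topology}"
  assumes "f \<in> borel_measurable M" "integrable M (\<lambda>x. norm (f x) powr p)" "p > 0"
  shows "Lp_le M p f (pnorm M p f)"
proof -
  have "(\<integral>x. norm (f x) powr p \<partial>M) \<ge> 0" by simp
  then have "pnorm M p f powr p = (\<integral>x. norm (f x) powr p \<partial>M)"
    using assms(3) by (simp add: pnorm_def powr_powr)
  then show ?thesis using assms nn_integral_eq_integral[OF assms(2)] by (simp add: Lp_le_def pnorm_def)
qed

lemma pnorm_le:
  fixes f :: "'a \<Rightarrow> 'b::{real_normed_vector, second_countable_topology}"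
  assumes "Lp_le M p f K" "p > 0" shows "pnorm M p f \<le> K"
proof -
  have "ennreal (\<integral>x. norm (f x) powr p \<partial>M) \<le> ennreal (K powr p)"
    using Lp_leD(3)[OF assms(1)] nn_integral_eq_integral[OF Lp_le_integrable[OF assms(1)]] by simp
  then have "(\<integral>x. norm (f x) powr p \<partial>M) \<le> K powr p" by simp
  then have "pnorm M p f \<le> (K powr p) powr (1 / p)"
    unfolding pnorm_def using assms(2) by (intro powr_mono2) auto
  then show ?thesis using assms(2) Lp_leD(2)[OF assms(1)] by (simp add: powr_powr)
qed

lemma pnorm_nonneg: "pnorm M p f \<ge> 0"
  by (simp add: pnorm_def)

section \<open>The half-line spaces and the weighted norms over Borel measure\<close>

abbreviation Leb :: "real measure" where "Leb \<equiv> lebesgue_on {0..}"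

lemma Lp_norm_pnorm: "Lp_norm p f = pnorm Leb p f"
  by (simp add: Lp_norm_def pnorm_def)

lemma Lp_halflineD: "f \<in> Lp_halfline p \<Longrightarrow> p > 0 \<Longrightarrow> Lp_le Leb p f (Lp_norm p f)"
  unfolding Lp_norm_pnorm Lp_halfline_def by (intro Lp_le_pnorm) auto

lemma Lp_halflineI: "Lp_le Leb p f K \<Longrightarrow> f \<in> Lp_halfline p"
  using Lp_le_integrable[of Leb p f K] Lp_leD(1)[of Leb p f K] by (simp add: Lp_halfline_def)

lemma Lp_norm_le: "Lp_le Leb p f K \<Longrightarrow> p > 0 \<Longrightarrow> Lp_norm p f \<le> K"
  unfolding Lp_norm_pnorm by (rule pnorm_le)

lemma Lp_norm_nonneg: "Lp_norm p f \<ge> 0"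
  unfolding Lp_norm_pnorm by (rule pnorm_nonneg)

lemma Lp_le_Holder_1:
  fixes f g :: "'a \<Rightarrow> complex"
  assumes f: "Lp_le M p f K" and g: "Lp_le M q g L" and pq: "p > 1" "q > 1" "1 / p + 1 / q = 1"
  shows "Lp_le M 1 (\<lambda>x. f x * g x) (K * L)"
proof -
  have [measurable]: "f \<in> borel_measurable M" "g \<in> borel_measurable M" using Lp_leD(1)[OF f] Lp_leD(1)[OF g] by auto
  have "(\<integral>\<^sup>+x. ennreal (norm (f x * g x) powr 1) \<partial>M) = (\<integral>\<^sup>+x. ennreal (norm (f x) * norm (g x)) \<partial>M)"
    by (simp add: norm_mult)
  also have "\<dots> \<le> ennreal (K * L)" by (rule Lp_le_Holder[OF f g pq])
  finally show ?thesis using Lp_leD(2)[OF f] Lp_leD(2)[OF g] by (simp add: Lp_le_def)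
qed

lemma Lp_le_diff:
  fixes f g :: "'a \<Rightarrow> complex"
  assumes "Lp_le M p f K" "Lp_le M p g L" "p \<ge> 1"
  shows "Lp_le M p (\<lambda>x. f x - g x) (K + L)"
proof -
  have "Lp_le M p (\<lambda>x. (-1) *\<^sub>R g x) (\<bar>-1\<bar> * L)" using assms by (intro Lp_le_scaleR) auto
  from Lp_le_Minkowski[OF assms(1) this assms(3)] show ?thesis by simp
qed

text \<open>The norms of the problem use completed Lebesgue measure on \<open>{0..}\<close>, the
  estimates use Borel measure on the line. For a continuous function the two integrands differ at
  most at the point 0, and completion does not change the nonnegative integral.\<close>

lemma Lp_le_Leb_iff:
  assumes "rapid w"
  shows "Lp_le Leb p w K \<longleftrightarrow> Lp_le lborel p (wt 0 w) K"
proof -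
  have "w \<in> borel_measurable Leb"
    using assms by (intro continuous_imp_measurable_on_sets_lebesgue) (auto simp: rapid_def)
  moreover have "wt 0 w \<in> borel_measurable lborel" using assms wt_borel by simp
  moreover have "(\<integral>\<^sup>+t. ennreal (norm (w t) powr p) \<partial>Leb) = (\<integral>\<^sup>+t. ennreal (norm (wt 0 w t) powr p) \<partial>lborel)"
  proof -
    have "(\<integral>\<^sup>+t. ennreal (norm (w t) powr p) \<partial>Leb) = (\<integral>\<^sup>+t. ennreal (norm (w t) powr p) * indicator {0..} t \<partial>lebesgue)"
      by (rule nn_integral_restrict_space) auto
    also have "\<dots> = (\<integral>\<^sup>+t. ennreal (norm (w t) powr p) * indicator {0..} t \<partial>lborel)"
      by (rule nn_integral_completion)
    also have "\<dots> = (\<integral>\<^sup>+t. ennreal (norm (wt 0 w t) powr p) \<partial>lborel)"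
    proof (rule nn_integral_cong_AE)
      have "AE t in lborel. t \<noteq> (0::real)" by (rule AE_lborel_singleton)
      then show "AE t in lborel. ennreal (norm (w t) powr p) * indicator {0..} t = ennreal (norm (wt 0 w t) powr p)"
        by eventually_elim (auto simp: wt_def indicator_def)
    qed
    finally show ?thesis .
  qed
  ultimately show ?thesis by (simp add: Lp_le_def)
qed

text \<open>The integer \<open>m\<close> in the decomposition \<open>\<alpha> = m + \<beta>\<close> with \<open>0 < \<beta> \<le> 1\<close>.\<close>

definition weyl_order :: "real \<Rightarrow> nat" where "weyl_order \<alpha> = nat \<lceil>\<alpha>\<rceil> - 1"

text \<open>
  Up to sign this is \<open>weyl_deriv \<alpha> f\<close>; for integer \<open>\<alpha>\<close> the detour of \<open>weyl_deriv\<close> through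
  \<open>n = \<alpha> + 1\<close> derivatives of \<open>W\<^sub>+\<^bsup>-1\<^esup> f\<close> disappears.
\<close>

definition weylD :: "real \<Rightarrow> (real \<Rightarrow> complex) \<Rightarrow> real \<Rightarrow> complex" where
  "weylD \<alpha> f = weylJ (1 - (\<alpha> - real (weyl_order \<alpha>))) (nderiv (Suc (weyl_order \<alpha>)) f)"

lemma weyl_order_bounds:
  assumes "\<alpha> > 0"
  shows "0 < \<alpha> - real (weyl_order \<alpha>)" "\<alpha> - real (weyl_order \<alpha>) \<le> 1"
proof -
  have "real (weyl_order \<alpha>) = of_int \<lceil>\<alpha>\<rceil> - 1"
    using assms by (simp add: weyl_order_def of_nat_diff nat_le_iff Suc_le_eq)
  then show "0 < \<alpha> - real (weyl_order \<alpha>)" "\<alpha> - real (weyl_order \<alpha>) \<le> 1" by linarith+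
qed

lemma weylD_schwartz: "\<alpha> > 0 \<Longrightarrow> f \<in> schwartz_halfline \<Longrightarrow> weylD \<alpha> f \<in> schwartz_halfline"
  unfolding weylD_def using weyl_order_bounds[of \<alpha>] by (intro weylJ_schwartz schwartz_nderiv) auto

lemma weylD_add:
  assumes "\<alpha> > 0" "f \<in> schwartz_halfline" "g \<in> schwartz_halfline" "t \<ge> 0"
  shows "weylD \<alpha> (\<lambda>t. f t + g t) t = weylD \<alpha> f t + weylD \<alpha> g t"
proof -
  have "weylD \<alpha> (\<lambda>t. f t + g t) t = weylJ (1 - (\<alpha> - real (weyl_order \<alpha>))) (\<lambda>t. nderiv (Suc (weyl_order \<alpha>)) f t + nderiv (Suc (weyl_order \<alpha>)) g t) t"
    unfolding weylD_def using assms by (intro weylJ_cong nderiv_plus)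
  also have "\<dots> = weylD \<alpha> f t + weylD \<alpha> g t"
    unfolding weylD_def using assms weyl_order_bounds[of \<alpha>] by (intro weylJ_add schwartz_nderiv) auto
  finally show ?thesis .
qed

lemma weylk_1: "weylk 1 z = indicator {0<..} z"
  by (simp add: weylk_def)

lemma kconv_weylk_1:
  assumes "rapid f" "rapid f'" "hderiv f f'" "t \<ge> 0"
  shows "kconv (weylk 1) f' t = - f t"
proof -
  have [measurable]: "zext f' \<in> borel_measurable borel" using assms by (simp add: zext_borel)
  have "kconv (weylk 1) f' t = (\<integral>z. indicator {0..} z *\<^sub>R zext f' (t + z) \<partial>lborel)"
    unfolding kconv_def weylk_1
  proof (rule integral_cong_AE)
    have "AE z in lborel. z \<noteq> (0::real)" by (rule AE_lborel_singleton)
    then show "AE z in lborel. indicator {0<..} z *\<^sub>R zext f' (t + z) = indicator {0..} z *\<^sub>R zext f' (t + z)"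
      by eventually_elim (auto simp: indicator_def)
  qed measurable
  then show ?thesis using rapid_FTC(1)[OF assms] by simp
qed

text \<open>All \<open>n\<close> derivatives pass under the Weyl integral by
  \<open>nderiv_kconv\<close>. For non-integer \<alpha> the order and the number of derivatives then
  agree with \<open>weylD\<close>. For integer \<alpha> there is one derivative too many under a
  kernel of order 1, and \<open>kconv_weylk_1\<close> removes both at the cost of a sign. Equality
  of moduli absorbs all signs.\<close>

lemma weyl_deriv_weylD:
  assumes a: "\<alpha> > 0" and f: "f \<in> schwartz_halfline" and t: "t \<ge> 0"
  shows "cmod (weyl_deriv \<alpha> f t) = cmod (weylD \<alpha> f t)"
proof -
  let ?m = "weyl_order \<alpha>"
  define n where "n = nat \<lfloor>\<alpha>\<rfloor> + 1"
  have n: "real n = of_int \<lfloor>\<alpha>\<rfloor> + 1" using a by (simp add: n_def)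
  have m: "real ?m = of_int \<lceil>\<alpha>\<rceil> - 1"
    using a by (simp add: weyl_order_def of_nat_diff nat_le_iff Suc_le_eq)
  have g: "0 < real n - \<alpha>" "real n - \<alpha> \<le> 1" using n by linarith+
  have admissible: "admissible (weylk (real n - \<alpha>))" using g by (rule admissible_weylk)
  have ne: "\<alpha> \<noteq> 0" using a by simp
  have "weyl_deriv \<alpha> f t = (-1) ^ n * nderiv n (weyl_integral (real n - \<alpha>) f) t"
    by (simp only: weyl_deriv_def Let_def n_def ne if_False)
  then have "cmod (weyl_deriv \<alpha> f t) = cmod (nderiv n (weyl_integral (real n - \<alpha>) f) t)"
    by (simp only: norm_mult norm_power norm_minus_cancel norm_one power_one mult_1)
  also have "nderiv n (weyl_integral (real n - \<alpha>) f) t = nderiv n (kconv (weylk (real n - \<alpha>)) f) t"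
    using t f by (intro nderiv_cong weyl_integral_kconv schwartz_rapid)
  also have "\<dots> = kconv (weylk (real n - \<alpha>)) (nderiv n f) t"
    using t f admissible by (intro nderiv_kconv)
  finally have e: "cmod (weyl_deriv \<alpha> f t) = cmod (kconv (weylk (real n - \<alpha>)) (nderiv n f) t)" .
  show ?thesis
  proof (cases "\<alpha> = of_int \<lfloor>\<alpha>\<rfloor>")
    case True
    then have "\<lceil>\<alpha>\<rceil> = \<lfloor>\<alpha>\<rfloor>" by (metis ceiling_of_int)
    then have "real n = real (Suc (Suc ?m))" and am: "\<alpha> = real (Suc ?m)" using n m True by auto
    then have nm: "n = Suc (Suc ?m)" by (simp only: of_nat_eq_iff)
    have "real n - \<alpha> = 1" using nm am by simp
    then have "kconv (weylk (real n - \<alpha>)) (nderiv n f) t = - nderiv (Suc ?m) f t"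
      unfolding nm using schwartz_halflineD[OF f] t by (simp only:, intro kconv_weylk_1)
    moreover have "weylD \<alpha> f t = nderiv (Suc ?m) f t"
      unfolding weylD_def using am by (simp add: weylJ_def del: nderiv.simps)
    ultimately show ?thesis using e by simp
  next
    case False
    then have "\<lceil>\<alpha>\<rceil> = \<lfloor>\<alpha>\<rfloor> + 1" by (simp add: ceiling_altdef)
    then have "real n = real (Suc ?m)" using n m by simp
    then have nm: "n = Suc ?m" by (simp only: of_nat_eq_iff)
    have eq: "1 - (\<alpha> - real ?m) = real n - \<alpha>" using nm by simp
    show ?thesis unfolding e weylD_def eq weylJ_def nm[symmetric] using g(1) by simp
  qed
qed

lemma schwartz_norm_pnorm:
  assumes a: "\<alpha> > 0" and f: "f \<in> schwartz_halfline" and p: "p \<ge> 1"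
  shows "Gamma (\<alpha> + 1) * schwartz_norm \<alpha> p f = pnorm lborel p (wt \<alpha> (weylD \<alpha> f))"
proof -
  have r: "rapid (weylD \<alpha> f)" using a f by (intro schwartz_rapid weylD_schwartz)
  have G: "Gamma (\<alpha> + 1) > 0" using a by (simp add: Gamma_real_pos)
  have [measurable]: "wt \<alpha> (weylD \<alpha> f) \<in> borel_measurable borel" using r by (rule wt_borel)
  have "(LINT t|Leb. cmod (weyl_deriv \<alpha> f t) powr p * t powr (\<alpha> * p)) = (LINT t|lebesgue. indicator {0..} t *\<^sub>R (cmod (weyl_deriv \<alpha> f t) powr p * t powr (\<alpha> * p)))"
    by (rule integral_restrict_space) auto
  also have "\<dots> = (LINT t|lebesgue. norm (wt \<alpha> (weylD \<alpha> f) t) powr p)"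
  proof (intro Bochner_Integration.integral_cong refl)
    fix t :: real
    show "indicator {0..} t *\<^sub>R (cmod (weyl_deriv \<alpha> f t) powr p * t powr (\<alpha> * p)) = norm (wt \<alpha> (weylD \<alpha> f) t) powr p"
    proof (cases "t > 0")
      case True
      then show ?thesis using weyl_deriv_weylD[OF a f, of t]
        by (simp add: wt_def powr_mult powr_powr mult_ac)
    next
      case False
      then show ?thesis by (auto simp: wt_def indicator_def)
    qed
  qed
  also have "\<dots> = (LINT t|lborel. norm (wt \<alpha> (weylD \<alpha> f) t) powr p)"
    by (rule integral_completion) simp
  finally show ?thesis using G by (simp add: schwartz_norm_def pnorm_def)
qed

lemma schwartz_norm_nonneg: "\<alpha> > 0 \<Longrightarrow> schwartz_norm \<alpha> p f \<ge> 0"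
  by (simp add: schwartz_norm_def Gamma_real_nonneg)

text \<open>A Bochner integral gives an upper bound only if it converges; \<open>wt_Lp\<close>
  provides the convergence.\<close>

lemma schwartz_norm_Lp_le:
  assumes a: "\<alpha> > 0" and f: "f \<in> schwartz_halfline" and p: "p \<ge> 1"
  shows "Lp_le lborel p (wt \<alpha> (weylD \<alpha> f)) (Gamma (\<alpha> + 1) * schwartz_norm \<alpha> p f)"
proof -
  have "rapid (weylD \<alpha> f)" using a f by (intro schwartz_rapid weylD_schwartz)
  from wt_Lp[OF this _ p, of \<alpha>] obtain K where "Lp_le lborel p (wt \<alpha> (weylD \<alpha> f)) K" using a by auto
  then show ?thesis unfolding schwartz_norm_pnorm[OF assms] using p Lp_le_integrable Lp_leD(1)
    by (intro Lp_le_pnorm) (blast, blast, simp)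
qed

lemma schwartz_norm_le:
  assumes a: "\<alpha> > 0" and f: "f \<in> schwartz_halfline" and p: "p \<ge> 1"
    and "Lp_le lborel p (wt \<alpha> (weylD \<alpha> f)) (Gamma (\<alpha> + 1) * K)"
  shows "schwartz_norm \<alpha> p f \<le> K"
proof -
  have G: "Gamma (\<alpha> + 1) > 0" using a by (simp add: Gamma_real_pos)
  have "Gamma (\<alpha> + 1) * schwartz_norm \<alpha> p f \<le> Gamma (\<alpha> + 1) * K"
    unfolding schwartz_norm_pnorm[OF a f p] using assms by (intro pnorm_le) auto
  then show ?thesis using G by simp
qed

lemma schwartz_norm_triangle:
  assumes a: "\<alpha> > 0" and f: "f \<in> schwartz_halfline" and g: "g \<in> schwartz_halfline" and p: "p \<ge> 1"
  shows "schwartz_norm \<alpha> p (\<lambda>t. f t + g t) \<le> schwartz_norm \<alpha> p f + schwartz_norm \<alpha> p g"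
proof (rule schwartz_norm_le[OF a schwartz_add[OF f g] p])
  have "Lp_le lborel p (wt \<alpha> (weylD \<alpha> (\<lambda>t. f t + g t))) (Gamma (\<alpha> + 1) * schwartz_norm \<alpha> p f + Gamma (\<alpha> + 1) * schwartz_norm \<alpha> p g)"
  proof (rule wt_add_Lp_le[OF schwartz_norm_Lp_le[OF a f p] schwartz_norm_Lp_le[OF a g p] p])
    show "rapid (weylD \<alpha> (\<lambda>t. f t + g t))" using a f g by (intro schwartz_rapid weylD_schwartz schwartz_add)
    show "cmod (weylD \<alpha> (\<lambda>t. f t + g t) t) \<le> cmod (weylD \<alpha> f t) + cmod (weylD \<alpha> g t)" if "t > 0" for t
      using weylD_add[OF a f g, of t] that norm_triangle_ineq[of "weylD \<alpha> f t" "weylD \<alpha> g t"] by simp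
  qed
  then show "Lp_le lborel p (wt \<alpha> (weylD \<alpha> (\<lambda>t. f t + g t))) (Gamma (\<alpha> + 1) * (schwartz_norm \<alpha> p f + schwartz_norm \<alpha> p g))"
    by (simp add: distrib_left)
qed

lemma schwartz_norm_diff_le:
  assumes a: "\<alpha> > 0" and f: "f \<in> schwartz_halfline" and g: "g \<in> schwartz_halfline" and p: "p \<ge> 1"
  shows "schwartz_norm \<alpha> p f - schwartz_norm \<alpha> p g \<le> schwartz_norm \<alpha> p (\<lambda>t. f t - g t)"
  using schwartz_norm_triangle[OF a schwartz_diff[OF f g] g p] by simp

lemma schwartz_norm_minus: "schwartz_norm \<alpha> p (\<lambda>t. f t - g t) = schwartz_norm \<alpha> p (\<lambda>t. g t - f t)"
  if "\<alpha> > 0" "f \<in> schwartz_halfline" "g \<in> schwartz_halfline" "p \<ge> 1"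
proof -
  have e: "wt \<alpha> (weylD \<alpha> (\<lambda>t. g t - f t)) = wt \<alpha> (weylD \<alpha> (\<lambda>t. f t - g t))"
  proof (rule wt_cong)
    fix t :: real assume t: "t > 0"
    \<comment> \<open>Oddness is drawn from additivity alone: the two differences add up to the zero
      function, and \<open>weylD\<close> of the zero function equals its own double.\<close>
    have "weylD \<alpha> (\<lambda>t. (f t - g t) + (g t - f t)) t = weylD \<alpha> (\<lambda>t. f t - g t) t + weylD \<alpha> (\<lambda>t. g t - f t) t"
      using that t by (intro weylD_add schwartz_diff) auto
    moreover have "weylD \<alpha> (\<lambda>t. 0) t = weylD \<alpha> (\<lambda>t. 0) t + weylD \<alpha> (\<lambda>t. 0) t"
      using weylD_add[of \<alpha> "\<lambda>t. 0" "\<lambda>t. 0" t] that t schwartz_diff[OF that(2) that(2)] by simp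
    ultimately have "weylD \<alpha> (\<lambda>t. g t - f t) t = - weylD \<alpha> (\<lambda>t. f t - g t) t" by (simp add: eq_neg_iff_add_eq_0 add.commute)
    then show "cmod (weylD \<alpha> (\<lambda>t. g t - f t) t) = cmod (weylD \<alpha> (\<lambda>t. f t - g t) t)" by simp
  qed
  have "Gamma (\<alpha> + 1) * schwartz_norm \<alpha> p (\<lambda>t. f t - g t) = Gamma (\<alpha> + 1) * schwartz_norm \<alpha> p (\<lambda>t. g t - f t)"
    using that by (simp add: schwartz_norm_pnorm schwartz_diff e)
  moreover have "Gamma (\<alpha> + 1) > 0" using that by (simp add: Gamma_real_pos)
  ultimately show ?thesis by simp
qed

lemma schwartz_norm_mult:
  assumes a: "\<alpha> > 0" and pq: "p > 1" "q > 1" "1 / p + 1 / q = 1"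
  shows "\<exists>C>0. \<forall>u\<in>schwartz_halfline. \<forall>v\<in>schwartz_halfline.
    schwartz_norm \<alpha> 1 (\<lambda>t. u t * v t) \<le> C * schwartz_norm \<alpha> p u * schwartz_norm \<alpha> q v"
proof -
  let ?b = "\<alpha> - real (weyl_order \<alpha>)" and ?G = "Gamma (\<alpha> + 1)"
  have G: "?G > 0" using a by (simp add: Gamma_real_pos)
  obtain C where C: "C \<ge> 0" and bd: "\<forall>u\<in>schwartz_halfline. \<forall>v\<in>schwartz_halfline. \<forall>a\<ge>0. \<forall>b\<ge>0. \<forall>K L.
     Lp_le lborel p (wt (?b + a + real (weyl_order \<alpha>)) (weylD \<alpha> u)) K \<longrightarrow>
     Lp_le lborel q (wt (?b + b + real (weyl_order \<alpha>)) (weylD \<alpha> v)) L \<longrightarrow>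
     Lp_le lborel 1 (wt (?b + a + b + real (weyl_order \<alpha>)) (weylD \<alpha> (\<lambda>t. u t * v t))) (C * (K * L))"
    using weyl_product_bound[OF weyl_order_bounds[OF a] pq, of "weyl_order \<alpha>"] unfolding weylD_def[symmetric] by (elim exE conjE) rule
  show ?thesis
  \<comment> \<open>The two norms on the right bring two factors
    \<open>Gamma (\<alpha> + 1)\<close>, the norm on the left takes one away. The summand 1 makes
    the constant positive even if \<open>C = 0\<close>.\<close>
  proof (intro exI[of _ "C * ?G + 1"] conjI ballI)
    show "C * ?G + 1 > 0" using C G by (simp add: add_nonneg_pos)
    fix u v assume u: "u \<in> schwartz_halfline" and v: "v \<in> schwartz_halfline"
    let ?U = "schwartz_norm \<alpha> p u" and ?V = "schwartz_norm \<alpha> q v"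
    have "Lp_le lborel 1 (wt \<alpha> (weylD \<alpha> (\<lambda>t. u t * v t))) (C * ((?G * ?U) * (?G * ?V)))"
      using bd[rule_format, OF u v order_refl order_refl, of "?G * ?U" "?G * ?V"] schwartz_norm_Lp_le[OF a u, of p] schwartz_norm_Lp_le[OF a v, of q] pq by simp
    then have "schwartz_norm \<alpha> 1 (\<lambda>t. u t * v t) \<le> C * ?G * ?U * ?V"
      by (intro schwartz_norm_le[OF a schwartz_mult[OF u v]]) (simp_all add: mult_ac)
    also have "\<dots> \<le> (C * ?G + 1) * ?U * ?V"
      using schwartz_norm_nonneg[OF a] by (intro mult_right_mono) auto
    finally show "schwartz_norm \<alpha> 1 (\<lambda>t. u t * v t) \<le> (C * ?G + 1) * ?U * ?V" .
  qed
qed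

section \<open>The norm of a limit of Schwartz functions\<close>

lemma fdiff_pow_cong:
  assumes "\<And>t. t \<ge> 0 \<Longrightarrow> f t = g t" "t \<ge> 0" "h \<ge> 0"
  shows "(fdiff h ^^ k) f t = (fdiff h ^^ k) g t"
  using assms(2) by (induction k arbitrary: t) (use assms in \<open>auto simp: fdiff_def\<close>)

lemma fdiff_pow_add: "(fdiff h ^^ k) (\<lambda>t. f t + g t) t = (fdiff h ^^ k) f t + (fdiff h ^^ k) g t"
  by (induction k arbitrary: t) (auto simp: fdiff_def)

text \<open>
  The norm is recovered from iterated difference quotients of \<open>weylJ \<gamma> (w n)\<close>. These are
  dominated by the norm, and for a fixed step they tend to \<open>0\<close> with the \<open>Lp\<close> norm of \<open>w m\<close>, because the
  differenced Weyl kernel is integrable. Comparing \<open>w n\<close> with \<open>w m\<close> and letting first \<open>m\<close> and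
  then the step pass to the limit gives the bound without using completeness of \<open>Lp\<close>.
\<close>

lemma schwartz_norm_small:
  assumes a: "\<alpha> > 0" and p: "p \<ge> 1" and w: "\<And>n. w n \<in> schwartz_halfline" and e: "\<epsilon> > 0"
    and n: "\<And>m. m \<ge> N \<Longrightarrow> Lp_le lborel p (wt \<alpha> (weylD \<alpha> (\<lambda>t. w n t - w m t))) \<epsilon>"
    and lim: "\<And>\<delta>. \<delta> > 0 \<Longrightarrow> \<exists>m\<ge>N. Lp_le lborel p (wt 0 (w m)) \<delta>"
  shows "Lp_le lborel p (wt \<alpha> (weylD \<alpha> (w n))) \<epsilon>"
proof -
  define \<gamma> where "\<gamma> = 1 - (\<alpha> - real (weyl_order \<alpha>))"
  have g: "0 \<le> \<gamma>" "\<gamma> < 1" using weyl_order_bounds[OF a] by (auto simp: \<gamma>_def)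
  let ?k = "Suc (weyl_order \<alpha>)"
  have weylD: "weylD \<alpha> f = weylJ \<gamma> (nderiv ?k f)" for f by (simp add: weylD_def \<gamma>_def)
  have weylJs: "weylJ \<gamma> f \<in> schwartz_halfline" if "f \<in> schwartz_halfline" for f using that g by (intro weylJ_schwartz) auto
  have weylDn: "wt \<alpha> (nderiv ?k (weylJ \<gamma> f)) = wt \<alpha> (weylD \<alpha> f)" if "f \<in> schwartz_halfline" for f
    unfolding weylD using that g nderiv_weylJ[OF that, of \<gamma> _ ?k] by (intro wt_cong) (simp del: nderiv.simps)
  \<comment> \<open>The cut-off at \<open>j + 1\<close> bounds the weight by a constant, so that
    smallness of \<open>w m\<close> in unweighted Lp becomes usable in the weighted norm. For fixed
    \<open>t\<close> it has no effect once \<open>j\<close> is large.\<close>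
  define f where "f j t = real (Suc j) ^ ?k *\<^sub>R (if t \<le> real (Suc j) then wt \<alpha> ((fdiff (1 / real (Suc j)) ^^ ?k) (weylJ \<gamma> (w n))) t else 0)" for j t
  show ?thesis
  proof (rule Lp_le_Fatou[where f = f])
    fix j
    define h where "h = 1 / real (Suc j)"
    define R where "R = real (Suc j)"
    have h: "h > 0" and R: "R > 0" "R * h = 1" by (auto simp: h_def R_def)
    let ?d = "\<lambda>f. (fdiff h ^^ ?k) (weylJ \<gamma> f)"
    have ds: "?d f \<in> schwartz_halfline" if "f \<in> schwartz_halfline" for f
      using that h by (intro fdiff_pow_schwartz weylJs) auto
    have [measurable]: "wt c (?d f) \<in> borel_measurable borel" if "f \<in> schwartz_halfline" for f c
      using ds[OF that] by (intro wt_borel schwartz_rapid)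
    obtain C where C: "C \<ge> 0" "\<And>w K. w \<in> schwartz_halfline \<Longrightarrow> Lp_le lborel p (wt 0 w) K \<Longrightarrow> Lp_le lborel p (wt 0 (fdiff h (weylJ \<gamma> w))) (C * K)"
      using Lp_le_wt0_fdiff_weylJ[OF g h p] by blast
    \<comment> \<open>The total cost of the \<open>w m\<close> term: \<open>R powr \<alpha>\<close>
      for the weight below the cut-off, \<open>C\<close> for the difference absorbed by the Weyl
      integral, and 2 for each further difference. Adding 1 allows division by \<open>C'\<close>.
      The index \<open>m\<close> is chosen only after step and cut-off, on which \<open>C'\<close>
      depends.\<close>
    define C' where "C' = R powr \<alpha> * (2 ^ weyl_order \<alpha> * C) + 1"
    have C': "C' > 0" using C(1) by (simp add: C'_def add_nonneg_pos)
    have "Lp_le lborel p (\<lambda>t. if t \<le> R then wt \<alpha> (?d (w n)) t else 0) (h ^ ?k * \<epsilon>)"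
    proof (rule Lp_le_closed)
      fix \<eta> :: real assume eta: "\<eta> > 0"
      define \<delta> where "\<delta> = \<eta> / C'"
      have d: "\<delta> > 0" "C' * \<delta> = \<eta>" using eta C' by (auto simp: \<delta>_def)
      obtain m where m: "m \<ge> N" "Lp_le lborel p (wt 0 (w m)) \<delta>" using lim[OF d(1)] by blast
      have wnm: "(\<lambda>t. w n t - w m t) \<in> schwartz_halfline" using w by (intro schwartz_diff)
      have 1: "Lp_le lborel p (wt \<alpha> (?d (\<lambda>t. w n t - w m t))) (h ^ ?k * \<epsilon>)"
        using a p h n[OF m(1)] wnm by (intro Lp_le_wt_fdiff_pow weylJs) (auto simp only: weylDn less_imp_le)
      \<comment> \<open>Of the \<open>weyl_order \<alpha> + 1\<close> differences one is spent on
        making the Weyl integral bounded on Lp. The remaining ones act on an Lp function and are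
        bounded trivially.\<close>
      have "Lp_le lborel p (wt 0 ((fdiff h ^^ weyl_order \<alpha>) (fdiff h (weylJ \<gamma> (w m))))) (2 ^ weyl_order \<alpha> * (C * \<delta>))"
        using p h w m by (intro Lp_le_wt0_fdiff_pow C fdiff_schwartz weylJs) auto
      then have "Lp_le lborel p (wt 0 (?d (w m))) (2 ^ weyl_order \<alpha> * (C * \<delta>))"
        by (simp add: funpow_swap1)
      then have 2: "Lp_le lborel p (\<lambda>t. R powr \<alpha> *\<^sub>R wt 0 (?d (w m)) t) (\<bar>R powr \<alpha>\<bar> * (2 ^ weyl_order \<alpha> * (C * \<delta>)))"
        using p by (intro Lp_le_scaleR) auto
      show "Lp_le lborel p (\<lambda>t. if t \<le> R then wt \<alpha> (?d (w n)) t else 0) (h ^ ?k * \<epsilon> + \<eta>)"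
      proof (rule Lp_le_mono[OF Lp_le_Minkowski[OF 1 2 p]])
        show "(\<lambda>t. if t \<le> R then wt \<alpha> (?d (w n)) t else 0) \<in> borel_measurable lborel" using w by measurable
        show "h ^ ?k * \<epsilon> + \<bar>R powr \<alpha>\<bar> * (2 ^ weyl_order \<alpha> * (C * \<delta>)) \<le> h ^ ?k * \<epsilon> + \<eta>"
          using d by (simp add: C'_def algebra_simps)
        fix t :: real
        show "norm (if t \<le> R then wt \<alpha> (?d (w n)) t else 0) \<le> norm (wt \<alpha> (?d (\<lambda>t. w n t - w m t)) t + R powr \<alpha> *\<^sub>R wt 0 (?d (w m)) t)"
        proof (cases "0 < t \<and> t \<le> R")
          case True
          have "?d (w n) t = (fdiff h ^^ ?k) (\<lambda>t. weylJ \<gamma> (\<lambda>t. w n t - w m t) t + weylJ \<gamma> (w m) t) t"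
          proof (rule fdiff_pow_cong)
            fix s :: real assume s: "s \<ge> 0"
            show "weylJ \<gamma> (w n) s = weylJ \<gamma> (\<lambda>t. w n t - w m t) s + weylJ \<gamma> (w m) s"
              using weylJ_add[OF wnm w[of m] _ _ s, of \<gamma>] g by simp
          qed (use True h in auto)
          then have e: "?d (w n) t = ?d (\<lambda>t. w n t - w m t) t + ?d (w m) t" by (simp only: fdiff_pow_add)
          have "t powr \<alpha> \<le> R powr \<alpha>" using True a by (intro powr_mono2) auto
          then have "t powr \<alpha> * cmod (?d (w m) t) \<le> R powr \<alpha> * cmod (?d (w m) t)" by (rule mult_right_mono) simp
          moreover have "t powr \<alpha> * cmod (?d (w n) t) \<le> t powr \<alpha> * (cmod (?d (\<lambda>t. w n t - w m t) t) + cmod (?d (w m) t))"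
            unfolding e by (intro mult_left_mono norm_triangle_ineq) auto
          ultimately have "t powr \<alpha> * cmod (?d (w n) t) \<le> t powr \<alpha> * cmod (?d (\<lambda>t. w n t - w m t) t) + R powr \<alpha> * cmod (?d (w m) t)"
            by (simp add: distrib_left)
          then show ?thesis using True by (simp add: wt_def del: funpow.simps)
        next
          case False
          then show ?thesis by (auto simp: wt_def)
        qed
      qed (use p in auto)
    qed (use p e h in auto)
    from Lp_le_scaleR[OF this, of "R ^ ?k"] p
    have "Lp_le lborel p (\<lambda>t. R ^ ?k *\<^sub>R (if t \<le> R then wt \<alpha> (?d (w n)) t else 0)) (\<bar>R ^ ?k\<bar> * (h ^ ?k * \<epsilon>))" by simp
    moreover have "\<bar>R ^ ?k\<bar> * (h ^ ?k * \<epsilon>) = \<epsilon>"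
    proof -
      have "\<bar>R ^ ?k\<bar> * (h ^ ?k * \<epsilon>) = (R * h) ^ ?k * \<epsilon>" using R(1) by (simp only: power_mult_distrib abs_of_pos zero_less_power mult.assoc)
      then show ?thesis using R(2) by simp
    qed
    ultimately have "Lp_le lborel p (\<lambda>t. R ^ ?k *\<^sub>R (if t \<le> R then wt \<alpha> (?d (w n)) t else 0)) \<epsilon>" by (simp only:)
    then show "Lp_le lborel p (f j) \<epsilon>" unfolding f_def R_def h_def .
  next
    fix t :: real
    show "(\<lambda>j. norm (f j t)) \<longlonglongrightarrow> norm (wt \<alpha> (weylD \<alpha> (w n)) t)"
    proof (cases "t > 0")
      case True
      have "(\<lambda>j. real (Suc j) ^ ?k *\<^sub>R (fdiff (1 / real (Suc j)) ^^ ?k) (weylJ \<gamma> (w n)) t) \<longlonglongrightarrow> nderiv ?k (weylJ \<gamma> (w n)) t"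
        using True w by (intro fdiff_pow_tendsto weylJs) auto
      also have "nderiv ?k (weylJ \<gamma> (w n)) t = weylD \<alpha> (w n) t"
        unfolding weylD using True g w by (intro nderiv_weylJ) auto
      finally have "(\<lambda>j. t powr \<alpha> * cmod (real (Suc j) ^ ?k *\<^sub>R (fdiff (1 / real (Suc j)) ^^ ?k) (weylJ \<gamma> (w n)) t)) \<longlonglongrightarrow> t powr \<alpha> * cmod (weylD \<alpha> (w n) t)"
        by (intro tendsto_intros)
      moreover have "\<forall>\<^sub>F j in sequentially. t powr \<alpha> * cmod (real (Suc j) ^ ?k *\<^sub>R (fdiff (1 / real (Suc j)) ^^ ?k) (weylJ \<gamma> (w n)) t) = norm (f j t)"
      proof -
        obtain J where J: "t \<le> real J" using real_arch_simple by blast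
        show ?thesis unfolding eventually_sequentially
        proof (intro exI[of _ J] allI impI)
          fix j assume "j \<ge> J"
          then have "t \<le> real (Suc j)" using J by simp
          then show "t powr \<alpha> * cmod (real (Suc j) ^ ?k *\<^sub>R (fdiff (1 / real (Suc j)) ^^ ?k) (weylJ \<gamma> (w n)) t) = norm (f j t)"
            unfolding f_def wt_def using True by (simp only: norm_scaleR if_True real_norm_def real_scaleR_def abs_mult abs_of_nonneg powr_ge_zero norm_ge_zero mult.left_commute)
        qed
      qed
      ultimately have "(\<lambda>j. norm (f j t)) \<longlonglongrightarrow> t powr \<alpha> * cmod (weylD \<alpha> (w n) t)"
        by (rule Lim_transform_eventually)
      then show ?thesis using True by (simp add: wt_def)
    qed (simp add: f_def wt_def)
  qed (use p a w in \<open>auto intro!: wt_borel schwartz_rapid weylD_schwartz\<close>)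
qed

section \<open>The completed norm and its independence of the representing sequence\<close>

lemma schwartz_Leb_Lp_le:
  assumes "f \<in> schwartz_halfline" "p \<ge> 1"
  shows "Lp_le Leb p f (Lp_norm p f)"
proof -
  obtain K where "Lp_le lborel p (wt 0 f) K" using wt_Lp[OF schwartz_rapid[OF assms(1)], of 0 p] assms by auto
  then have "Lp_le Leb p f K" using Lp_le_Leb_iff[OF schwartz_rapid[OF assms(1)]] by simp
  then have "f \<in> Lp_halfline p" by (rule Lp_halflineI)
  then show ?thesis using assms by (intro Lp_halflineD) auto
qed

text \<open>Integrability of the difference has to be established first, since
  \<open>Lp_norm\<close> would be 0 for a non-integrable power and then bound nothing.\<close>

lemma completion_seq_Lp_le:
  assumes "completion_seq \<alpha> p \<phi> f" "p \<ge> 1"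
  shows "Lp_le Leb p (\<lambda>t. \<phi> n t - f t) (Lp_norm p (\<lambda>t. \<phi> n t - f t))"
proof -
  have "\<phi> n \<in> schwartz_halfline" "f \<in> Lp_halfline p" using assms by (auto simp: completion_seq_def)
  then have "Lp_le Leb p (\<lambda>t. \<phi> n t - f t) (Lp_norm p (\<phi> n) + Lp_norm p f)"
    using assms(2) by (intro Lp_le_diff schwartz_Leb_Lp_le Lp_halflineD) auto
  then show ?thesis using assms(2) by (intro Lp_halflineD[OF Lp_halflineI]) auto
qed

text \<open>This is the injectivity of the extended inclusion into Lp. The differences
  \<open>\<phi> n - \<psi> n\<close> are Cauchy in the norm and tend to 0 in Lp because both
  sequences have the limit \<open>f\<close>; \<open>schwartz_norm_small\<close> then turns the
  Cauchy bound into a bound for the differences themselves.\<close>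

lemma completion_seq_unique:
  assumes a: "\<alpha> > 0" and p: "p \<ge> 1" and \<phi>: "completion_seq \<alpha> p \<phi> f" and \<psi>: "completion_seq \<alpha> p \<psi> f"
  shows "(\<lambda>n. schwartz_norm \<alpha> p (\<lambda>t. \<phi> n t - \<psi> n t)) \<longlonglongrightarrow> 0"
proof (rule LIMSEQ_I)
  fix r :: real assume r: "r > 0"
  have G: "Gamma (\<alpha> + 1) > 0" using a by (simp add: Gamma_real_pos)
  have S: "\<phi> n \<in> schwartz_halfline" "\<psi> n \<in> schwartz_halfline" for n using \<phi> \<psi> by (auto simp: completion_seq_def)
  define w where "w n t = \<phi> n t - \<psi> n t" for n t
  have w: "w n \<in> schwartz_halfline" for n unfolding w_def using S by (intro schwartz_diff)
  \<comment> \<open>Two differences, each below \<open>r / 4\<close>, combine to a bound of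
    \<open>r / 2\<close>. It survives the limit as a weak inequality and is still strictly below
    \<open>r\<close>.\<close>
  obtain N1 where N1: "\<And>m n. m \<ge> N1 \<Longrightarrow> n \<ge> N1 \<Longrightarrow> schwartz_norm \<alpha> p (\<lambda>t. \<phi> m t - \<phi> n t) < r / 4"
    using \<phi> r unfolding completion_seq_def by (metis zero_less_divide_iff zero_less_numeral)
  obtain N2 where N2: "\<And>m n. m \<ge> N2 \<Longrightarrow> n \<ge> N2 \<Longrightarrow> schwartz_norm \<alpha> p (\<lambda>t. \<psi> m t - \<psi> n t) < r / 4"
    using \<psi> r unfolding completion_seq_def by (metis zero_less_divide_iff zero_less_numeral)
  define N where "N = max N1 N2"
  have cauchy: "Lp_le lborel p (wt \<alpha> (weylD \<alpha> (\<lambda>t. w n t - w m t))) (Gamma (\<alpha> + 1) * (r / 2))" if "n \<ge> N" "m \<ge> N" for n m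
  proof -
    have s1: "(\<lambda>t. \<phi> n t - \<phi> m t) \<in> schwartz_halfline" and s2: "(\<lambda>t. \<psi> m t - \<psi> n t) \<in> schwartz_halfline"
      using S by (auto intro: schwartz_diff)
    have e: "(\<lambda>t. w n t - w m t) = (\<lambda>t. (\<phi> n t - \<phi> m t) + (\<psi> m t - \<psi> n t))" by (auto simp: w_def)
    have "schwartz_norm \<alpha> p (\<lambda>t. w n t - w m t) \<le> r / 4 + r / 4"
      unfolding e using schwartz_norm_triangle[OF a s1 s2 p] N1[of n m] N2[of m n] that by (simp add: N_def)
    then have "Gamma (\<alpha> + 1) * schwartz_norm \<alpha> p (\<lambda>t. w n t - w m t) \<le> Gamma (\<alpha> + 1) * (r / 2)"
      using G by (intro mult_left_mono) auto
    then show ?thesis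
      using p Lp_leD(1)[OF schwartz_norm_Lp_le[OF a schwartz_diff[OF w w] p]]
      by (intro Lp_le_mono[OF schwartz_norm_Lp_le[OF a schwartz_diff[OF w w] p]]) auto
  qed
  have lim: "\<exists>m\<ge>N. Lp_le lborel p (wt 0 (w m)) \<delta>" if d: "\<delta> > 0" for \<delta>
  proof -
    have "(\<lambda>n. Lp_norm p (\<lambda>t. \<phi> n t - f t) + Lp_norm p (\<lambda>t. \<psi> n t - f t)) \<longlonglongrightarrow> 0 + 0"
      using \<phi> \<psi> by (intro tendsto_add) (auto simp: completion_seq_def)
    then have "\<forall>\<^sub>F n in sequentially. Lp_norm p (\<lambda>t. \<phi> n t - f t) + Lp_norm p (\<lambda>t. \<psi> n t - f t) < \<delta>"
      using d by (intro order_tendstoD(2)) auto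
    then have "\<forall>\<^sub>F n in sequentially. n \<ge> N \<and> Lp_norm p (\<lambda>t. \<phi> n t - f t) + Lp_norm p (\<lambda>t. \<psi> n t - f t) < \<delta>"
      using eventually_ge_at_top[of N] by eventually_elim simp
    then obtain m where m: "m \<ge> N" "Lp_norm p (\<lambda>t. \<phi> m t - f t) + Lp_norm p (\<lambda>t. \<psi> m t - f t) < \<delta>"
      using eventually_happens'[OF sequentially_bot] by blast
    have l: "Lp_le Leb p (\<lambda>t. (\<phi> m t - f t) - (\<psi> m t - f t)) (Lp_norm p (\<lambda>t. \<phi> m t - f t) + Lp_norm p (\<lambda>t. \<psi> m t - f t))"
      using p by (intro Lp_le_diff completion_seq_Lp_le[OF \<phi>] completion_seq_Lp_le[OF \<psi>])
    have "(\<lambda>t. (\<phi> m t - f t) - (\<psi> m t - f t)) = w m" by (auto simp: w_def)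
    with l have l': "Lp_le Leb p (w m) (Lp_norm p (\<lambda>t. \<phi> m t - f t) + Lp_norm p (\<lambda>t. \<psi> m t - f t))" by simp
    have "Lp_le Leb p (w m) \<delta>" using m p by (intro Lp_le_mono[OF l' Lp_leD(1)[OF l']]) auto
    then show ?thesis using m Lp_le_Leb_iff[OF schwartz_rapid[OF w]] by auto
  qed
  show "\<exists>no. \<forall>n\<ge>no. norm (schwartz_norm \<alpha> p (\<lambda>t. \<phi> n t - \<psi> n t) - 0) < r"
  proof (intro exI[of _ N] allI impI)
    fix n assume n: "n \<ge> N"
    have "Lp_le lborel p (wt \<alpha> (weylD \<alpha> (w n))) (Gamma (\<alpha> + 1) * (r / 2))"
      by (rule schwartz_norm_small[OF a p w _ cauchy[OF n] lim]) (use G r in auto)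
    then have "schwartz_norm \<alpha> p (w n) \<le> r / 2" by (rule schwartz_norm_le[OF a w p])
    then show "norm (schwartz_norm \<alpha> p (\<lambda>t. \<phi> n t - \<psi> n t) - 0) < r"
      using r schwartz_norm_nonneg[OF a, of p "w n"] unfolding w_def by simp
  qed
qed

lemma schwartz_norm_completion_Cauchy:
  assumes a: "\<alpha> > 0" and p: "p \<ge> 1" and \<phi>: "completion_seq \<alpha> p \<phi> f"
  shows "convergent (\<lambda>n. schwartz_norm \<alpha> p (\<phi> n))"
proof (rule Cauchy_convergent, rule CauchyI)
  fix e :: real assume e: "e > 0"
  have S: "\<phi> n \<in> schwartz_halfline" for n using \<phi> by (auto simp: completion_seq_def)
  obtain N where N: "\<And>m n. m \<ge> N \<Longrightarrow> n \<ge> N \<Longrightarrow> schwartz_norm \<alpha> p (\<lambda>t. \<phi> m t - \<phi> n t) < e"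
    using \<phi> e unfolding completion_seq_def by metis
  show "\<exists>M. \<forall>m\<ge>M. \<forall>n\<ge>M. norm (schwartz_norm \<alpha> p (\<phi> m) - schwartz_norm \<alpha> p (\<phi> n)) < e"
  proof (intro exI[of _ N] allI impI)
    fix m n assume "m \<ge> N" "n \<ge> N"
    then show "norm (schwartz_norm \<alpha> p (\<phi> m) - schwartz_norm \<alpha> p (\<phi> n)) < e"
      using schwartz_norm_diff_le[OF a S S p, of m n] schwartz_norm_diff_le[OF a S S p, of n m] N[of m n] N[of n m]
      by simp
  qed
qed

text \<open>By \<open>completion_seq_unique\<close> and the reverse triangle inequality any two
  representing sequences have the same limit of norms. The definite description in
  \<open>T_norm\<close> thus denotes it, and \<open>T_norm\<close> may be computed along whichever
  sequence is at hand.\<close>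

lemma T_norm_tendsto:
  assumes a: "\<alpha> > 0" and p: "p \<ge> 1" and \<phi>: "completion_seq \<alpha> p \<phi> f"
  shows "(\<lambda>n. schwartz_norm \<alpha> p (\<phi> n)) \<longlonglongrightarrow> T_norm \<alpha> p f"
proof -
  obtain r where r: "(\<lambda>n. schwartz_norm \<alpha> p (\<phi> n)) \<longlonglongrightarrow> r"
    using schwartz_norm_completion_Cauchy[OF assms] by (auto simp: convergent_def)
  have "(THE r. \<exists>\<phi>. completion_seq \<alpha> p \<phi> f \<and> (\<lambda>n. schwartz_norm \<alpha> p (\<phi> n)) \<longlonglongrightarrow> r) = r"
  proof (rule the_equality)
    fix s assume "\<exists>\<phi>. completion_seq \<alpha> p \<phi> f \<and> (\<lambda>n. schwartz_norm \<alpha> p (\<phi> n)) \<longlonglongrightarrow> s"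
    then obtain \<psi> where \<psi>: "completion_seq \<alpha> p \<psi> f" "(\<lambda>n. schwartz_norm \<alpha> p (\<psi> n)) \<longlonglongrightarrow> s" by blast
    have S: "\<phi> n \<in> schwartz_halfline" "\<psi> n \<in> schwartz_halfline" for n using \<phi> \<psi> by (auto simp: completion_seq_def)
    have "(\<lambda>n. schwartz_norm \<alpha> p (\<phi> n) - schwartz_norm \<alpha> p (\<psi> n)) \<longlonglongrightarrow> 0"
    proof (rule Lim_null_comparison[OF _ completion_seq_unique[OF a p \<phi> \<psi>(1)]], intro always_eventually allI)
      fix n
      show "norm (schwartz_norm \<alpha> p (\<phi> n) - schwartz_norm \<alpha> p (\<psi> n)) \<le> schwartz_norm \<alpha> p (\<lambda>t. \<phi> n t - \<psi> n t)"
        using schwartz_norm_diff_le[OF a S p, of n n] schwartz_norm_diff_le[OF a S(2,1) p, of n n]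
          schwartz_norm_minus[OF a S p, of n n] by simp
    qed
    moreover have "(\<lambda>n. schwartz_norm \<alpha> p (\<phi> n) - schwartz_norm \<alpha> p (\<psi> n)) \<longlonglongrightarrow> r - s" using r \<psi>(2) by (intro tendsto_diff)
    ultimately have "r - s = 0" using LIMSEQ_unique by blast
    then show "s = r" by simp
  qed (use r \<phi> in blast)
  then show ?thesis using r a by (simp add: T_norm_def)
qed

text \<open>Both requirements come from splitting a difference of products into two terms with one
  difference each. The Cauchy property uses the product estimate on the Schwartz class and the
  boundedness of convergent norm sequences; the L1 limit uses Hoelder's inequality.\<close>

lemma completion_seq_mult:
  assumes a: "\<alpha> > 0" and pq: "p > 1" "q > 1" "1 / p + 1 / q = 1"
    and \<phi>: "completion_seq \<alpha> p \<phi> f" and \<psi>: "completion_seq \<alpha> q \<psi> g"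
  shows "completion_seq \<alpha> 1 (\<lambda>n t. \<phi> n t * \<psi> n t) (\<lambda>t. f t * g t)"
proof -
  have p1: "p \<ge> 1" "q \<ge> 1" using pq by auto
  have S: "\<phi> n \<in> schwartz_halfline" "\<psi> n \<in> schwartz_halfline" for n using \<phi> \<psi> by (auto simp: completion_seq_def)
  have f: "Lp_le Leb p f (Lp_norm p f)" and g: "Lp_le Leb q g (Lp_norm q g)"
    using \<phi> \<psi> pq by (auto simp: completion_seq_def intro!: Lp_halflineD)
  obtain C where C: "C > 0" "\<And>u v. u \<in> schwartz_halfline \<Longrightarrow> v \<in> schwartz_halfline \<Longrightarrow>
      schwartz_norm \<alpha> 1 (\<lambda>t. u t * v t) \<le> C * schwartz_norm \<alpha> p u * schwartz_norm \<alpha> q v"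
    using schwartz_norm_mult[OF a pq] by blast
  note nn = schwartz_norm_nonneg[OF a]
  have "Bseq (\<lambda>n. schwartz_norm \<alpha> p (\<phi> n))" "Bseq (\<lambda>n. schwartz_norm \<alpha> q (\<psi> n))"
    using schwartz_norm_completion_Cauchy[OF a p1(1) \<phi>] schwartz_norm_completion_Cauchy[OF a p1(2) \<psi>]
    by (auto intro: convergent_imp_Bseq)
  then obtain A B where A: "A > 0" "\<And>n. schwartz_norm \<alpha> p (\<phi> n) \<le> A" and B: "B > 0" "\<And>n. schwartz_norm \<alpha> q (\<psi> n) \<le> B"
    using nn by (auto simp: Bseq_def)
  have cauchy: "\<exists>N. \<forall>m\<ge>N. \<forall>n\<ge>N. schwartz_norm \<alpha> 1 (\<lambda>t. \<phi> m t * \<psi> m t - \<phi> n t * \<psi> n t) < e" if e: "e > 0" for e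
  proof -
    \<comment> \<open>Chosen so that each of the two terms, \<open>C * d1 * B\<close> and
      \<open>C * A * d2\<close>, equals \<open>e / 2\<close>.\<close>
    define d1 where "d1 = e / (2 * C * B)"
    define d2 where "d2 = e / (2 * C * A)"
    have d: "d1 > 0" "d2 > 0" using e A B C by (auto simp: d1_def d2_def)
    obtain N1 where N1: "\<And>m n. m \<ge> N1 \<Longrightarrow> n \<ge> N1 \<Longrightarrow> schwartz_norm \<alpha> p (\<lambda>t. \<phi> m t - \<phi> n t) < d1"
      using \<phi> d unfolding completion_seq_def by metis
    obtain N2 where N2: "\<And>m n. m \<ge> N2 \<Longrightarrow> n \<ge> N2 \<Longrightarrow> schwartz_norm \<alpha> q (\<lambda>t. \<psi> m t - \<psi> n t) < d2"
      using \<psi> d unfolding completion_seq_def by metis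
    show ?thesis
    proof (intro exI[of _ "max N1 N2"] allI impI)
      fix m n assume mn: "m \<ge> max N1 N2" "n \<ge> max N1 N2"
      have s1: "(\<lambda>t. \<phi> m t - \<phi> n t) \<in> schwartz_halfline" and s2: "(\<lambda>t. \<psi> m t - \<psi> n t) \<in> schwartz_halfline"
        using S by (auto intro: schwartz_diff)
      have e1: "(\<lambda>t. \<phi> m t * \<psi> m t - \<phi> n t * \<psi> n t) = (\<lambda>t. (\<phi> m t - \<phi> n t) * \<psi> m t + \<phi> n t * (\<psi> m t - \<psi> n t))"
        by (auto simp: algebra_simps)
      have "schwartz_norm \<alpha> 1 (\<lambda>t. \<phi> m t * \<psi> m t - \<phi> n t * \<psi> n t)
        \<le> schwartz_norm \<alpha> 1 (\<lambda>t. (\<phi> m t - \<phi> n t) * \<psi> m t) + schwartz_norm \<alpha> 1 (\<lambda>t. \<phi> n t * (\<psi> m t - \<psi> n t))"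
        unfolding e1 using S s1 s2 by (intro schwartz_norm_triangle[OF a] schwartz_mult) auto
      also have "\<dots> \<le> C * schwartz_norm \<alpha> p (\<lambda>t. \<phi> m t - \<phi> n t) * schwartz_norm \<alpha> q (\<psi> m)
          + C * schwartz_norm \<alpha> p (\<phi> n) * schwartz_norm \<alpha> q (\<lambda>t. \<psi> m t - \<psi> n t)"
        using S s1 s2 by (intro add_mono C(2))
      also have "\<dots> < C * d1 * B + C * A * d2"
      proof (rule add_less_le_mono)
        have "C * schwartz_norm \<alpha> p (\<lambda>t. \<phi> m t - \<phi> n t) * schwartz_norm \<alpha> q (\<psi> m) \<le> C * schwartz_norm \<alpha> p (\<lambda>t. \<phi> m t - \<phi> n t) * B"
          using C(1) nn B by (intro mult_left_mono) auto
        also have "\<dots> < C * d1 * B" using C(1) B N1[of m n] mn by simp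
        finally show "C * schwartz_norm \<alpha> p (\<lambda>t. \<phi> m t - \<phi> n t) * schwartz_norm \<alpha> q (\<psi> m) < C * d1 * B" .
        show "C * schwartz_norm \<alpha> p (\<phi> n) * schwartz_norm \<alpha> q (\<lambda>t. \<psi> m t - \<psi> n t) \<le> C * A * d2"
          using C(1) nn A N2[of m n] mn by (intro mult_mono) auto
      qed
      also have "\<dots> = e" using A B C by (simp add: d1_def d2_def)
      finally show "schwartz_norm \<alpha> 1 (\<lambda>t. \<phi> m t * \<psi> m t - \<phi> n t * \<psi> n t) < e" .
    qed
  qed
  have lim: "(\<lambda>n. Lp_norm 1 (\<lambda>t. \<phi> n t * \<psi> n t - f t * g t)) \<longlonglongrightarrow> 0"
  proof (rule Lim_null_comparison, intro always_eventually allI)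
    fix n
    let ?a = "Lp_norm p (\<lambda>t. \<phi> n t - f t)" and ?b = "Lp_norm q (\<lambda>t. \<psi> n t - g t)"
    note F = completion_seq_Lp_le[OF \<phi> p1(1), of n] and G = completion_seq_Lp_le[OF \<psi> p1(2), of n]
    \<comment> \<open>Writing \<open>\<psi> n\<close> as \<open>(\<psi> n - g) + g\<close> bounds
      its norm by quantities whose limits are known.\<close>
    have \<psi>n: "Lp_le Leb q (\<lambda>t. (\<psi> n t - g t) + g t) (?b + Lp_norm q g)"
      using p1 G g by (intro Lp_le_Minkowski)
    have "Lp_le Leb 1 (\<lambda>t. (\<phi> n t - f t) * \<psi> n t) (?a * (?b + Lp_norm q g))"
      using Lp_le_Holder_1[OF F \<psi>n pq] by simp
    moreover have "Lp_le Leb 1 (\<lambda>t. f t * (\<psi> n t - g t)) (Lp_norm p f * ?b)"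
      by (rule Lp_le_Holder_1[OF f G pq])
    ultimately have "Lp_le Leb 1 (\<lambda>t. (\<phi> n t - f t) * \<psi> n t + f t * (\<psi> n t - g t)) (?a * (?b + Lp_norm q g) + Lp_norm p f * ?b)"
      by (intro Lp_le_Minkowski) auto
    then have "Lp_le Leb 1 (\<lambda>t. \<phi> n t * \<psi> n t - f t * g t) (?a * (?b + Lp_norm q g) + Lp_norm p f * ?b)"
      by (simp add: algebra_simps)
    then show "norm (Lp_norm 1 (\<lambda>t. \<phi> n t * \<psi> n t - f t * g t)) \<le> ?a * (?b + Lp_norm q g) + Lp_norm p f * ?b"
      using Lp_norm_le Lp_norm_nonneg by (simp add: abs_of_nonneg)
  next
    have "(\<lambda>n. Lp_norm p (\<lambda>t. \<phi> n t - f t) * (Lp_norm q (\<lambda>t. \<psi> n t - g t) + Lp_norm q g) + Lp_norm p f * Lp_norm q (\<lambda>t. \<psi> n t - g t))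
       \<longlonglongrightarrow> 0 * (0 + Lp_norm q g) + Lp_norm p f * 0"
      using \<phi> \<psi> by (intro tendsto_intros) (auto simp: completion_seq_def)
    then show "(\<lambda>n. Lp_norm p (\<lambda>t. \<phi> n t - f t) * (Lp_norm q (\<lambda>t. \<psi> n t - g t) + Lp_norm q g) + Lp_norm p f * Lp_norm q (\<lambda>t. \<psi> n t - g t)) \<longlonglongrightarrow> 0"
      by simp
  qed
  show ?thesis unfolding completion_seq_def
    using S cauchy lim Lp_halflineI[OF Lp_le_Holder_1[OF f g pq]] by (auto intro: schwartz_mult)
qed

theorem theorem2:
  fixes \<alpha> p p' :: real
  assumes "\<alpha> \<ge> 0" and "1 < p" and "1 < p'" and "1 / p + 1 / p' = 1"
  shows "\<exists>C>0. \<forall>f \<in> T_space \<alpha> p. \<forall>g \<in> T_space \<alpha> p'.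
           (\<lambda>t. f t * g t) \<in> T_space \<alpha> 1 \<and>
           T_norm \<alpha> 1 (\<lambda>t. f t * g t) \<le> C * T_norm \<alpha> p f * T_norm \<alpha> p' g"
proof (cases "\<alpha> = 0")
  case True
  show ?thesis
  proof (intro exI[of _ 1] conjI ballI)
    fix f g assume "f \<in> T_space \<alpha> p" "g \<in> T_space \<alpha> p'"
    then have "Lp_le Leb p f (Lp_norm p f)" "Lp_le Leb p' g (Lp_norm p' g)"
      using True assms by (auto simp: T_space_def intro!: Lp_halflineD)
    from Lp_le_Holder_1[OF this assms(2-4)]
    have *: "Lp_le Leb 1 (\<lambda>t. f t * g t) (Lp_norm p f * Lp_norm p' g)" .
    show "(\<lambda>t. f t * g t) \<in> T_space \<alpha> 1" using Lp_halflineI[OF *] True by (simp add: T_space_def)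
    show "T_norm \<alpha> 1 (\<lambda>t. f t * g t) \<le> 1 * T_norm \<alpha> p f * T_norm \<alpha> p' g"
      using Lp_norm_le[OF *] True by (simp add: T_norm_def)
  qed simp
next
  case False
  then have a: "\<alpha> > 0" using assms by simp
  \<comment> \<open>The constant of the Schwartz class is kept unchanged: the products of
    representing sequences represent \<open>f * g\<close>, and the inequality passes to the limit of
    the three norms.\<close>
  obtain C where C: "C > 0" "\<And>u v. u \<in> schwartz_halfline \<Longrightarrow> v \<in> schwartz_halfline \<Longrightarrow>
      schwartz_norm \<alpha> 1 (\<lambda>t. u t * v t) \<le> C * schwartz_norm \<alpha> p u * schwartz_norm \<alpha> p' v"
    using schwartz_norm_mult[OF a assms(2-4)] by blast
  show ?thesis
  proof (intro exI[of _ C] conjI ballI C(1))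
    fix f g assume "f \<in> T_space \<alpha> p" "g \<in> T_space \<alpha> p'"
    then obtain \<phi> \<psi> where \<phi>: "completion_seq \<alpha> p \<phi> f" and \<psi>: "completion_seq \<alpha> p' \<psi> g"
      using False by (auto simp: T_space_def)
    note \<theta> = completion_seq_mult[OF a assms(2-4) \<phi> \<psi>]
    show "(\<lambda>t. f t * g t) \<in> T_space \<alpha> 1" using \<theta> False by (auto simp: T_space_def)
    show "T_norm \<alpha> 1 (\<lambda>t. f t * g t) \<le> C * T_norm \<alpha> p f * T_norm \<alpha> p' g"
    proof (rule LIMSEQ_le)
      show "(\<lambda>n. schwartz_norm \<alpha> 1 (\<lambda>t. \<phi> n t * \<psi> n t)) \<longlonglongrightarrow> T_norm \<alpha> 1 (\<lambda>t. f t * g t)"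
        using T_norm_tendsto[OF a _ \<theta>] by simp
      show "(\<lambda>n. C * schwartz_norm \<alpha> p (\<phi> n) * schwartz_norm \<alpha> p' (\<psi> n)) \<longlonglongrightarrow> C * T_norm \<alpha> p f * T_norm \<alpha> p' g"
        using assms by (intro tendsto_intros T_norm_tendsto a \<phi> \<psi>) auto
      show "\<exists>N. \<forall>n\<ge>N. schwartz_norm \<alpha> 1 (\<lambda>t. \<phi> n t * \<psi> n t) \<le> C * schwartz_norm \<alpha> p (\<phi> n) * schwartz_norm \<alpha> p' (\<psi> n)"
        using C(2) \<phi> \<psi> by (auto simp: completion_seq_def)
    qed
  qed
qed

end
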